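(* Let $V\in L^\infty(\mathbb{R}^d)$ with $\|V\|_\infty\leq C_V$ for some constant $C_V$, and $V\not\equiv0$. Then there exists a constant $M>0$ such that for any solution $u$ to $$-\Delta u+Vu=0\quad\text{in }\mathbb{R}^d$$ satisfying $\|u\|_{L^2(\mathbb{R}^d)}=1$, one has, for $R>0$ sufficiently large, $$\int_{B(0,R,R+1)}|u(x)|^2\,dx\geq M^{-1}R^{-4/3}e^{-M\|V\|_\infty^{2/3}R^{4/3}}.$$
   Context: $B(0,R,R+1)=B(0,R+1)\setminus\overline{B(0,R)}\subset\mathbb{R}^d$ denotes the annulus of inner radius $R$ and outer radius $R+1$ centered at $0$. *)

theory Defs
  imports "HOL-Probability.Essential_Supremum"
begin

text \<open>Complex-valued functions cover real-valued ones. An arbitrary Euclidean space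
  \<open>'a\<close> plays the role of d-dimensional space, with \<open>d = DIM('a) \<ge> 1\<close>.
  As usual, elements of Lebesgue spaces are represented by functions, and ``being zero''
  is understood almost everywhere.\<close>

definition in_Linf :: "('a::euclidean_space \<Rightarrow> complex) \<Rightarrow> bool" where
  "in_Linf f \<longleftrightarrow> f \<in> borel_measurable lebesgue \<and> esssup lebesgue (\<lambda>x. ereal (norm (f x))) < \<infinity>"

text \<open>Meaningful only for functions satisfying \<open>in_Linf\<close>: \<open>real_of_ereal\<close> sends infinity to 0.\<close>

definition Linf_norm :: "('a::euclidean_space \<Rightarrow> complex) \<Rightarrow> real" where
  "Linf_norm f = real_of_ereal (esssup lebesgue (\<lambda>x. ereal (norm (f x))))"

definition in_L2 :: "('a::euclidean_space \<Rightarrow> complex) \<Rightarrow> bool" where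
  "in_L2 f \<longleftrightarrow> f \<in> borel_measurable lebesgue \<and> integrable lebesgue (\<lambda>x. (norm (f x))\<^sup>2)"

definition L2_norm :: "('a::euclidean_space \<Rightarrow> complex) \<Rightarrow> real" where
  "L2_norm f = sqrt (LINT x|lebesgue. (norm (f x))\<^sup>2)"

definition locally_integrable :: "('a::euclidean_space \<Rightarrow> complex) \<Rightarrow> bool" where
  "locally_integrable f \<longleftrightarrow> (\<forall>K. compact K \<longrightarrow> set_integrable lebesgue K f)"

definition partial_deriv :: "'a::euclidean_space \<Rightarrow> ('a \<Rightarrow> real) \<Rightarrow> 'a \<Rightarrow> real" where
  "partial_deriv b f x = frechet_derivative f (at x) b"

primrec Ck :: "nat \<Rightarrow> ('a::euclidean_space \<Rightarrow> real) \<Rightarrow> bool" where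
  "Ck 0 f \<longleftrightarrow> continuous_on UNIV f"
| "Ck (Suc k) f \<longleftrightarrow> (\<forall>x. f differentiable (at x)) \<and> (\<forall>b\<in>Basis. Ck k (partial_deriv b f))"

definition test_function :: "('a::euclidean_space \<Rightarrow> real) \<Rightarrow> bool" where
  "test_function \<phi> \<longleftrightarrow> (\<forall>k. Ck k \<phi>) \<and> compact (closure {x. \<phi> x \<noteq> 0})"

definition laplacian :: "('a::euclidean_space \<Rightarrow> real) \<Rightarrow> 'a \<Rightarrow> real" where
  "laplacian \<phi> x = (\<Sum>b\<in>Basis. partial_deriv b (partial_deriv b \<phi>) x)"

text \<open>\<open>u\<close> solves \<open>- \<Delta> u + V u = 0\<close> on the whole space in the sense of distributions.
  Real-valued test functions suffice, by linearity. For essentially bounded \<open>V\<close>, the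
  integrability of \<open>V u\<close> follows from that of \<open>u\<close>.\<close>

definition schroedinger_solution ::
    "('a::euclidean_space \<Rightarrow> complex) \<Rightarrow> ('a \<Rightarrow> complex) \<Rightarrow> bool" where
  "schroedinger_solution V u \<longleftrightarrow>
     locally_integrable u \<and> locally_integrable (\<lambda>x. V x * u x) \<and>
     (\<forall>\<phi>. test_function \<phi> \<longrightarrow>
        (LINT x|lebesgue. - (u x * of_real (laplacian \<phi> x)) + V x * u x * of_real (\<phi> x)) = 0)"

definition annulus :: "real \<Rightarrow> real \<Rightarrow> 'a::euclidean_space set" where
  "annulus r s = ball 0 s - closure (ball 0 r)"

end

theory Submission
  imports Defs "HOL-Computational_Algebra.Polynomial"
begin

text \<open>
  Cut \<open>u\<close> off inside the annulus and apply a Carleman estimate to the result. Since the annulus is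
  the outer boundary region of the ball \<open>B(0, R + 1)\<close>, no singular weight is needed: with
  \<open>t = x \<bullet> e + 2 (R + 1)\<close>, which lies between \<open>R + 1\<close> and \<open>3 (R + 1)\<close> on that ball, the weight
  \<open>w = exp (l t\<^sup>2 / 2)\<close> gives \<open>8 l\<^sup>3 \<integral> t\<^sup>2 w\<^sup>2 f\<^sup>2 \<le> \<integral> w\<^sup>2 (\<Delta> f)\<^sup>2\<close> for test functions \<open>f\<close>. For
  \<open>8 l\<^sup>3 (R + 1)\<^sup>2 = 4 \<parallel>V\<parallel>\<^sup>2\<close> the contribution of \<open>V u\<close> is absorbed, and what remains on the right is
  supported in the annulus, where \<open>w\<^sup>2 \<le> exp (9 l (R + 1)\<^sup>2)\<close>; the exponent is of order
  \<open>\<parallel>V\<parallel>\<^bsup>2/3\<^esup> R\<^bsup>4/3\<^esup>\<close>. The gradient of \<open>u\<close> in the annulus is controlled by Caccioppoli's inequality.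
  The resulting inequality involves only weighted \<open>L\<^sup>2\<close> integrals of \<open>u\<close> and \<open>V u\<close>, so it passes from
  mollifications to \<open>u\<close> itself. Powers of \<open>R\<close> and constants depending on \<open>\<parallel>V\<parallel>\<close> are swallowed by
  a slightly larger constant in the exponential, because \<open>R\<close> may be taken large depending on \<open>V\<close>
  and \<open>u\<close>; hence \<open>M = 37\<close> works for all \<open>V\<close>.
\<close>

section \<open>Smooth functions\<close>

text \<open>The rate comes from the mismatch of two powers of \<open>l\<close>: the gain
  \<open>8 l^3 t^2\<close> is cubic, while \<open>w^2\<close> costs an exponential of
  \<open>l t^2\<close>, so that fixing \<open>l^3 R^2\<close> fixes \<open>l R^2\<close> as its cube
  root times \<open>R^(4/3)\<close>. The shift by \<open>2 (R + 1)\<close> keeps \<open>t\<close>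
  away from 0, where the gain would degenerate; on the inner ball nothing better than
  \<open>w \<ge> 1\<close> is used. Two obstacles shape the rest. A distributional solution offers
  no pointwise derivatives, so all gradients are eliminated while the function is still smooth, and
  the surviving weights only have to be continuous. Moreover, a complex \<open>V\<close> couples the
  real and imaginary parts of \<open>u\<close>, so the pointwise bound on \<open>V u\<close> fails
  for each part separately. The weighted inequality is therefore proved for pairs of real functions
  with \<open>\<Delta> p = q\<close>, with one weight serving all pairs, and the absorption is done
  only after adding the two parts.\<close>

definition smooth :: "('a::euclidean_space \<Rightarrow> real) \<Rightarrow> bool" where
  "smooth f \<longleftrightarrow> (\<forall>k. Ck k f)"

text \<open>Equivalent to compact support for the functions at hand
  (\<open>test_function_iff\<close>), but visibly stable under products, sums and
  differentiation.\<close>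

definition bounded_support :: "('a::euclidean_space \<Rightarrow> real) \<Rightarrow> bool" where
  "bounded_support f \<longleftrightarrow> (\<exists>r. \<forall>x. norm x > r \<longrightarrow> f x = 0)"

lemma Ck_imp_continuous: "Ck k f \<Longrightarrow> continuous_on UNIV f"
  by (cases k) (auto intro!: differentiable_imp_continuous_on simp: differentiable_on_def
      intro: differentiable_at_withinI)

lemma Ck_Suc_imp_Ck: "Ck (Suc k) f \<Longrightarrow> Ck k f"
proof (induction k arbitrary: f)
  case 0
  then show ?case using Ck_imp_continuous by fastforce
next
  case (Suc k)
  then show ?case by (metis Ck.simps(2))
qed

lemma smooth_continuous: "smooth f \<Longrightarrow> continuous_on A f"
  unfolding smooth_def using Ck_imp_continuous continuous_on_subset by blast

lemma smooth_measurable [measurable_dest]: "smooth f \<Longrightarrow> f \<in> borel_measurable borel"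
  by (intro borel_measurable_continuous_onI smooth_continuous)

lemma smooth_differentiable: "smooth f \<Longrightarrow> f differentiable (at x)"
  unfolding smooth_def by (metis Ck.simps(2))

lemma smooth_partial: "smooth f \<Longrightarrow> b \<in> Basis \<Longrightarrow> smooth (partial_deriv b f)"
  unfolding smooth_def by (metis Ck.simps(2))

section \<open>Calculus of partial derivatives\<close>

lemma has_derivative_partials:
  fixes f :: "'a::euclidean_space \<Rightarrow> real"
  assumes "f differentiable (at x)"
  shows "(f has_derivative (\<lambda>h. \<Sum>b\<in>Basis. (h \<bullet> b) * partial_deriv b f x)) (at x)"
proof -
  let ?D = "frechet_derivative f (at x)"
  have D: "(f has_derivative ?D) (at x)"
    using assms frechet_derivative_works by blast
  have lin: "linear ?D"
    using D has_derivative_linear by blast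
  have "?D h = (\<Sum>b\<in>Basis. (h \<bullet> b) * partial_deriv b f x)" for h
  proof -
    have "?D h = ?D (\<Sum>b\<in>Basis. (h \<bullet> b) *\<^sub>R b)"
      by (simp add: euclidean_representation)
    also have "\<dots> = (\<Sum>b\<in>Basis. (h \<bullet> b) * partial_deriv b f x)"
      using lin by (simp add: linear_sum linear_cmul partial_deriv_def)
    finally show ?thesis .
  qed
  then show ?thesis
    using D by (metis (no_types, lifting) ext)
qed

lemma partial_deriv_eqI:
  "(f has_derivative D) (at x) \<Longrightarrow> partial_deriv b f x = D b"
  unfolding partial_deriv_def using frechet_derivative_at by metis

lemma has_derivative_frechet:
  "f differentiable (at x) \<Longrightarrow> (f has_derivative frechet_derivative f (at x)) (at x)"
  using frechet_derivative_works by blast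

lemma partial_deriv_const [simp]: "partial_deriv b (\<lambda>x. c) x = 0"
  by (rule partial_deriv_eqI[where D = "\<lambda>_. 0", simplified]) simp

lemma partial_deriv_inner [simp]: "partial_deriv b (\<lambda>x. x \<bullet> a) x = b \<bullet> a"
  by (rule partial_deriv_eqI[where D = "\<lambda>h. h \<bullet> a"]) (auto intro!: derivative_eq_intros)

lemma partial_deriv_add:
  "f differentiable (at x) \<Longrightarrow> g differentiable (at x) \<Longrightarrow>
    partial_deriv b (\<lambda>x. f x + g x) x = partial_deriv b f x + partial_deriv b g x"
  unfolding partial_deriv_def[of _ f] partial_deriv_def[of _ g]
  by (rule partial_deriv_eqI) (auto intro!: derivative_eq_intros has_derivative_frechet)

lemma partial_deriv_mult:
  "f differentiable (at x) \<Longrightarrow> g differentiable (at x) \<Longrightarrow>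
    partial_deriv b (\<lambda>x. f x * g x) x = partial_deriv b f x * g x + f x * partial_deriv b g x"
  unfolding partial_deriv_def[of _ f] partial_deriv_def[of _ g]
  by (rule partial_deriv_eqI) (auto intro!: derivative_eq_intros has_derivative_frechet)

lemma has_real_derivative_partial:
  fixes h :: "real \<Rightarrow> real"
  assumes "h differentiable (at t)"
  shows "(h has_real_derivative partial_deriv 1 h t) (at t)"
proof -
  obtain D where "(h has_real_derivative D) (at t)"
    using assms real_differentiable_def by blast
  then show ?thesis
    using partial_deriv_eqI[of h "(*) D" t 1] by (auto simp: has_field_derivative_def)
qed

lemma partial_deriv_real_eqI:
  fixes h :: "real \<Rightarrow> real"
  shows "(h has_real_derivative D) (at t) \<Longrightarrow> partial_deriv 1 h t = D"
  using partial_deriv_eqI[of h "(*) D" t 1] by (auto simp: has_field_derivative_def)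

lemma has_derivative_compose_real:
  fixes h :: "real \<Rightarrow> real"
  assumes "h differentiable (at (f x))" "(f has_derivative D) (at x)"
  shows "((\<lambda>x. h (f x)) has_derivative (\<lambda>y. partial_deriv 1 h (f x) * D y)) (at x)"
  using has_derivative_compose[OF assms(2), of h "(*) (partial_deriv 1 h (f x))"]
    has_real_derivative_partial[OF assms(1)]
  by (simp add: has_field_derivative_def)

lemma partial_deriv_compose:
  fixes h :: "real \<Rightarrow> real"
  assumes "h differentiable (at (f x))" "f differentiable (at x)"
  shows "partial_deriv b (\<lambda>x. h (f x)) x = partial_deriv 1 h (f x) * partial_deriv b f x"
  using partial_deriv_eqI[OF has_derivative_compose_real[where D="frechet_derivative f (at x)"],
      OF assms(1) has_derivative_frechet[OF assms(2)], of b]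
  by (simp add: partial_deriv_def)

section \<open>Closure properties of smooth functions\<close>

lemma Ck_const [simp]: "Ck k (\<lambda>x. c)"
proof (induction k arbitrary: c)
  case (Suc k)
  have "partial_deriv b (\<lambda>x::'a. c) = (\<lambda>x. 0)" for b by auto
  with Suc show ?case by simp
qed auto

lemma Ck_inner [simp]: "Ck k (\<lambda>x. x \<bullet> a)"
proof (cases k)
  case (Suc k)
  have "partial_deriv b (\<lambda>x::'a. x \<bullet> a) = (\<lambda>x. b \<bullet> a)" for b by auto
  with Suc show ?thesis by simp
qed (auto intro!: continuous_intros)

lemma Ck_add: "Ck k f \<Longrightarrow> Ck k g \<Longrightarrow> Ck k (\<lambda>x. f x + g x)"
proof (induction k arbitrary: f g)
  case (Suc k)
  then have "partial_deriv b (\<lambda>x. f x + g x) = (\<lambda>x. partial_deriv b f x + partial_deriv b g x)"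
    for b by (auto simp: partial_deriv_add)
  with Suc show ?case by simp
qed (auto intro!: continuous_intros)

lemma Ck_mult: "Ck k f \<Longrightarrow> Ck k g \<Longrightarrow> Ck k (\<lambda>x. f x * g x)"
proof (induction k arbitrary: f g)
  case (Suc k)
  then have "partial_deriv b (\<lambda>x. f x * g x) =
      (\<lambda>x. partial_deriv b f x * g x + f x * partial_deriv b g x)" for b
    by (auto simp: partial_deriv_mult)
  moreover have "Ck k f" "Ck k g"
    using Suc.prems Ck_Suc_imp_Ck by blast+
  ultimately show ?case
    using Suc by (auto intro!: Ck_add)
qed (auto intro!: continuous_intros)

lemma Ck_compose:
  fixes h :: "real \<Rightarrow> real"
  shows "Ck k h \<Longrightarrow> Ck k f \<Longrightarrow> Ck k (\<lambda>x. h (f x))"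
proof (induction k arbitrary: h f)
  case 0
  then show ?case by (auto intro: continuous_on_compose2)
next
  case (Suc k)
  then have "partial_deriv b (\<lambda>x. h (f x)) =
      (\<lambda>x. partial_deriv 1 h (f x) * partial_deriv b f x)" for b
    by (auto simp: partial_deriv_compose)
  moreover have "Ck k f"
    using Suc.prems Ck_Suc_imp_Ck by blast
  moreover have "(\<lambda>x. h (f x)) differentiable (at x)" for x
    using Suc.prems has_derivative_compose_real has_derivative_frechet
    unfolding differentiable_def Ck.simps by blast
  ultimately show ?case
    using Suc by (auto intro!: Ck_mult)
qed

lemma has_derivative_reflect:
  fixes f :: "'a::euclidean_space \<Rightarrow> real"
  assumes "f differentiable (at (x - y))"
  shows "((\<lambda>y. f (x - y)) has_derivative (\<lambda>h. - frechet_derivative f (at (x - y)) h)) (at y)"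
proof -
  have D: "(f has_derivative frechet_derivative f (at (x - y))) (at (x - y))"
    using assms by (rule has_derivative_frechet)
  have "((\<lambda>y. f (x - y)) has_derivative (\<lambda>h. frechet_derivative f (at (x - y)) (- h))) (at y)"
    by (rule has_derivative_compose[of "\<lambda>y. x - y", OF _ D]) (auto intro!: derivative_eq_intros)
  then show ?thesis
    using linear_neg[OF has_derivative_linear[OF D]] by simp
qed

lemma partial_deriv_reflect:
  fixes f :: "'a::euclidean_space \<Rightarrow> real"
  assumes "f differentiable (at (x - y))"
  shows "partial_deriv b (\<lambda>y. f (x - y)) y = - partial_deriv b f (x - y)"
  using partial_deriv_eqI[OF has_derivative_reflect[OF assms]] by (simp add: partial_deriv_def)

lemma Ck_reflect: "Ck k f \<Longrightarrow> Ck k (\<lambda>y. f (x - y))"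
proof (induction k arbitrary: f)
  case 0
  then show ?case by (auto intro!: continuous_on_compose2[of UNIV f] continuous_intros)
next
  case (Suc k)
  then have "partial_deriv b (\<lambda>y. f (x - y)) = (\<lambda>y. - partial_deriv b f (x - y))" for b
    by (auto simp: partial_deriv_reflect)
  moreover have "(\<lambda>y. f (x - y)) differentiable (at y)" for y
    using has_derivative_reflect Suc.prems unfolding differentiable_def Ck.simps by blast
  ultimately show ?case
    using Suc Ck_mult[OF Ck_const[of k "- 1"], of "\<lambda>y. partial_deriv _ f (x - y)"] by simp
qed

lemma smooth_const [simp, intro]: "smooth (\<lambda>x. c)"
  by (simp add: smooth_def)

lemma smooth_inner [simp, intro]: "smooth (\<lambda>x. x \<bullet> a)"
  by (simp add: smooth_def)

lemma smooth_add [intro]: "smooth f \<Longrightarrow> smooth g \<Longrightarrow> smooth (\<lambda>x. f x + g x)"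
  by (simp add: smooth_def Ck_add)

lemma smooth_mult [intro]: "smooth f \<Longrightarrow> smooth g \<Longrightarrow> smooth (\<lambda>x. f x * g x)"
  by (simp add: smooth_def Ck_mult)

lemma smooth_uminus [intro]: "smooth f \<Longrightarrow> smooth (\<lambda>x. - f x)"
  using smooth_mult[of "\<lambda>x. - 1" f] by simp

lemma smooth_diff [intro]: "smooth f \<Longrightarrow> smooth g \<Longrightarrow> smooth (\<lambda>x. f x - g x)"
  using smooth_add[of f "\<lambda>x. - g x"] by auto

lemma smooth_power [intro]: "smooth f \<Longrightarrow> smooth (\<lambda>x. f x ^ n)"
  by (induction n) auto

lemma smooth_sum [intro]: "(\<And>i. i \<in> I \<Longrightarrow> smooth (f i)) \<Longrightarrow> smooth (\<lambda>x. \<Sum>i\<in>I. f i x)"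
  by (induction I rule: infinite_finite_induct) auto

lemma smooth_prod [intro]: "(\<And>i. i \<in> I \<Longrightarrow> smooth (f i)) \<Longrightarrow> smooth (\<lambda>x. \<Prod>i\<in>I. f i x)"
  by (induction I rule: infinite_finite_induct) auto

lemma smooth_compose: "smooth h \<Longrightarrow> smooth f \<Longrightarrow> smooth (\<lambda>x. h (f x))"
  for h :: "real \<Rightarrow> real"
  by (simp add: smooth_def Ck_compose)

lemma smooth_laplacian [intro]: "smooth f \<Longrightarrow> smooth (laplacian f)"
  unfolding laplacian_def[abs_def] by (intro smooth_sum smooth_partial)

lemma partial_deriv_diff:
  assumes "f differentiable (at x)" "g differentiable (at x)"
  shows "partial_deriv b (\<lambda>x. f x - g x) x = partial_deriv b f x - partial_deriv b g x"
  using assms unfolding partial_deriv_def[of _ f] partial_deriv_def[of _ g]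
  by (intro partial_deriv_eqI) (auto intro!: derivative_eq_intros has_derivative_frechet)

section \<open>Smooth functions of one variable: exponential and bump\<close>

lemma smooth_real_derivatives:
  fixes D :: "nat \<Rightarrow> real \<Rightarrow> real"
  assumes "\<And>n t. (D n has_real_derivative D (Suc n) t) (at t)"
  shows "smooth (D n)"
proof -
  have pd: "partial_deriv 1 (D n) = D (Suc n)" for n
    using partial_deriv_real_eqI assms by blast
  have "Ck k (D n)" for k
  proof (induction k arbitrary: n)
    case 0
    show ?case
      using assms by (auto intro!: continuous_at_imp_continuous_on DERIV_isCont)
  next
    case (Suc k)
    then show ?case
      using pd assms unfolding Ck.simps real_differentiable_def by (auto, blast)
  qed
  then show ?thesis by (simp add: smooth_def)
qed

lemma smooth_antiderivative:
  fixes F h :: "real \<Rightarrow> real"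
  assumes "\<And>t. (F has_real_derivative h t) (at t)" "smooth h"
  shows "smooth F"
proof -
  have pd: "partial_deriv 1 F = h"
    using partial_deriv_real_eqI assms by blast
  have "Ck k F" for k
  proof (cases k)
    case 0
    then show ?thesis
      using assms(1) by (auto intro!: continuous_at_imp_continuous_on DERIV_isCont)
  next
    case (Suc k)
    then show ?thesis
      using pd assms by (auto simp: real_differentiable_def smooth_def)
  qed
  then show ?thesis by (simp add: smooth_def)
qed

lemma smooth_exp: "smooth (exp :: real \<Rightarrow> real)"
  by (rule smooth_real_derivatives[where D = "\<lambda>_. exp"]) (rule DERIV_exp)

text \<open>The functions \<open>p (1/t) exp (-1/t)\<close>, extended by 0, form a class closed under differentiation.\<close>

definition flat :: "real poly \<Rightarrow> real \<Rightarrow> real" where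
  "flat p t = (if t > 0 then poly p (1 / t) * exp (- (1 / t)) else 0)"

lemma poly_times_exp_minus_tendsto_0:
  "((\<lambda>y. poly p y * exp (- y)) \<longlongrightarrow> 0) (at_top :: real filter)"
proof -
  have "((\<lambda>y. \<Sum>i\<le>degree p. coeff p i * (y ^ i / exp y)) \<longlongrightarrow> (\<Sum>i\<le>degree p. coeff p i * 0)) at_top"
    by (intro tendsto_sum tendsto_mult tendsto_const tendsto_power_div_exp_0)
  then show ?thesis
    by (simp add: poly_altdef sum_distrib_right exp_minus divide_inverse mult.assoc)
qed

text \<open>For \<open>t > 0\<close> the chain rule gives
  \<open>(1/t)^2 (p - p') (1/t) exp (-1/t)\<close>, and \<open>[:0, 0, 1:]\<close> is the monomial
  \<open>X^2\<close>. At 0 the difference quotient from the right is again of this type, with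
  \<open>X p\<close> in place of \<open>p\<close>, and tends to 0 because the exponential beats
  every polynomial. Iterating the map \<open>p \<mapsto> X^2 (p - p')\<close> lists all
  derivatives.\<close>

lemma flat_has_derivative:
  "(flat p has_real_derivative flat ([:0, 0, 1:] * (p - pderiv p)) t) (at t)"
proof -
  consider "t > 0" | "t < 0" | "t = 0" by linarith
  then show ?thesis
  proof cases
    case 1
    have "((\<lambda>t. poly p (1 / t) * exp (- (1 / t))) has_real_derivative
        flat ([:0, 0, 1:] * (p - pderiv p)) t) (at t)"
      using 1 by (auto intro!: derivative_eq_intros DERIV_chain2[OF poly_DERIV]
          simp: flat_def field_simps power2_eq_square)
    then show ?thesis
      by (rule has_field_derivative_transform_within_open[where S = "{0<..}"])
         (use 1 in \<open>auto simp: flat_def\<close>)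
  next
    case 2
    have "((\<lambda>t. 0) has_real_derivative flat ([:0, 0, 1:] * (p - pderiv p)) t) (at t)"
      using 2 by (simp add: flat_def)
    then show ?thesis
      by (rule has_field_derivative_transform_within_open[where S = "{..<0}"])
         (use 2 in \<open>auto simp: flat_def\<close>)
  next
    case 3
    have "((\<lambda>h. poly (pCons 0 p) (1 / h) * exp (- (1 / h))) \<longlongrightarrow> 0) (at_right 0)"
      using poly_times_exp_minus_tendsto_0[of "pCons 0 p"]
      by (auto intro: filterlim_compose[OF _ filterlim_inverse_at_top_right] simp: divide_inverse)
    then have "((\<lambda>h. flat p h / h) \<longlongrightarrow> 0) (at_right 0)"
      by (rule Lim_transform_eventually)
         (auto simp: flat_def eventually_at_filter)
    moreover have "((\<lambda>h. flat p h / h) \<longlongrightarrow> 0) (at_left 0)"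
      by (rule Lim_transform_eventually[OF tendsto_const])
         (auto simp: flat_def eventually_at_filter)
    ultimately have "((\<lambda>h. flat p h / h) \<longlongrightarrow> 0) (at 0)"
      by (simp add: filterlim_split_at)
    then show ?thesis
      using 3 by (simp add: DERIV_def flat_def)
  qed
qed

lemma smooth_flat: "smooth (flat p)"
proof -
  define T where "T = (\<lambda>p. [:0, 0, 1:] * (p - pderiv p) :: real poly)"
  have "smooth (flat ((T ^^ 0) p))"
    by (rule smooth_real_derivatives[where D = "\<lambda>n. flat ((T ^^ n) p)"])
       (use flat_has_derivative in \<open>simp add: T_def\<close>)
  then show ?thesis by simp
qed

text \<open>The product of \<open>exp (-1/s)\<close> over the distances \<open>s = 1 - t\<close> and
  \<open>s = 1 + t\<close> to the endpoints: positive exactly on (-1, 1), and at most 1 without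
  normalisation.\<close>

definition bump :: "real \<Rightarrow> real" where
  "bump t = flat 1 (1 - t) * flat 1 (1 + t)"

lemma smooth_bump: "smooth bump"
proof -
  have "smooth (\<lambda>t::real. 1 - t \<bullet> 1)" "smooth (\<lambda>t::real. 1 + t \<bullet> 1)"
    by (intro smooth_diff smooth_add smooth_const smooth_inner)+
  then have "smooth (\<lambda>t::real. flat 1 (1 - t \<bullet> 1) * flat 1 (1 + t \<bullet> 1))"
    by (intro smooth_mult smooth_compose[OF smooth_flat, of "\<lambda>t. 1 - t \<bullet> 1"]
        smooth_compose[OF smooth_flat, of "\<lambda>t. 1 + t \<bullet> 1"])
  then show ?thesis
    unfolding bump_def[abs_def] by simp
qed

lemma bump_nonneg: "bump t \<ge> 0" and bump_le_1: "bump t \<le> 1"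
  and bump_pos: "\<bar>t\<bar> < 1 \<Longrightarrow> bump t > 0" and bump_eq_0: "\<bar>t\<bar> \<ge> 1 \<Longrightarrow> bump t = 0"
  by (auto simp: bump_def flat_def mult_le_one)

section \<open>Functions of bounded support\<close>

lemma smooth_partial_add:
  "smooth f \<Longrightarrow> smooth g \<Longrightarrow>
    partial_deriv b (\<lambda>x. f x + g x) = (\<lambda>x. partial_deriv b f x + partial_deriv b g x)"
  by (auto simp: partial_deriv_add smooth_differentiable)

lemma smooth_partial_diff:
  "smooth f \<Longrightarrow> smooth g \<Longrightarrow>
    partial_deriv b (\<lambda>x. f x - g x) = (\<lambda>x. partial_deriv b f x - partial_deriv b g x)"
  by (auto simp: partial_deriv_diff smooth_differentiable)

lemma smooth_partial_mult:
  "smooth f \<Longrightarrow> smooth g \<Longrightarrow> partial_deriv b (\<lambda>x. f x * g x) =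
      (\<lambda>x. partial_deriv b f x * g x + f x * partial_deriv b g x)"
  by (auto simp: partial_deriv_mult smooth_differentiable)

lemma smooth_partial_compose:
  fixes h :: "real \<Rightarrow> real"
  shows "smooth h \<Longrightarrow> smooth f \<Longrightarrow> partial_deriv b (\<lambda>x. h (f x)) =
      (\<lambda>x. partial_deriv 1 h (f x) * partial_deriv b f x)"
  by (auto simp: partial_deriv_compose smooth_differentiable)

lemma partial_deriv_const_fun: "partial_deriv b (\<lambda>x. c) = (\<lambda>x. 0)"
  and partial_deriv_inner_fun: "partial_deriv b (\<lambda>x. x \<bullet> a) = (\<lambda>x. b \<bullet> a)"
  by auto

lemmas smooth_partial_simps = smooth_partial_add smooth_partial_diff smooth_partial_mult
  partial_deriv_const_fun partial_deriv_inner_fun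

lemmas smooth_intros = smooth_const smooth_inner smooth_add smooth_mult smooth_diff smooth_uminus
  smooth_power smooth_sum smooth_prod smooth_partial smooth_laplacian

lemma laplacian_mult:
  assumes "smooth f" "smooth g"
  shows "laplacian (\<lambda>x. f x * g x) x =
    f x * laplacian g x + 2 * (\<Sum>b\<in>Basis. partial_deriv b f x * partial_deriv b g x) + laplacian f x * g x"
  using assms
  by (simp add: laplacian_def smooth_partial_simps smooth_intros sum.distrib sum_distrib_left
      sum_distrib_right algebra_simps)

lemma bounded_support_mult1: "bounded_support f \<Longrightarrow> bounded_support (\<lambda>x. f x * g x)"
  and bounded_support_mult2: "bounded_support g \<Longrightarrow> bounded_support (\<lambda>x. f x * g x)"
  unfolding bounded_support_def by auto

lemma bounded_support_add:
  assumes "bounded_support f" "bounded_support g"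
  shows "bounded_support (\<lambda>x. f x + g x)"
proof -
  obtain r s where "\<forall>x. norm x > r \<longrightarrow> f x = 0" "\<forall>x. norm x > s \<longrightarrow> g x = 0"
    using assms unfolding bounded_support_def by auto
  then show ?thesis
    unfolding bounded_support_def by (intro exI[of _ "max r s"]) auto
qed

lemma bounded_support_power: "bounded_support f \<Longrightarrow> n > 0 \<Longrightarrow> bounded_support (\<lambda>x. f x ^ n)"
  unfolding bounded_support_def by auto

lemma partial_deriv_eq_0_outside:
  fixes f :: "'a::euclidean_space \<Rightarrow> real"
  assumes "open S" "\<And>y. y \<in> S \<Longrightarrow> f y = c" "x \<in> S"
  shows "partial_deriv b f x = 0"
proof -
  have "((\<lambda>y. c) has_derivative (\<lambda>h. 0)) (at x)" by simp
  then have "(f has_derivative (\<lambda>h. 0)) (at x)"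
    by (rule has_derivative_transform_within_open[OF _ assms(1,3)]) (simp add: assms(2))
  then show ?thesis by (rule partial_deriv_eqI[where D = "\<lambda>_. 0"])
qed

lemma open_norm_greater: "open {x::'a::euclidean_space. norm x > r}"
  by (intro open_Collect_less continuous_intros)

lemma bounded_support_partial:
  assumes "bounded_support f"
  shows "bounded_support (partial_deriv b f)"
proof -
  obtain r where "\<forall>x. norm x > r \<longrightarrow> f x = 0"
    using assms unfolding bounded_support_def by auto
  then have "partial_deriv b f x = 0" if "norm x > r" for x
    using that by (intro partial_deriv_eq_0_outside[OF open_norm_greater[of r]]) auto
  then show ?thesis
    unfolding bounded_support_def by blast
qed

lemma bounded_support_sum:
  "(\<And>i. i \<in> I \<Longrightarrow> bounded_support (f i)) \<Longrightarrow> bounded_support (\<lambda>x. \<Sum>i\<in>I. f i x)"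
  by (induction I rule: infinite_finite_induct)
     (auto intro!: bounded_support_add, auto simp: bounded_support_def)

lemma bounded_support_laplacian: "bounded_support f \<Longrightarrow> bounded_support (laplacian f)"
  unfolding laplacian_def[abs_def] by (intro bounded_support_sum bounded_support_partial)

lemma integrable_bounded_support:
  assumes "continuous_on UNIV f" "bounded_support f"
  shows "integrable lborel f"
proof -
  obtain r where r: "\<forall>x. norm x > r \<longrightarrow> f x = 0"
    using assms unfolding bounded_support_def by auto
  have "integrable lborel (\<lambda>x. indicator (cball 0 r) x *\<^sub>R f x)"
    using assms(1) continuous_on_subset by (intro borel_integrable_compact) auto
  moreover have "(\<lambda>x. indicator (cball 0 r) x *\<^sub>R f x) = f"
    using r by (auto simp: indicator_def not_le fun_eq_iff)
  ultimately show ?thesis by simp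
qed

lemma bounded_support_bounded:
  assumes "continuous_on UNIV f" "bounded_support f"
  obtains B where "B > 0" "\<And>x. \<bar>f x\<bar> \<le> B"
proof -
  obtain r where r: "\<forall>x. norm x > r \<longrightarrow> f x = 0"
    using assms unfolding bounded_support_def by auto
  have "compact (f ` cball 0 r)"
    using assms(1) continuous_on_subset by (intro compact_continuous_image) auto
  then obtain B where B: "B > 0" "\<forall>y\<in>f ` cball 0 r. norm y \<le> B"
    using compact_imp_bounded bounded_pos by metis
  have "\<bar>f x\<bar> \<le> B" for x
    using B r by (cases "norm x > r") auto
  then show ?thesis using B that by blast
qed

lemma bounded_support_uniformly_continuous:
  assumes "continuous_on UNIV f" "bounded_support f" "\<epsilon> > 0"
  obtains \<delta> where "\<delta> > 0" "\<And>x y. dist x y < \<delta> \<Longrightarrow> \<bar>f x - f y\<bar> < \<epsilon>"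
proof -
  obtain r where r: "\<forall>x. norm x > r \<longrightarrow> f x = 0"
    using assms unfolding bounded_support_def by auto
  have "uniformly_continuous_on (cball 0 (r + 1)) f"
    using assms(1) continuous_on_subset by (intro compact_uniformly_continuous) auto
  then obtain d where d: "d > 0"
    "\<And>x y. x \<in> cball 0 (r + 1) \<Longrightarrow> y \<in> cball 0 (r + 1) \<Longrightarrow> dist x y < d \<Longrightarrow> dist (f x) (f y) < \<epsilon>"
    using \<open>\<epsilon> > 0\<close> unfolding uniformly_continuous_on_def by metis
  \<comment> \<open>The cap 1 on the distance puts both points into the ball of radius
    \<open>r + 1\<close> as soon as one of them has norm at most \<open>r\<close>; otherwise both
    values are 0.\<close>
  have "\<bar>f x - f y\<bar> < \<epsilon>" if "dist x y < min d 1" for x y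
  proof (cases "norm x \<le> r \<or> norm y \<le> r")
    case True
    moreover have "norm x \<le> norm y + dist x y" "norm y \<le> norm x + dist x y"
      by (metis dist_norm norm_triangle_sub norm_minus_commute)+
    ultimately have "x \<in> cball 0 (r + 1)" "y \<in> cball 0 (r + 1)"
      using that by auto
    then show ?thesis
      using d that by (auto simp: dist_real_def)
  next
    case False
    then show ?thesis using r \<open>\<epsilon> > 0\<close> by auto
  qed
  then show ?thesis
    using that[of "min d 1"] d(1) by auto
qed

section \<open>Mean values along lines, mixed partials, integration by parts\<close>

lemma has_real_derivative_line:
  fixes f :: "'a::euclidean_space \<Rightarrow> real"
  assumes "smooth f"
  shows "((\<lambda>s. f (x + s *\<^sub>R b)) has_real_derivative partial_deriv b f (x + s *\<^sub>R b)) (at s)"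
proof -
  have D: "(f has_derivative frechet_derivative f (at (x + s *\<^sub>R b))) (at (x + s *\<^sub>R b))"
    using assms smooth_differentiable has_derivative_frechet by blast
  have "((\<lambda>s. f (x + s *\<^sub>R b)) has_derivative
      (\<lambda>h. frechet_derivative f (at (x + s *\<^sub>R b)) (h *\<^sub>R b))) (at s)"
    by (rule has_derivative_compose[of "\<lambda>s. x + s *\<^sub>R b", OF _ D]) (auto intro!: derivative_eq_intros)
  moreover have "(\<lambda>h. frechet_derivative f (at (x + s *\<^sub>R b)) (h *\<^sub>R b)) =
      (*) (partial_deriv b f (x + s *\<^sub>R b))"
    using linear_cmul[OF has_derivative_linear[OF D]] by (auto simp: partial_deriv_def)
  ultimately show ?thesis
    by (simp add: has_field_derivative_def)
qed

lemma mvt_line: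
  fixes f :: "'a::euclidean_space \<Rightarrow> real"
  assumes "smooth f" "s > 0"
  obtains \<theta> where "0 < \<theta>" "\<theta> < s" "f (x + s *\<^sub>R b) - f x = s * partial_deriv b f (x + \<theta> *\<^sub>R b)"
  using MVT2[of 0 s "\<lambda>s. f (x + s *\<^sub>R b)" "\<lambda>s. partial_deriv b f (x + s *\<^sub>R b)"]
    has_real_derivative_line[OF assms(1)] assms(2) by auto

text \<open>The second difference quotient \<open>\<Delta>\<close> is symmetric in \<open>b\<close>
  and \<open>c\<close>. Two applications of the mean value theorem write it as one mixed derivative
  at a nearby point, so by continuity it tends to that derivative at \<open>x\<close>; exchanging
  \<open>b\<close> and \<open>c\<close> gives the other one, and limits are unique.\<close>

lemma partial_deriv_commute:
  fixes f :: "'a::euclidean_space \<Rightarrow> real"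
  assumes f: "smooth f" and b: "b \<in> Basis" and c: "c \<in> Basis"
  shows "partial_deriv b (partial_deriv c f) x = partial_deriv c (partial_deriv b f) x"
proof -
  define \<Delta> where "\<Delta> = (\<lambda>s. (f (x + s *\<^sub>R b + s *\<^sub>R c) - f (x + s *\<^sub>R b) - f (x + s *\<^sub>R c) + f x) / s\<^sup>2)"
  have lim: "(\<Delta> \<longlongrightarrow> partial_deriv c (partial_deriv b f) x) (at_right 0)"
    if "b \<in> Basis" "c \<in> Basis"
      and \<Delta>: "\<Delta> = (\<lambda>s. (f (x + s *\<^sub>R b + s *\<^sub>R c) - f (x + s *\<^sub>R b) - f (x + s *\<^sub>R c) + f x) / s\<^sup>2)"
    for b c
  proof -
    have "\<exists>\<theta> \<theta>'. 0 < \<theta> \<and> \<theta> < s \<and> 0 < \<theta>' \<and> \<theta>' < s \<and>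
        \<Delta> s = partial_deriv c (partial_deriv b f) (x + \<theta> *\<^sub>R b + \<theta>' *\<^sub>R c)" if "s > 0" for s
    proof -
      have g: "((\<lambda>r. f ((x + s *\<^sub>R c) + r *\<^sub>R b) - f (x + r *\<^sub>R b)) has_real_derivative
          partial_deriv b f ((x + s *\<^sub>R c) + r *\<^sub>R b) - partial_deriv b f (x + r *\<^sub>R b)) (at r)" for r
        by (intro DERIV_diff has_real_derivative_line f)
      obtain \<theta> where \<theta>: "0 < \<theta>" "\<theta> < s" "f ((x + s *\<^sub>R c) + s *\<^sub>R b) - f (x + s *\<^sub>R b) - (f (x + s *\<^sub>R c) - f x) =
          s * (partial_deriv b f ((x + s *\<^sub>R c) + \<theta> *\<^sub>R b) - partial_deriv b f (x + \<theta> *\<^sub>R b))"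
        using MVT2[OF \<open>s > 0\<close> g] by auto
      obtain \<theta>' where \<theta>': "0 < \<theta>'" "\<theta>' < s"
        "partial_deriv b f ((x + \<theta> *\<^sub>R b) + s *\<^sub>R c) - partial_deriv b f (x + \<theta> *\<^sub>R b) =
          s * partial_deriv c (partial_deriv b f) (x + \<theta> *\<^sub>R b + \<theta>' *\<^sub>R c)"
        using mvt_line[OF smooth_partial[OF f \<open>b \<in> Basis\<close>] \<open>s > 0\<close>] by metis
      have "f (x + s *\<^sub>R b + s *\<^sub>R c) - f (x + s *\<^sub>R b) - f (x + s *\<^sub>R c) + f x =
          s * (s * partial_deriv c (partial_deriv b f) (x + \<theta> *\<^sub>R b + \<theta>' *\<^sub>R c))"
        using \<theta>(3) \<theta>'(3) by (simp add: algebra_simps)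
      then show ?thesis
        using \<theta> \<theta>' \<open>s > 0\<close> unfolding \<Delta>
        by (intro exI[of _ \<theta>] exI[of _ \<theta>']) (simp add: power2_eq_square)
    qed
    then obtain \<theta> \<theta>' where \<theta>: "\<And>s. s > 0 \<Longrightarrow> 0 < \<theta> s \<and> \<theta> s < s \<and> 0 < \<theta>' s \<and> \<theta>' s < s \<and>
        \<Delta> s = partial_deriv c (partial_deriv b f) (x + \<theta> s *\<^sub>R b + \<theta>' s *\<^sub>R c)"
      by metis
    have id0: "((\<lambda>s::real. s) \<longlongrightarrow> 0) (at_right 0)"
      by (simp add: tendsto_ident_at)
    have "(\<theta> \<longlongrightarrow> 0) (at_right 0)" "(\<theta>' \<longlongrightarrow> 0) (at_right 0)"
      by (rule tendsto_sandwich[OF _ _ tendsto_const id0];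
          rule eventually_at_rightI[of 0 1]; use \<theta> in \<open>simp add: less_imp_le\<close>)+
    then have "((\<lambda>s. x + \<theta> s *\<^sub>R b + \<theta>' s *\<^sub>R c) \<longlongrightarrow> x + 0 *\<^sub>R b + 0 *\<^sub>R c) (at_right 0)"
      by (intro tendsto_intros)
    moreover have "isCont (partial_deriv c (partial_deriv b f)) x"
      using smooth_partial[OF smooth_partial[OF f that(1)] that(2)] smooth_differentiable
        differentiable_imp_continuous_within by blast
    ultimately have "((\<lambda>s. partial_deriv c (partial_deriv b f) (x + \<theta> s *\<^sub>R b + \<theta>' s *\<^sub>R c)) \<longlongrightarrow>
        partial_deriv c (partial_deriv b f) x) (at_right 0)"
      using isCont_tendsto_compose by fastforce
    then show ?thesis
      by (rule Lim_transform_eventually) (use \<theta> in \<open>auto simp: eventually_at_filter\<close>)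
  qed
  have "\<Delta> = (\<lambda>s. (f (x + s *\<^sub>R c + s *\<^sub>R b) - f (x + s *\<^sub>R c) - f (x + s *\<^sub>R b) + f x) / s\<^sup>2)"
    unfolding \<Delta>_def by (simp add: algebra_simps)
  from lim[OF c b this] lim[OF b c \<Delta>_def] show ?thesis
    by (rule tendsto_unique[rotated]) simp
qed

lemma integral_lborel_translate:
  fixes f :: "'a::euclidean_space \<Rightarrow> real"
  assumes [measurable]: "f \<in> borel_measurable borel"
  shows "(LINT x|lborel. f (x + a)) = integral\<^sup>L lborel f"
proof -
  have "integral\<^sup>L lborel f = integral\<^sup>L (distr lborel borel ((+) a)) f"
    by (simp add: lborel_distr_plus)
  also have "\<dots> = (LINT x|lborel. f (x + a))"
    by (subst integral_distr) (auto simp: add.commute)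
  finally show ?thesis ..
qed

text \<open>Difference quotients integrate to 0 by translation invariance. The mean value theorem
  bounds them by \<open>B\<close>, and since the steps have length at most 1 they live in a ball of
  radius \<open>r + 1\<close>, so dominated convergence applies. Applied to products, this is the
  integration by parts of the Carleman and Caccioppoli estimates.\<close>

lemma integral_partial_deriv:
  assumes f: "smooth f" and supp: "bounded_support f" and b: "b \<in> Basis"
  shows "has_bochner_integral lborel (partial_deriv b f) 0"
proof -
  have f': "smooth (partial_deriv b f)" "bounded_support (partial_deriv b f)"
    using smooth_partial bounded_support_partial assms by blast+
  have int: "integrable lborel f" "integrable lborel (partial_deriv b f)"
    using assms f' smooth_continuous integrable_bounded_support by blast+
  have mf [measurable]: "f \<in> borel_measurable borel"
    using f by (rule smooth_measurable)
  obtain r where r: "\<forall>x. norm x > r \<longrightarrow> f x = 0"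
    using supp unfolding bounded_support_def by auto
  obtain B where B: "B > 0" "\<And>x. \<bar>partial_deriv b f x\<bar> \<le> B"
    using bounded_support_bounded smooth_continuous f' by metis
  define h where "h = (\<lambda>n. 1 / real (Suc n))"
  have h: "h n > 0" "h n \<le> 1" for n by (auto simp: h_def)
  define g where "g = (\<lambda>n x. (f (x + h n *\<^sub>R b) - f x) / h n)"
  have "(\<lambda>n. integral\<^sup>L lborel (g n)) \<longlonglongrightarrow> integral\<^sup>L lborel (partial_deriv b f)"
  proof (rule integral_dominated_convergence[where w = "\<lambda>x. indicator (cball 0 (r + 1)) x *\<^sub>R B"])
    show "partial_deriv b f \<in> borel_measurable lborel"
      using f'(1) smooth_measurable by fastforce
    show "g n \<in> borel_measurable lborel" for n
      unfolding g_def by measurable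
    show "integrable lborel (\<lambda>x::'a. indicator (cball 0 (r + 1)) x *\<^sub>R B)"
      by (intro borel_integrable_compact) auto
    show "AE x in lborel. (\<lambda>n. g n x) \<longlonglongrightarrow> partial_deriv b f x"
    proof (rule AE_I2)
      fix x
      have "((\<lambda>s. f (x + s *\<^sub>R b)) has_real_derivative partial_deriv b f x) (at 0)"
        using has_real_derivative_line[OF f, of x b 0] by simp
      then have "((\<lambda>s. (f (x + s *\<^sub>R b) - f x) / s) \<longlongrightarrow> partial_deriv b f x) (at 0)"
        by (simp add: DERIV_def)
      moreover have "filterlim h (at 0) sequentially"
        unfolding filterlim_at using LIMSEQ_Suc[OF lim_1_over_n] h(1)
        by (simp add: h_def less_imp_neq[symmetric])
      ultimately show "(\<lambda>n. g n x) \<longlonglongrightarrow> partial_deriv b f x"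
        unfolding g_def by (rule filterlim_compose)
    qed
    show "AE x in lborel. norm (g n x) \<le> indicator (cball 0 (r + 1)) x *\<^sub>R B" for n
    proof (rule AE_I2)
      fix x :: 'a
      show "norm (g n x) \<le> indicator (cball 0 (r + 1)) x *\<^sub>R B"
      proof (cases "norm x \<le> r + 1")
        case True
        obtain \<theta> where "f (x + h n *\<^sub>R b) - f x = h n * partial_deriv b f (x + \<theta> *\<^sub>R b)"
          using mvt_line[OF f h(1)] by metis
        then have "g n x = partial_deriv b f (x + \<theta> *\<^sub>R b)"
          using h(1)[of n] by (simp add: g_def)
        then show ?thesis using B True by simp
      next
        case False
        have "norm x \<le> norm (x + h n *\<^sub>R b) + norm (h n *\<^sub>R b)"
          by (metis add_diff_cancel_right' norm_triangle_ineq4)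
        then have "norm (x + h n *\<^sub>R b) > r" "norm x > r"
          using False h[of n] b by auto
        then show ?thesis using r B(1) by (simp add: g_def)
      qed
    qed
  qed
  moreover have "integral\<^sup>L lborel (g n) = 0" for n
  proof -
    have "integrable lborel (\<lambda>x. f (x + h n *\<^sub>R b))"
    proof -
      have "integrable (distr lborel borel ((+) (h n *\<^sub>R b))) f"
        using int by (simp add: lborel_distr_plus)
      then show ?thesis
        by (subst (asm) integrable_distr_eq) (auto simp: add.commute)
    qed
    then show ?thesis
      using int(1) integral_lborel_translate[OF mf, of "h n *\<^sub>R b"] by (simp add: g_def)
  qed
  ultimately have "integral\<^sup>L lborel (partial_deriv b f) = 0"
    by (simp add: LIMSEQ_const_iff)
  then show ?thesis using int has_bochner_integral_iff by blast
qed

section \<open>The Carleman estimate\<close>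

lemma sum_Basis_inner_mult:
  fixes f :: "'a::euclidean_space \<Rightarrow> real"
  assumes "e \<in> Basis"
  shows "(\<Sum>b\<in>Basis. (b \<bullet> e) * f b) = f e"
proof -
  have "(\<Sum>b\<in>Basis. (b \<bullet> e) * f b) = (\<Sum>b\<in>Basis. if b = e then f b else 0)"
    using assms by (intro sum.cong) (auto simp: inner_Basis)
  then show ?thesis using assms by simp
qed

lemma four_mult_le_square_add: "4 * (x * y) \<le> (x + y)\<^sup>2" for x y :: real
  using sum_squares_bound[of x y] by (simp add: power2_sum)

text \<open>The right-hand side is \<open>(S v + A v)\<^sup>2 \<ge> 4 S v \<cdot> A v\<close>, where \<open>S = \<Delta> + l\<^sup>2 t\<^sup>2\<close> and
  \<open>A = - 2 l t \<partial>\<^sub>e - l\<close> are the symmetric and antisymmetric parts of the Laplacian conjugated with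
  the weight; \<open>D\<close> collects the divergence terms in \<open>4 S v \<cdot> A v\<close>.\<close>

lemma carleman_conjugated:
  fixes v :: "'a::euclidean_space \<Rightarrow> real" and l a :: real
  assumes v: "smooth v" and supp: "bounded_support v" and e: "e \<in> Basis" and l: "l \<ge> 0"
  obtains D where "has_bochner_integral lborel D 0"
    and "\<And>x. 8 * l ^ 3 * ((x \<bullet> e + a)\<^sup>2 * (v x)\<^sup>2) + D x \<le>
      (laplacian v x + l\<^sup>2 * (x \<bullet> e + a)\<^sup>2 * v x
        - 2 * l * (x \<bullet> e + a) * partial_deriv e v x - l * v x)\<^sup>2"
proof -
  let ?d = "partial_deriv"
  define t where "t = (\<lambda>x::'a. x \<bullet> e + a)"
  have t: "smooth t" "\<And>b. ?d b t = (\<lambda>x. b \<bullet> e)"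
    unfolding t_def by (auto simp: smooth_partial_simps smooth_intros)
  have vs: "smooth (?d b v)" "smooth (?d c (?d b v))" "bounded_support (?d b v)"
    if "b \<in> Basis" "c \<in> Basis" for b c
    using that v supp smooth_partial bounded_support_partial by blast+
  \<comment> \<open>Expanding the derivatives shows the role of each term. The first produces
    \<open>t \<Delta>v \<partial>\<^sub>e v\<close> and a sum of mixed derivatives; the second
    cancels that sum and leaves the squared gradient; the third cancels the squared gradient and
    supplies \<open>v \<Delta>v\<close>; the fourth trades \<open>t^3 v \<partial>\<^sub>e v\<close>
    for \<open>t^2 v^2\<close>. What remains of \<open>4 S v A v - D\<close> is
    \<open>8 l^3 t^2 v^2 + 8 l (\<partial>\<^sub>e v)^2\<close>, and the last term is
    dropped.\<close>
  define D where "D = (\<lambda>x. 4 * ((\<Sum>b\<in>Basis. - (2 * l) * ?d b (\<lambda>x. t x * (?d b v x * ?d e v x)) x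
      + l * ?d e (\<lambda>x. t x * (?d b v x * ?d b v x)) x - l * ?d b (\<lambda>x. v x * ?d b v x) x)
      - l ^ 3 * ?d e (\<lambda>x. (t x * (t x * t x)) * (v x * v x)) x))"
  have "has_bochner_integral lborel D (4 * ((\<Sum>b\<in>(Basis::'a set). - (2 * l) * 0 + l * 0 - l * 0) - l ^ 3 * 0))"
    unfolding D_def
    by (intro has_bochner_integral_mult_right has_bochner_integral_diff has_bochner_integral_add
        has_bochner_integral_sum integral_partial_deriv e)
      (use e v t vs supp in \<open>auto intro!: smooth_mult bounded_support_mult1 bounded_support_mult2
          intro: smooth_partial\<close>)
  then have int: "has_bochner_integral lborel D 0" by simp
  have "8 * l ^ 3 * ((t x)\<^sup>2 * (v x)\<^sup>2) + D x \<le>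
      (laplacian v x + l\<^sup>2 * (t x)\<^sup>2 * v x - 2 * l * t x * ?d e v x - l * v x)\<^sup>2" for x
  proof -
    define A G H where "A = laplacian v x" and "G = (\<Sum>b\<in>Basis. (?d b v x)\<^sup>2)"
      and "H = (\<Sum>b\<in>Basis. ?d b v x * ?d e (?d b v) x)"
    have 1: "(\<Sum>b\<in>Basis. ?d b (\<lambda>x. t x * (?d b v x * ?d e v x)) x) = (?d e v x)\<^sup>2 + t x * A * ?d e v x + t x * H"
    proof -
      have "(\<Sum>b\<in>Basis. ?d b (\<lambda>x. t x * (?d b v x * ?d e v x)) x) =
          (\<Sum>b\<in>Basis. (b \<bullet> e) * (?d b v x * ?d e v x) + t x * (?d b (?d b v) x * ?d e v x)
            + t x * (?d b v x * ?d e (?d b v) x))"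
        using e v t vs by (intro sum.cong refl)
          (simp add: smooth_partial_simps smooth_intros partial_deriv_commute[of v e] algebra_simps)
      also have "\<dots> = ?d e v x * ?d e v x + t x * (A * ?d e v x) + t x * H"
        unfolding sum.distrib sum_Basis_inner_mult[OF e] A_def H_def laplacian_def
        by (simp add: sum_distrib_left sum_distrib_right)
      finally show ?thesis by (simp add: power2_eq_square)
    qed
    have 2: "(\<Sum>b\<in>Basis. ?d e (\<lambda>x. t x * (?d b v x * ?d b v x)) x) = G + 2 * t x * H"
    proof -
      have "(\<Sum>b\<in>Basis. ?d e (\<lambda>x. t x * (?d b v x * ?d b v x)) x) =
          (\<Sum>b\<in>Basis. (?d b v x)\<^sup>2 + 2 * t x * (?d b v x * ?d e (?d b v) x))"
        using e v t vs by (intro sum.cong refl)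
          (simp add: smooth_partial_simps smooth_intros algebra_simps power2_eq_square)
      then show ?thesis
        by (simp add: sum.distrib sum_distrib_left G_def H_def)
    qed
    have 3: "(\<Sum>b\<in>Basis. ?d b (\<lambda>x. v x * ?d b v x) x) = G + v x * A"
    proof -
      have "(\<Sum>b\<in>Basis. ?d b (\<lambda>x. v x * ?d b v x) x) =
          (\<Sum>b\<in>Basis. (?d b v x)\<^sup>2 + v x * ?d b (?d b v) x)"
        using e v t vs by (intro sum.cong refl)
          (simp add: smooth_partial_simps smooth_intros algebra_simps power2_eq_square)
      then show ?thesis
        by (simp add: sum.distrib sum_distrib_left G_def A_def laplacian_def)
    qed
    have 4: "?d e (\<lambda>x. (t x * (t x * t x)) * (v x * v x)) x =
        3 * (t x)\<^sup>2 * (v x)\<^sup>2 + 2 * (t x) ^ 3 * v x * ?d e v x"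
      using e v t by (simp add: smooth_partial_simps smooth_intros algebra_simps
          power2_eq_square power3_eq_cube)
    have "D x = 4 * (- (2 * l) * (\<Sum>b\<in>Basis. ?d b (\<lambda>x. t x * (?d b v x * ?d e v x)) x)
        + l * (\<Sum>b\<in>Basis. ?d e (\<lambda>x. t x * (?d b v x * ?d b v x)) x)
        - l * (\<Sum>b\<in>Basis. ?d b (\<lambda>x. v x * ?d b v x) x)
        - l ^ 3 * ?d e (\<lambda>x. (t x * (t x * t x)) * (v x * v x)) x)"
      unfolding D_def sum.distrib sum_subtractf sum_distrib_left ..
    also have "\<dots> = 4 * ((A + l\<^sup>2 * (t x)\<^sup>2 * v x) * (- 2 * l * t x * ?d e v x - l * v x))
        - 8 * l ^ 3 * ((t x)\<^sup>2 * (v x)\<^sup>2) - 8 * l * (?d e v x)\<^sup>2"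
      unfolding 1 2 3 4 by (simp add: algebra_simps power2_eq_square power3_eq_cube)
    finally have "8 * l ^ 3 * ((t x)\<^sup>2 * (v x)\<^sup>2) + D x \<le>
        4 * ((A + l\<^sup>2 * (t x)\<^sup>2 * v x) * (- 2 * l * t x * ?d e v x - l * v x))"
      using l by simp
    also have "\<dots> \<le> ((A + l\<^sup>2 * (t x)\<^sup>2 * v x) + (- 2 * l * t x * ?d e v x - l * v x))\<^sup>2"
      by (rule four_mult_le_square_add)
    finally show ?thesis
      by (simp add: A_def algebra_simps)
  qed
  then show ?thesis
    using int that unfolding t_def by blast
qed

definition carleman_weight :: "real \<Rightarrow> 'a::euclidean_space \<Rightarrow> real \<Rightarrow> 'a \<Rightarrow> real" where
  "carleman_weight l e a x = exp (l / 2 * (x \<bullet> e + a)\<^sup>2)"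

lemma smooth_carleman_weight: "smooth (carleman_weight l e a)"
  unfolding carleman_weight_def[abs_def]
  by (intro smooth_compose[OF smooth_exp] smooth_intros)

text \<open>Substitute \<open>v = w f\<close>. For \<open>\<phi> = l t^2 / 2\<close> one has
  \<open>\<nabla>\<phi> = l t e\<close> and \<open>\<Delta>\<phi> = l\<close>, so the Laplacian
  conjugated with \<open>w\<close> is
  \<open>\<Delta> - 2 l t \<partial>\<^sub>e + l^2 t^2 - l\<close>, which is the operator in
  \<open>carleman_conjugated\<close>.\<close>

lemma carleman:
  fixes f :: "'a::euclidean_space \<Rightarrow> real" and l a :: real
  assumes f: "smooth f" and supp: "bounded_support f" and e: "e \<in> Basis" and l: "l \<ge> 0"
  shows "8 * l ^ 3 * (LINT x|lborel. ((x \<bullet> e + a) * carleman_weight l e a x * f x)\<^sup>2) \<le>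
    (LINT x|lborel. (carleman_weight l e a x * laplacian f x)\<^sup>2)"
proof -
  let ?d = "partial_deriv"
  define t where "t = (\<lambda>x::'a. x \<bullet> e + a)"
  have t: "smooth t" "\<And>b. ?d b t = (\<lambda>x. b \<bullet> e)"
    unfolding t_def by (auto simp: smooth_partial_simps smooth_intros)
  define w where "w = carleman_weight l e a"
  have w: "smooth w" unfolding w_def by (rule smooth_carleman_weight)
  have dw: "?d b w = (\<lambda>x. w x * (l * (b \<bullet> e) * t x))" for b
  proof -
    have exp1: "?d 1 exp s = exp s" for s :: real
      by (rule partial_deriv_real_eqI) (rule DERIV_exp)
    have "w = (\<lambda>x. exp (l / 2 * (t x * t x)))"
      by (auto simp: w_def carleman_weight_def t_def power2_eq_square)
    moreover have "smooth (\<lambda>x. l / 2 * (t x * t x))"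
      using t by (intro smooth_intros)
    ultimately show ?thesis
      using t smooth_partial_compose[OF smooth_exp, of "\<lambda>x. l / 2 * (t x * t x)" b]
      by (simp only: exp1 smooth_partial_simps smooth_intros) (simp add: algebra_simps)
  qed
  define v where "v = (\<lambda>x. w x * f x)"
  have v: "smooth v" "bounded_support v"
    unfolding v_def using w f supp by (auto intro: bounded_support_mult2)
  \<comment> \<open>Checked by the product rule for \<open>w f\<close>, so that \<open>1 / w\<close>
    never has to be differentiated.\<close>
  have conj: "laplacian v x + l\<^sup>2 * (t x)\<^sup>2 * v x - 2 * l * t x * ?d e v x - l * v x =
      w x * laplacian f x" for x
  proof -
    have "(\<Sum>b\<in>Basis. ?d b w x * ?d b f x) = (\<Sum>b\<in>Basis. (b \<bullet> e) * (w x * l * t x * ?d b f x))"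
      by (simp add: dw mult_ac)
    then have 1: "(\<Sum>b\<in>Basis. ?d b w x * ?d b f x) = w x * l * t x * ?d e f x"
      by (simp only: sum_Basis_inner_mult[OF e])
    have "laplacian w x = (\<Sum>b\<in>Basis. (b \<bullet> e) * (w x * (l\<^sup>2 * (b \<bullet> e) * (t x)\<^sup>2 + l * (b \<bullet> e))))"
      unfolding laplacian_def dw using w t
      by (simp add: smooth_partial_simps smooth_intros dw algebra_simps power2_eq_square)
    then have 2: "laplacian w x = w x * (l\<^sup>2 * (t x)\<^sup>2 + l)"
      using e by (simp only: sum_Basis_inner_mult[OF e]) simp
    have 3: "?d e v x = w x * l * t x * f x + w x * ?d e f x"
      unfolding v_def using w f e by (simp add: smooth_partial_simps dw)
    show ?thesis
      unfolding 3 unfolding v_def laplacian_mult[OF w f] 1 2 by (simp add: algebra_simps power2_eq_square)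
  qed
  obtain D where D: "has_bochner_integral lborel D 0"
    "\<And>x. 8 * l ^ 3 * ((t x)\<^sup>2 * (v x)\<^sup>2) + D x \<le> (w x * laplacian f x)\<^sup>2"
    using carleman_conjugated[OF v e l, of a] conj unfolding t_def by metis
  have i1: "integrable lborel (\<lambda>x. (t x)\<^sup>2 * (v x)\<^sup>2)"
    using t v by (intro integrable_bounded_support smooth_continuous smooth_intros
        bounded_support_mult2 bounded_support_power) auto
  have i2: "integrable lborel (\<lambda>x. (w x * laplacian f x)\<^sup>2)"
    using w f supp by (intro integrable_bounded_support smooth_continuous smooth_intros
        bounded_support_mult2 bounded_support_power bounded_support_laplacian) auto
  have "(LINT x|lborel. 8 * l ^ 3 * ((t x)\<^sup>2 * (v x)\<^sup>2) + D x) \<le> (LINT x|lborel. (w x * laplacian f x)\<^sup>2)"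
    using D i1 i2 by (intro integral_mono) (auto simp: has_bochner_integral_iff)
  moreover have "(LINT x|lborel. 8 * l ^ 3 * ((t x)\<^sup>2 * (v x)\<^sup>2) + D x) =
      8 * l ^ 3 * (LINT x|lborel. (t x)\<^sup>2 * (v x)\<^sup>2)"
    using D(1) i1 by (simp add: has_bochner_integral_iff)
  ultimately show ?thesis
    by (simp add: t_def v_def w_def power_mult_distrib mult.assoc)
qed

text \<open>The two sides differ by the divergence of
  \<open>\<zeta> P \<nabla>P - P^2 \<nabla>\<zeta> / 2\<close>. The second field cancels the cross
  term \<open>P \<nabla>\<zeta> \<nabla>P\<close> produced by the first, which makes this an
  identity in which only \<open>\<Delta>\<zeta>\<close> occurs.\<close>

lemma caccioppoli:
  fixes P \<zeta> :: "'a::euclidean_space \<Rightarrow> real"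
  assumes P: "smooth P" and z: "smooth \<zeta>" "bounded_support \<zeta>"
  shows "(LINT x|lborel. \<zeta> x * (\<Sum>b\<in>Basis. (partial_deriv b P x)\<^sup>2)) =
    (LINT x|lborel. laplacian \<zeta> x / 2 * (P x)\<^sup>2 - \<zeta> x * (P x * laplacian P x))"
proof -
  let ?d = "partial_deriv"
  define D where "D = (\<lambda>x. \<Sum>b\<in>Basis. ?d b (\<lambda>x. \<zeta> x * (P x * ?d b P x)) x -
      1 / 2 * ?d b (\<lambda>x. ?d b \<zeta> x * (P x * P x)) x)"
  have "has_bochner_integral lborel D (\<Sum>b\<in>(Basis::'a set). 0 - 1 / 2 * 0)"
    unfolding D_def
    by (intro has_bochner_integral_mult_right has_bochner_integral_diff
        has_bochner_integral_sum integral_partial_deriv)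
      (use P z in \<open>auto intro!: smooth_intros bounded_support_mult1 bounded_support_partial\<close>)
  then have D: "has_bochner_integral lborel D 0" by simp
  have i: "integrable lborel (\<lambda>x. laplacian \<zeta> x / 2 * (P x)\<^sup>2 - \<zeta> x * (P x * laplacian P x))"
  proof -
    have "integrable lborel (\<lambda>x. laplacian \<zeta> x * (P x)\<^sup>2)" "integrable lborel (\<lambda>x. \<zeta> x * (P x * laplacian P x))"
      using z P by (auto intro!: integrable_bounded_support smooth_continuous smooth_intros
          bounded_support_mult1 bounded_support_laplacian)
    then show ?thesis by simp
  qed
  have eq: "\<zeta> x * (\<Sum>b\<in>Basis. (?d b P x)\<^sup>2) =
      (laplacian \<zeta> x / 2 * (P x)\<^sup>2 - \<zeta> x * (P x * laplacian P x)) + D x" for x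
  proof -
    have "D x = (\<Sum>b\<in>Basis. \<zeta> x * (?d b P x)\<^sup>2 + \<zeta> x * (P x * ?d b (?d b P) x)
        - ?d b (?d b \<zeta>) x * ((P x)\<^sup>2 / 2))"
      unfolding D_def using P z by (intro sum.cong refl)
        (simp add: smooth_partial_simps smooth_intros field_simps power2_eq_square)
    also have "\<dots> = \<zeta> x * (\<Sum>b\<in>Basis. (?d b P x)\<^sup>2) + \<zeta> x * (P x * laplacian P x) -
        laplacian \<zeta> x * ((P x)\<^sup>2 / 2)"
      by (simp add: sum.distrib sum_subtractf laplacian_def sum_distrib_left sum_distrib_right)
    finally show ?thesis by simp
  qed
  show ?thesis
    unfolding eq using D i by (simp add: has_bochner_integral_iff)
qed

text \<open>Apply \<open>carleman\<close> to \<open>\<kappa> P\<close>. The commutator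
  \<open>2 \<nabla>\<kappa> \<nabla>P + P \<Delta>\<kappa>\<close> contains the gradient of
  \<open>P\<close>, which Cauchy-Schwarz and the bound of \<open>\<nabla>\<kappa>\<close> by the
  smooth weight \<open>\<zeta>\<close> turn into \<open>\<zeta> |\<nabla>P|^2\<close>;
  \<open>caccioppoli\<close> and \<open>- 2 P \<Delta>P \<le> P^2 + (\<Delta>P)^2\<close> then
  remove it. In the result only \<open>P\<close> and \<open>\<Delta>P\<close> occur, both squared
  against fixed weights, which is the form that survives a limit of mollifications.\<close>

lemma carleman_cutoff:
  fixes P \<kappa> \<zeta> :: "'a::euclidean_space \<Rightarrow> real" and e :: 'a and l a K W :: real
  defines "w \<equiv> carleman_weight l e a"
  assumes P: "smooth P" and c: "smooth \<kappa>" "bounded_support \<kappa>"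
    and z: "smooth \<zeta>" "bounded_support \<zeta>" "\<And>x. \<zeta> x \<ge> 0"
    and e: "e \<in> Basis" and l: "l \<ge> 0" and K: "K \<ge> 0"
    and grad: "\<And>x. (\<Sum>b\<in>Basis. (partial_deriv b \<kappa> x)\<^sup>2) \<le> K * \<zeta> x"
    and W: "W \<ge> 0" "\<And>x. \<zeta> x \<noteq> 0 \<or> laplacian \<kappa> x \<noteq> 0 \<Longrightarrow> (w x)\<^sup>2 \<le> W"
  shows "8 * l ^ 3 * (LINT x|lborel. ((x \<bullet> e + a) * w x * \<kappa> x)\<^sup>2 * (P x)\<^sup>2) \<le>
    2 * (LINT x|lborel. (w x * \<kappa> x)\<^sup>2 * (laplacian P x)\<^sup>2)
    + (LINT x|lborel. W * (4 * (laplacian \<kappa> x)\<^sup>2 + 8 * K * \<bar>laplacian \<zeta> x\<bar> + 8 * K * \<zeta> x) * (P x)\<^sup>2)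
    + (LINT x|lborel. 8 * K * W * \<zeta> x * (laplacian P x)\<^sup>2)"
proof -
  let ?d = "partial_deriv"
  define G where "G = (\<lambda>x. \<Sum>b\<in>Basis. (?d b P x)\<^sup>2)"
  have w: "smooth w" unfolding w_def by (rule smooth_carleman_weight)
  have smG: "smooth G"
    unfolding G_def using P by (intro smooth_intros)
  have pw: "(w x * laplacian (\<lambda>x. \<kappa> x * P x) x)\<^sup>2 \<le>
      2 * ((w x * \<kappa> x)\<^sup>2 * (laplacian P x)\<^sup>2) + W * (4 * (laplacian \<kappa> x)\<^sup>2) * (P x)\<^sup>2
      + 16 * K * W * (\<zeta> x * G x)" for x
  proof -
    define X where "X = (\<Sum>b\<in>Basis. ?d b \<kappa> x * ?d b P x)"
    have X: "X\<^sup>2 \<le> K * \<zeta> x * G x"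
    proof -
      have "X\<^sup>2 \<le> (\<Sum>b\<in>Basis. (?d b \<kappa> x)\<^sup>2) * G x"
        unfolding X_def G_def by (rule Cauchy_Schwarz_ineq_sum)
      also have "\<dots> \<le> K * \<zeta> x * G x"
        by (intro mult_right_mono grad) (auto simp: G_def sum_nonneg)
      finally show ?thesis .
    qed
    have 2: "(p + q)\<^sup>2 \<le> 2 * p\<^sup>2 + 2 * q\<^sup>2" for p q :: real
      using sum_squares_bound[of p q] by (simp add: power2_sum)
    define Y where "Y = 2 * X + laplacian \<kappa> x * P x"
    have "(w x)\<^sup>2 * Y\<^sup>2 \<le>
        W * (8 * (K * \<zeta> x * G x) + 2 * ((laplacian \<kappa> x)\<^sup>2 * (P x)\<^sup>2))"
    \<comment> \<open>\<open>W\<close> bounds \<open>w^2\<close> only in this case. In the other one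
      \<open>X\<close> vanishes by \<open>X^2 \<le> K \<zeta> G\<close>, hence so does
      \<open>Y\<close>.\<close>
    proof (cases "\<zeta> x \<noteq> 0 \<or> laplacian \<kappa> x \<noteq> 0")
      case True
      have "Y\<^sup>2 \<le> 2 * (2 * X)\<^sup>2 + 2 * (laplacian \<kappa> x * P x)\<^sup>2"
        unfolding Y_def by (rule 2)
      also have "\<dots> \<le> 8 * (K * \<zeta> x * G x) + 2 * ((laplacian \<kappa> x)\<^sup>2 * (P x)\<^sup>2)"
        using X by (simp add: power_mult_distrib)
      finally show ?thesis
        using W True by (intro mult_mono) auto
    next
      case False
      then have "X = 0" using X by simp
      then show ?thesis using False by (simp add: Y_def)
    qed
    moreover have "(w x * laplacian (\<lambda>x. \<kappa> x * P x) x)\<^sup>2 =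
        (w x * \<kappa> x * laplacian P x + w x * Y)\<^sup>2"
      unfolding laplacian_mult[OF c(1) P] Y_def X_def by (simp add: algebra_simps)
    moreover have "\<dots> \<le> 2 * (w x * \<kappa> x * laplacian P x)\<^sup>2 + 2 * (w x * Y)\<^sup>2"
      by (rule 2)
    ultimately show ?thesis
      by (simp add: power_mult_distrib algebra_simps)
  qed
  have i1: "integrable lborel (\<lambda>x. (w x * \<kappa> x)\<^sup>2 * (laplacian P x)\<^sup>2)"
    "integrable lborel (\<lambda>x. (laplacian \<kappa> x)\<^sup>2 * (P x)\<^sup>2)"
    "integrable lborel (\<lambda>x. \<zeta> x * G x)" "integrable lborel (\<lambda>x. \<zeta> x * (P x)\<^sup>2)"
    "integrable lborel (\<lambda>x. \<zeta> x * (laplacian P x)\<^sup>2)"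
    "integrable lborel (\<lambda>x. laplacian \<zeta> x * (P x)\<^sup>2)"
    "integrable lborel (\<lambda>x. \<zeta> x * (P x * laplacian P x))"
    "integrable lborel (\<lambda>x. (w x * laplacian (\<lambda>x. \<kappa> x * P x) x)\<^sup>2)"
  proof -
    have I: "integrable lborel (\<lambda>x. g x * f x)" if "smooth g" "smooth f" "bounded_support g"
      for f g :: "'a \<Rightarrow> real"
      using that by (intro integrable_bounded_support smooth_continuous smooth_mult bounded_support_mult1)
    have L: "smooth (laplacian P)" "smooth (laplacian \<kappa>)" "smooth (laplacian \<zeta>)"
      "bounded_support (laplacian \<kappa>)" "bounded_support (laplacian \<zeta>)"
      "bounded_support (\<lambda>x. w x * \<kappa> x)"
      "smooth (laplacian (\<lambda>x. \<kappa> x * P x))" "bounded_support (laplacian (\<lambda>x. \<kappa> x * P x))"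
      using P c z
      by (auto intro: bounded_support_laplacian bounded_support_mult1 bounded_support_mult2)
    show "integrable lborel (\<lambda>x. (w x * \<kappa> x)\<^sup>2 * (laplacian P x)\<^sup>2)"
      by (intro I smooth_power smooth_mult w c L bounded_support_power) simp
    show "integrable lborel (\<lambda>x. (laplacian \<kappa> x)\<^sup>2 * (P x)\<^sup>2)"
      by (intro I smooth_power P L bounded_support_power) simp
    show "integrable lborel (\<lambda>x. \<zeta> x * G x)" "integrable lborel (\<lambda>x. \<zeta> x * (P x)\<^sup>2)"
      "integrable lborel (\<lambda>x. \<zeta> x * (laplacian P x)\<^sup>2)"
      "integrable lborel (\<lambda>x. laplacian \<zeta> x * (P x)\<^sup>2)"
      "integrable lborel (\<lambda>x. \<zeta> x * (P x * laplacian P x))"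
      by (intro I smG smooth_power smooth_mult P L z)+
    show "integrable lborel (\<lambda>x. (w x * laplacian (\<lambda>x. \<kappa> x * P x) x)\<^sup>2)"
      by (intro integrable_bounded_support smooth_continuous smooth_power smooth_mult w L
          bounded_support_power bounded_support_mult2) simp
  qed
  have i2: "integrable lborel (\<lambda>x. \<bar>laplacian \<zeta> x\<bar> * (P x)\<^sup>2)"
    using integrable_norm[OF i1(6)] by (simp add: abs_mult)
  have "8 * l ^ 3 * (LINT x|lborel. ((x \<bullet> e + a) * w x * \<kappa> x)\<^sup>2 * (P x)\<^sup>2) \<le>
      (LINT x|lborel. (w x * laplacian (\<lambda>x. \<kappa> x * P x) x)\<^sup>2)"
    using carleman[OF _ bounded_support_mult1[OF c(2)] e l, of P a] P c
    by (simp add: w_def power_mult_distrib smooth_mult mult.assoc)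
  also have "\<dots> \<le> (LINT x|lborel. 2 * ((w x * \<kappa> x)\<^sup>2 * (laplacian P x)\<^sup>2) +
      W * 4 * ((laplacian \<kappa> x)\<^sup>2 * (P x)\<^sup>2) + 16 * K * W * (\<zeta> x * G x))"
    using pw i1 by (intro integral_mono) (auto simp: mult.assoc)
  also have "\<dots> = (LINT x|lborel. 2 * ((w x * \<kappa> x)\<^sup>2 * (laplacian P x)\<^sup>2) +
      W * 4 * ((laplacian \<kappa> x)\<^sup>2 * (P x)\<^sup>2)) +
      16 * K * W * (LINT x|lborel. laplacian \<zeta> x / 2 * (P x)\<^sup>2 - \<zeta> x * (P x * laplacian P x))"
    using caccioppoli[OF P z(1,2)] i1 by (simp add: G_def)
  also have "\<dots> = (LINT x|lborel. 2 * ((w x * \<kappa> x)\<^sup>2 * (laplacian P x)\<^sup>2) +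
      W * 4 * ((laplacian \<kappa> x)\<^sup>2 * (P x)\<^sup>2) +
      16 * K * W * ((laplacian \<zeta> x * (P x)\<^sup>2) / 2 - \<zeta> x * (P x * laplacian P x)))"
    using i1 by simp
  also have "\<dots> \<le> (LINT x|lborel. 2 * ((w x * \<kappa> x)\<^sup>2 * (laplacian P x)\<^sup>2) +
      W * 4 * ((laplacian \<kappa> x)\<^sup>2 * (P x)\<^sup>2) +
      16 * K * W * ((\<bar>laplacian \<zeta> x\<bar> * (P x)\<^sup>2) / 2 + (\<zeta> x * (P x)\<^sup>2) / 2 + (\<zeta> x * (laplacian P x)\<^sup>2) / 2))"
  proof (intro integral_mono add_left_mono mult_left_mono)
    fix x
    have "laplacian \<zeta> x * (P x)\<^sup>2 \<le> \<bar>laplacian \<zeta> x\<bar> * (P x)\<^sup>2"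
      by (intro mult_right_mono) auto
    moreover have "\<zeta> x * (- 2 * P x * laplacian P x) \<le> \<zeta> x * ((P x)\<^sup>2 + (laplacian P x)\<^sup>2)"
      using sum_squares_bound[of "- P x" "laplacian P x"] by (intro mult_left_mono z) auto
    ultimately show "laplacian \<zeta> x * (P x)\<^sup>2 / 2 - \<zeta> x * (P x * laplacian P x) \<le>
        \<bar>laplacian \<zeta> x\<bar> * (P x)\<^sup>2 / 2 + \<zeta> x * (P x)\<^sup>2 / 2 + \<zeta> x * (laplacian P x)\<^sup>2 / 2"
      by (simp add: algebra_simps)
  qed (use i1 i2 K W in auto)
  also have "\<dots> = (LINT x|lborel. 2 * ((w x * \<kappa> x)\<^sup>2 * (laplacian P x)\<^sup>2)
      + (W * 4 * ((laplacian \<kappa> x)\<^sup>2 * (P x)\<^sup>2) + 8 * K * W * (\<bar>laplacian \<zeta> x\<bar> * (P x)\<^sup>2)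
      + 8 * K * W * (\<zeta> x * (P x)\<^sup>2)) + 8 * K * W * (\<zeta> x * (laplacian P x)\<^sup>2))"
    by (simp add: algebra_simps)
  also have "\<dots> = 2 * (LINT x|lborel. (w x * \<kappa> x)\<^sup>2 * (laplacian P x)\<^sup>2)
      + (LINT x|lborel. W * 4 * ((laplacian \<kappa> x)\<^sup>2 * (P x)\<^sup>2) + 8 * K * W * (\<bar>laplacian \<zeta> x\<bar> * (P x)\<^sup>2)
      + 8 * K * W * (\<zeta> x * (P x)\<^sup>2)) + (LINT x|lborel. 8 * K * W * (\<zeta> x * (laplacian P x)\<^sup>2))"
    using i1 i2 by simp
  finally show ?thesis
    by (simp add: algebra_simps)
qed

section \<open>Mollification\<close>

text \<open>Borel rather than Lebesgue measurability makes \<open>u y * h (x - y)\<close> measurable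
  on the product space, as Fubini's theorem requires.\<close>

definition loc_int :: "('a::euclidean_space \<Rightarrow> real) \<Rightarrow> bool" where
  "loc_int u \<longleftrightarrow> u \<in> borel_measurable borel \<and>
    (\<forall>r. integrable lborel (\<lambda>x. indicator (cball 0 r) x * u x))"

definition conv :: "('a::euclidean_space \<Rightarrow> real) \<Rightarrow> ('a \<Rightarrow> real) \<Rightarrow> 'a \<Rightarrow> real" where
  "conv u k x = (LINT y|lborel. u y * k (x - y))"

lemma loc_int_measurable: "loc_int u \<Longrightarrow> u \<in> borel_measurable borel"
  by (simp add: loc_int_def)

lemma loc_int_abs:
  assumes "loc_int u"
  shows "loc_int (\<lambda>x. \<bar>u x\<bar>)"
  unfolding loc_int_def
proof (intro conjI allI)
  show "(\<lambda>x. \<bar>u x\<bar>) \<in> borel_measurable borel"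
    using loc_int_measurable[OF assms] by measurable
  fix r
  have "integrable lborel (\<lambda>x. norm (indicator (cball 0 r) x * u x))"
    using assms by (simp add: loc_int_def)
  then show "integrable lborel (\<lambda>x. indicator (cball 0 r) x * \<bar>u x\<bar>)"
    by (simp add: abs_mult)
qed

lemma integrable_loc_int_mult:
  assumes u: "loc_int u" and g: "continuous_on UNIV g" "bounded_support g"
  shows "integrable lborel (\<lambda>y. u y * g y)"
proof -
  obtain B where B: "B > 0" "\<And>x. \<bar>g x\<bar> \<le> B"
    using bounded_support_bounded g by metis
  obtain r where r: "\<forall>x. norm x > r \<longrightarrow> g x = 0"
    using g unfolding bounded_support_def by auto
  have [measurable]: "u \<in> borel_measurable borel" "g \<in> borel_measurable borel"
    using u g borel_measurable_continuous_onI by (auto simp: loc_int_def)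
  show ?thesis
  proof (rule Bochner_Integration.integrable_bound)
    show "integrable lborel (\<lambda>x. B * (indicator (cball 0 r) x * u x))"
      using u by (simp add: loc_int_def)
    show "AE x in lborel. norm (u x * g x) \<le> norm (B * (indicator (cball 0 r) x * u x))"
    proof (rule AE_I2)
      fix x
      show "norm (u x * g x) \<le> norm (B * (indicator (cball 0 r) x * u x))"
        using B r mult_left_mono[OF B(2)[of x], of "\<bar>u x\<bar>"]
        by (cases "norm x > r") (auto simp: abs_mult mult.commute)
    qed
  qed simp
qed

lemma continuous_on_reflect: "continuous_on UNIV k \<Longrightarrow> continuous_on UNIV (\<lambda>y. k (x - y))"
  for k :: "'a::euclidean_space \<Rightarrow> real"
  by (rule continuous_on_compose2[of UNIV k]) (auto intro!: continuous_intros)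

lemma bounded_support_reflect:
  assumes "bounded_support k"
  shows "bounded_support (\<lambda>y. k (x - y))"
proof -
  obtain r where r: "\<forall>x. norm x > r \<longrightarrow> k x = 0"
    using assms unfolding bounded_support_def by auto
  have "k (x - y) = 0" if "norm y > r + norm x" for y
  proof -
    have "norm (x - y) > r"
      using that norm_triangle_ineq2[of y x] by (simp add: norm_minus_commute)
    then show ?thesis using r by blast
  qed
  then show ?thesis
    unfolding bounded_support_def by blast
qed

lemma integrable_conv:
  assumes "loc_int u" "continuous_on UNIV k" "bounded_support k"
  shows "integrable lborel (\<lambda>y. u y * k (x - y))"
  by (rule integrable_loc_int_mult[OF assms(1) continuous_on_reflect[OF assms(2)]
        bounded_support_reflect[OF assms(3)]])

text \<open>The partial derivatives are uniformly continuous, so the mean value inequality gives a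
  remainder that is uniform in \<open>z\<close>. That uniformity is what allows differentiation
  under a convolution integral.\<close>

lemma uniform_linearization:
  fixes k :: "'a::euclidean_space \<Rightarrow> real"
  assumes k: "smooth k" "bounded_support k" and "\<epsilon> > 0"
  obtains \<delta> where "\<delta> > 0" "\<And>z h. norm h < \<delta> \<Longrightarrow>
    \<bar>k (z + h) - k z - (\<Sum>b\<in>Basis. (h \<bullet> b) * partial_deriv b k z)\<bar> \<le> \<epsilon> * norm h"
proof -
  \<comment> \<open>The operator norm of a difference of derivatives is estimated by the sum over
    the \<open>DIM('a)\<close> coordinate directions.\<close>
  define \<epsilon>' where "\<epsilon>' = \<epsilon> / DIM('a)"
  have "\<epsilon>' > 0" using \<open>\<epsilon> > 0\<close> by (simp add: \<epsilon>'_def)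
  have "\<exists>\<delta>>0. \<forall>x y. dist x y < \<delta> \<longrightarrow> \<bar>partial_deriv b k x - partial_deriv b k y\<bar> < \<epsilon>'"
    if "b \<in> Basis" for b
    using bounded_support_uniformly_continuous[OF smooth_continuous[OF smooth_partial[OF k(1) that]]
        bounded_support_partial[OF k(2)] \<open>\<epsilon>' > 0\<close>] by metis
  then obtain d where d: "\<And>b. b \<in> Basis \<Longrightarrow> d b > 0"
    "\<And>b x y. b \<in> Basis \<Longrightarrow> dist x y < d b \<Longrightarrow> \<bar>partial_deriv b k x - partial_deriv b k y\<bar> < \<epsilon>'"
    by metis
  define \<delta> where "\<delta> = Min (d ` Basis)"
  have "\<delta> > 0" using d(1) by (auto simp: \<delta>_def)
  moreover have "\<bar>k (z + h) - k z - (\<Sum>b\<in>Basis. (h \<bullet> b) * partial_deriv b k z)\<bar> \<le> \<epsilon> * norm h"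
    if h: "norm h < \<delta>" for z h
  proof -
    let ?D = "\<lambda>x h. \<Sum>b\<in>Basis. (h \<bullet> b) * partial_deriv b k x"
    have "norm (k (z + h) - k z - ?D z ((z + h) - z)) \<le> norm ((z + h) - z) * \<epsilon>"
    proof (rule differentiable_bound_linearization[where S = "ball z \<delta>"])
      show "z + t *\<^sub>R ((z + h) - z) \<in> ball z \<delta>" if "t \<in> {0..1}" for t
        using that h mult_left_le_one_le[of "norm h" t] by (auto simp: dist_norm)
      show "(k has_derivative ?D x) (at x within ball z \<delta>)" if "x \<in> ball z \<delta>" for x
        using has_derivative_partials[OF smooth_differentiable[OF k(1)]]
        by (rule has_derivative_at_withinI)
      show "z \<in> ball z \<delta>" using \<open>\<delta> > 0\<close> by simp
      show "onorm (?D x - ?D z) \<le> \<epsilon>" if x: "x \<in> ball z \<delta>" for x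
      proof (rule onorm_le)
        fix y
        have "norm ((?D x - ?D z) y) =
            \<bar>\<Sum>b\<in>Basis. (y \<bullet> b) * (partial_deriv b k x - partial_deriv b k z)\<bar>"
          by (simp add: sum_subtractf right_diff_distrib)
        also have "\<dots> \<le> (\<Sum>b\<in>Basis. \<bar>(y \<bullet> b) * (partial_deriv b k x - partial_deriv b k z)\<bar>)"
          by (rule sum_abs)
        also have "\<dots> \<le> (\<Sum>b\<in>(Basis::'a set). norm y * \<epsilon>')"
        proof (intro sum_mono)
          fix b :: 'a assume b: "b \<in> Basis"
          have "dist x z < d b"
            using x b by (auto simp: \<delta>_def dist_commute)
          then show "\<bar>(y \<bullet> b) * (partial_deriv b k x - partial_deriv b k z)\<bar> \<le> norm y * \<epsilon>'"
            unfolding abs_mult using d(2)[OF b] Basis_le_norm[OF b]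
            by (intro mult_mono) (auto intro: less_imp_le)
        qed
        also have "\<dots> = \<epsilon> * norm y" by (simp add: \<epsilon>'_def)
        finally show "norm ((?D x - ?D z) y) \<le> \<epsilon> * norm y" .
      qed
    qed
    then show ?thesis by (simp add: mult.commute)
  qed
  ultimately show ?thesis using that by blast
qed

text \<open>The linearization error of the kernel is at most a small multiple of
  \<open>norm (y - x)\<close>, uniformly in the integration variable, and vanishes outside a fixed
  ball; integrating it against \<open>u\<close> needs only local integrability.\<close>

lemma conv_has_derivative:
  assumes u: "loc_int u" and k: "smooth k" "bounded_support k"
  shows "(conv u k has_derivative (\<lambda>h. \<Sum>b\<in>Basis. (h \<bullet> b) * conv u (partial_deriv b k) x)) (at x)"
  unfolding has_derivative_at_alt
proof (intro conjI allI impI)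
  show "bounded_linear (\<lambda>h. \<Sum>b\<in>Basis. (h \<bullet> b) * conv u (partial_deriv b k) x)"
    by (intro bounded_linear_sum bounded_linear_mult_const bounded_linear_inner_left)
  fix e :: real assume "e > 0"
  obtain r where r: "\<forall>x. norm x > r \<longrightarrow> k x = 0"
    using k unfolding bounded_support_def by auto
  \<comment> \<open>For \<open>norm (y - x) < 1\<close> and \<open>norm s > \<rho>\<close>, both
    \<open>x - s\<close> and \<open>y - s\<close> lie outside the support of
    \<open>k\<close>.\<close>
  define \<rho> where "\<rho> = \<bar>r\<bar> + norm x + 1"
  \<comment> \<open>Adding 1 keeps \<open>C\<close> positive when \<open>u\<close> vanishes on the
    ball, so that \<open>e / C\<close> makes sense.\<close>
  define C where "C = (LINT s|lborel. indicator (cball 0 \<rho>) s * \<bar>u s\<bar>) + 1"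
  have iu: "integrable lborel (\<lambda>s. indicator (cball 0 \<rho>) s * \<bar>u s\<bar>)"
    using loc_int_abs[OF u] by (simp add: loc_int_def)
  have "(LINT s|lborel. indicator (cball 0 \<rho>) s * \<bar>u s\<bar>) \<ge> 0"
    by (intro integral_nonneg_AE) auto
  then have "C > 0" unfolding C_def by linarith
  then have "e / C > 0" using \<open>e > 0\<close> by simp
  obtain \<delta> where \<delta>: "\<delta> > 0" "\<And>z h. norm h < \<delta> \<Longrightarrow>
    \<bar>k (z + h) - k z - (\<Sum>b\<in>Basis. (h \<bullet> b) * partial_deriv b k z)\<bar> \<le> (e / C) * norm h"
    using uniform_linearization[OF k \<open>e / C > 0\<close>] by metis
  have kd: "partial_deriv b k z = 0" if "norm z > r" for b z
    using r that by (intro partial_deriv_eq_0_outside[OF open_norm_greater[of r]]) auto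
  have "norm (conv u k y - conv u k x - (\<Sum>b\<in>Basis. ((y - x) \<bullet> b) * conv u (partial_deriv b k) x))
      \<le> e * norm (y - x)" if y: "norm (y - x) < min \<delta> 1" for y
  proof -
    define E where "E = (\<lambda>s. k (y - s) - k (x - s) - (\<Sum>b\<in>Basis. ((y - x) \<bullet> b) * partial_deriv b k (x - s)))"
    have ik: "integrable lborel (\<lambda>s. u s * k (z - s))" for z
      using u k smooth_continuous by (intro integrable_conv) auto
    have ikd: "integrable lborel (\<lambda>s. u s * partial_deriv b k (x - s))" if "b \<in> Basis" for b
      using u k that smooth_continuous smooth_partial bounded_support_partial
      by (intro integrable_conv) auto
    have eqE: "(\<lambda>s. u s * E s) = (\<lambda>s. u s * k (y - s) - u s * k (x - s) -
        (\<Sum>b\<in>Basis. ((y - x) \<bullet> b) * (u s * partial_deriv b k (x - s))))"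
      by (auto simp: E_def algebra_simps sum_distrib_left)
    have iE: "integrable lborel (\<lambda>s. u s * E s)"
      unfolding eqE using ik ikd by (intro Bochner_Integration.integrable_diff
          Bochner_Integration.integrable_sum integrable_mult_right) auto
    have "conv u k y - conv u k x - (\<Sum>b\<in>Basis. ((y - x) \<bullet> b) * conv u (partial_deriv b k) x) =
        (LINT s|lborel. u s * E s)"
      unfolding eqE conv_def using ik ikd by simp
    also have "norm \<dots> \<le> (LINT s|lborel. norm (u s * E s))"
      by (rule integral_norm_bound)
    also have "\<dots> \<le> (LINT s|lborel. e / C * norm (y - x) * (indicator (cball 0 \<rho>) s * \<bar>u s\<bar>))"
    proof (intro integral_mono)
      fix s
      show "norm (u s * E s) \<le> e / C * norm (y - x) * (indicator (cball 0 \<rho>) s * \<bar>u s\<bar>)"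
      proof (cases "norm s \<le> \<rho>")
        case True
        have "\<bar>E s\<bar> \<le> e / C * norm (y - x)"
          using \<delta>(2)[of "y - x" "x - s"] y by (simp add: E_def)
        from mult_right_mono[OF this, of "\<bar>u s\<bar>"] show ?thesis
          using True by (simp add: abs_mult mult_ac)
      next
        case False
        have "norm s \<le> norm (x - s) + norm x" "norm s \<le> norm (y - s) + norm (y - x) + norm x"
          using norm_triangle_ineq4[of x "x - s"] norm_triangle_ineq4[of y "y - s"]
            norm_triangle_ineq[of "y - x" x] by auto
        then have "norm (x - s) > r" "norm (y - s) > r"
          using False y by (auto simp: \<rho>_def)
        then have "E s = 0" using r kd by (simp add: E_def)
        then show ?thesis using False by simp
      qed
    qed (use iE iu in \<open>auto simp del: times_divide_eq_left intro!: integrable_mult_right\<close>)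
    also have "\<dots> = e / C * norm (y - x) * (C - 1)"
      by (simp add: C_def)
    also have "\<dots> \<le> e / C * norm (y - x) * C"
      using \<open>e / C > 0\<close> by (intro mult_left_mono mult_nonneg_nonneg less_imp_le[OF \<open>e / C > 0\<close>]) auto
    also have "\<dots> = e * norm (y - x)"
      using \<open>C > 0\<close> by simp
    finally show ?thesis .
  qed
  then show "\<exists>d>0. \<forall>y. norm (y - x) < d \<longrightarrow>
      norm (conv u k y - conv u k x - (\<Sum>b\<in>Basis. ((y - x) \<bullet> b) * conv u (partial_deriv b k) x))
      \<le> e * norm (y - x)"
    using \<delta>(1) by (intro exI[of _ "min \<delta> 1"]) auto
qed

lemma partial_deriv_conv:
  assumes "loc_int u" "smooth k" "bounded_support k" "b \<in> Basis"
  shows "partial_deriv b (conv u k) = conv u (partial_deriv b k)"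
proof
  fix x
  show "partial_deriv b (conv u k) x = conv u (partial_deriv b k) x"
    using partial_deriv_eqI[OF conv_has_derivative[OF assms(1-3)], of b x]
      sum_Basis_inner_mult[OF assms(4), of "\<lambda>c. conv u (partial_deriv c k) x"]
    by (simp add: inner_commute)
qed

text \<open>All derivatives fall on the kernel, so the induction has to run over all kernels at
  once.\<close>

lemma smooth_conv:
  assumes u: "loc_int u" and k: "smooth k" "bounded_support k"
  shows "smooth (conv u k)"
proof -
  have diff: "conv u k differentiable (at x)" if "smooth k" "bounded_support k" for k x
    using conv_has_derivative[OF u that] by (auto simp: differentiable_def)
  have "Ck n (conv u k)" for n
    using k
  proof (induction n arbitrary: k)
    case 0
    then show ?case
      using diff by (auto intro!: differentiable_imp_continuous_on simp: differentiable_on_def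
          intro: differentiable_at_withinI)
  next
    case (Suc n)
    have "Ck n (partial_deriv b (conv u k))" if "b \<in> Basis" for b
      unfolding partial_deriv_conv[OF u Suc.prems that]
      using Suc that by (intro Suc.IH smooth_partial bounded_support_partial)
    then show ?case
      using diff Suc.prems by simp
  qed
  then show ?thesis by (simp add: smooth_def)
qed

lemma laplacian_conv:
  assumes u: "loc_int u" and k: "smooth k" "bounded_support k"
  shows "laplacian (conv u k) = conv u (laplacian k)"
proof
  fix x
  have "laplacian (conv u k) x = (\<Sum>b\<in>Basis. conv u (partial_deriv b (partial_deriv b k)) x)"
    unfolding laplacian_def using assms
    by (intro sum.cong) (auto simp: partial_deriv_conv smooth_partial bounded_support_partial)
  also have "\<dots> = conv u (laplacian k) x"
    unfolding conv_def laplacian_def sum_distrib_left using assms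
    by (subst Bochner_Integration.integral_sum)
      (auto intro!: integrable_conv smooth_continuous smooth_partial bounded_support_partial)
  finally show "laplacian (conv u k) x = conv u (laplacian k) x" .
qed

lemma smooth_partial_uminus:
  "smooth f \<Longrightarrow> partial_deriv b (\<lambda>x. - f x) = (\<lambda>x. - partial_deriv b f x)"
  using smooth_partial_diff[of "\<lambda>_. 0" f b] by (simp add: partial_deriv_const_fun)

lemma laplacian_reflect:
  assumes "smooth k"
  shows "laplacian (\<lambda>y. k (x - y)) y = laplacian k (x - y)"
proof -
  have "partial_deriv b (partial_deriv b (\<lambda>y. k (x - y))) y = partial_deriv b (partial_deriv b k) (x - y)"
    if b: "b \<in> Basis" for b
  proof -
    have sk: "smooth (partial_deriv b k)" using assms b by (rule smooth_partial)
    have "partial_deriv b (\<lambda>y. k (x - y)) = (\<lambda>y. - partial_deriv b k (x - y))"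
      using partial_deriv_reflect smooth_differentiable[OF assms] by fastforce
    moreover have "smooth (\<lambda>y. partial_deriv b k (x - y))"
      using sk Ck_reflect by (auto simp: smooth_def)
    ultimately show ?thesis
      using partial_deriv_reflect[where f = "partial_deriv b k" and x = x and y = y and b = b]
        smooth_differentiable[OF sk]
      by (simp add: smooth_partial_uminus)
  qed
  then show ?thesis by (simp add: laplacian_def)
qed

text \<open>The reflected kernel \<open>y \<mapsto> k (x - y)\<close> is itself an admissible test
  function; inserting it turns the distributional equation into a classical one for the mollified
  functions.\<close>

lemma laplacian_conv_distributional:
  assumes u: "loc_int p" "loc_int q" and k: "smooth k" "bounded_support k"
    and eq: "\<And>\<phi>. smooth \<phi> \<Longrightarrow> bounded_support \<phi> \<Longrightarrow>
      (LINT x|lborel. p x * laplacian \<phi> x) = (LINT x|lborel. q x * \<phi> x)"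
  shows "laplacian (conv p k) = conv q k"
proof
  fix x
  have "smooth (\<lambda>y. k (x - y))" "bounded_support (\<lambda>y. k (x - y))"
    using k Ck_reflect bounded_support_reflect by (auto simp: smooth_def)
  then show "laplacian (conv p k) x = conv q k x"
    using eq[of "\<lambda>y. k (x - y)"]
    by (simp add: laplacian_conv[OF u(1) k] conv_def laplacian_reflect[OF k(1)])
qed

text \<open>Normalised products of bumps in the coordinates, with the scaling by
  \<open>Suc n\<close> placed on the basis vectors. Beyond radius \<open>DIM('a) / Suc n\<close> the
  bound of the norm by the sum of the coordinates forces some coordinate to reach
  \<open>1 / Suc n\<close>, where its bump is 0.\<close>

lemma mollifier_sequence:
  obtains \<eta> :: "nat \<Rightarrow> 'a::euclidean_space \<Rightarrow> real"
  where "\<And>n. smooth (\<eta> n)" "\<And>n. bounded_support (\<eta> n)" "\<And>n x. \<eta> n x \<ge> 0"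
    "\<And>n. integral\<^sup>L lborel (\<eta> n) = 1"
    "\<And>n x. norm x > DIM('a) / real (Suc n) \<Longrightarrow> \<eta> n x = 0"
proof -
  define g where "g = (\<lambda>n x. \<Prod>b\<in>(Basis::'a set). bump (x \<bullet> (real (Suc n) *\<^sub>R b)))"
  have g: "smooth (g n)" "\<And>x. g n x \<ge> 0" for n
    unfolding g_def by (intro smooth_prod smooth_compose[OF smooth_bump] smooth_inner prod_nonneg bump_nonneg)+
  have g0: "g n x = 0" if "norm x > DIM('a) / real (Suc n)" for n x
  proof -
    have "\<exists>b\<in>Basis. \<bar>x \<bullet> b\<bar> \<ge> 1 / real (Suc n)"
    proof (rule ccontr)
      assume "\<not> ?thesis"
      then have "(\<Sum>b\<in>Basis. \<bar>x \<bullet> b\<bar>) \<le> (\<Sum>b\<in>(Basis::'a set). 1 / real (Suc n))"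
        by (intro sum_mono) auto
      then show False
        using that norm_le_l1[of x] by simp
    qed
    then obtain b where "b \<in> Basis" "\<bar>x \<bullet> b\<bar> * real (Suc n) \<ge> 1"
      by (auto simp: field_simps)
    then have "bump (x \<bullet> (real (Suc n) *\<^sub>R b)) = 0"
      by (intro bump_eq_0) (simp add: abs_mult mult.commute del: of_nat_Suc)
    then show ?thesis
      using \<open>b \<in> Basis\<close> unfolding g_def by (intro prod_zero) auto
  qed
  have gs: "bounded_support (g n)" for n
    using g0 unfolding bounded_support_def by blast
  have ig: "integrable lborel (g n)" for n
    using g gs by (intro integrable_bounded_support smooth_continuous)
  define c where "c = (\<lambda>n. integral\<^sup>L lborel (g n))"
  have c: "c n > 0" for n
  proof (rule ccontr)
    assume "\<not> c n > 0"
    moreover have "c n \<ge> 0"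
      unfolding c_def by (intro integral_nonneg_AE) (auto simp: g)
    ultimately have "integral\<^sup>L lborel (g n) = 0" by (simp add: c_def)
    \<comment> \<open>A non-negative function with integral 0 vanishes almost everywhere, but the
      set where \<open>g n\<close> is non-zero is open and contains 0.\<close>
    then have "AE x in lborel. g n x = 0"
      using integral_nonneg_eq_0_iff_AE[OF ig[of n]] g by simp
    then have "AE x in lebesgue. g n x = 0"
      by (rule AE_completion)
    then obtain N where N: "negligible N" "{x. g n x \<noteq> 0} \<subseteq> N"
      unfolding eventually_ae_filter_negligible by auto
    have "open {x. g n x \<noteq> 0}"
      using smooth_continuous[OF g(1)] by (intro open_Collect_neq continuous_on_const)
    moreover have "g n 0 \<noteq> 0"
      using bump_pos[of 0] by (simp add: g_def)
    ultimately show False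
      using open_not_negligible[of "{x. g n x \<noteq> 0}"] negligible_subset[OF N] by auto
  qed
  show ?thesis
  proof
    fix n and x :: 'a
    show "smooth (\<lambda>x. 1 / c n * g n x)" "bounded_support (\<lambda>x. 1 / c n * g n x)"
      by (intro smooth_mult smooth_const g bounded_support_mult2 gs)+
    show "1 / c n * g n x \<ge> 0"
      using c[of n] g by simp
    show "(LINT x|lborel. 1 / c n * g n x) = 1"
      using c[of n] by (simp add: c_def)
    show "norm x > DIM('a) / real (Suc n) \<Longrightarrow> 1 / c n * g n x = 0"
      using g0 by simp
  qed
qed

text \<open>Fubini's theorem. Because \<open>h\<close> is non-negative, the inner integral of the
  absolute value is \<open>\<bar>k x\<bar>\<close> times the mollification of
  \<open>\<bar>u\<bar>\<close>, which is continuous; bounded support of \<open>k\<close> then gives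
  integrability on the product.\<close>

lemma conv_swap:
  assumes u: "loc_int u" and h: "smooth h" "bounded_support h" "\<And>x. h x \<ge> 0"
    and k: "continuous_on UNIV k" "bounded_support k"
  shows "(LINT x|lborel. k x * conv u h x) = (LINT y|lborel. u y * (LINT x|lborel. k x * h (x - y)))"
    and "integrable lborel (\<lambda>y. u y * (LINT x|lborel. k x * h (x - y)))"
proof -
  have [measurable]: "u \<in> borel_measurable borel" "h \<in> borel_measurable borel" "k \<in> borel_measurable borel"
    using u h(1) k(1) loc_int_measurable smooth_measurable borel_measurable_continuous_onI by blast+
  define f where "f = (\<lambda>(x, y). k x * (u y * h (x - y)))"
  have int: "integrable (lborel \<Otimes>\<^sub>M lborel) f"
  proof (rule lborel_pair.Fubini_integrable)
    show "f \<in> borel_measurable (lborel \<Otimes>\<^sub>M lborel)"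
      unfolding f_def by measurable
    have eq: "(\<lambda>x. LINT y|lborel. norm (f (x, y))) = (\<lambda>x. \<bar>k x\<bar> * conv (\<lambda>y. \<bar>u y\<bar>) h x)"
      using h(3) by (simp add: f_def conv_def abs_mult)
    show "integrable lborel (\<lambda>x. LINT y|lborel. norm (f (x, y)))"
      unfolding eq
    proof (intro integrable_bounded_support continuous_on_mult continuous_on_rabs k(1)
        bounded_support_mult1)
      show "continuous_on UNIV (conv (\<lambda>y. \<bar>u y\<bar>) h)"
        using smooth_conv[OF loc_int_abs[OF u] h(1,2)] by (rule smooth_continuous)
      show "bounded_support (\<lambda>x. \<bar>k x\<bar>)"
        using k(2) by (auto simp: bounded_support_def)
    qed
    show "AE x in lborel. integrable lborel (\<lambda>y. f (x, y))"
      using integrable_conv[OF u smooth_continuous[OF h(1)] h(2)] by (simp add: f_def)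
  qed
  have fy: "(LINT x|lborel. f (x, y)) = u y * (LINT x|lborel. k x * h (x - y))" for y
  proof -
    have "f (x, y) = u y * (k x * h (x - y))" for x by (simp add: f_def)
    then show ?thesis by simp
  qed
  have "(LINT x|lborel. k x * conv u h x) = (LINT x|lborel. (LINT y|lborel. f (x, y)))"
    by (simp add: f_def conv_def)
  also have "\<dots> = (LINT y|lborel. (LINT x|lborel. f (x, y)))"
    using lborel_pair.Fubini_integral[of "\<lambda>x y. f (x, y)"] int by (simp add: case_prod_eta)
  also have "\<dots> = (LINT y|lborel. u y * (LINT x|lborel. k x * h (x - y)))"
    by (simp add: fy)
  finally show "(LINT x|lborel. k x * conv u h x) = (LINT y|lborel. u y * (LINT x|lborel. k x * h (x - y)))" .
  have "integrable lborel (\<lambda>y. LINT x|lborel. f (x, y))"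
    using lborel_pair.integrable_snd[of "\<lambda>x y. f (x, y)"] int by (simp add: case_prod_eta)
  then show "integrable lborel (\<lambda>y. u y * (LINT x|lborel. k x * h (x - y)))"
    by (simp add: fy)
qed

locale mollifier =
  fixes \<eta> :: "nat \<Rightarrow> 'a::euclidean_space \<Rightarrow> real"
  assumes smooth_eta: "\<And>n. smooth (\<eta> n)" and bounded_support_eta: "\<And>n. bounded_support (\<eta> n)"
    and eta_nonneg: "\<And>n x. \<eta> n x \<ge> 0" and integral_eta: "\<And>n. integral\<^sup>L lborel (\<eta> n) = 1"
    and eta_0: "\<And>n x. norm x > DIM('a) / real (Suc n) \<Longrightarrow> \<eta> n x = 0"
begin

lemma integral_eta_translate: "(LINT x|lborel. \<eta> n (x - y)) = 1"
  and integral_eta_reflect: "(LINT y|lborel. \<eta> n (x - y)) = 1"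
  and integrable_eta_translate: "integrable lborel (\<lambda>x. \<eta> n (x - y))"
  and integrable_eta_reflect: "integrable lborel (\<lambda>y. \<eta> n (x - y))"
proof -
  have [measurable]: "\<eta> n \<in> borel_measurable borel"
    using smooth_measurable[OF smooth_eta] .
  show 1: "(LINT x|lborel. \<eta> n (x - y)) = 1"
    using integral_lborel_translate[of "\<eta> n" "- y"] integral_eta[of n] by simp
  show 2: "(LINT y|lborel. \<eta> n (x - y)) = 1"
  proof -
    have "1 = integral\<^sup>L (density (distr lborel borel (\<lambda>y. x + (- 1) *\<^sub>R y)) (\<lambda>_. ennreal (\<bar>- 1\<bar> ^ DIM('a)))) (\<eta> n)"
      using integral_eta[of n] lborel_affine[of "- 1" x] by simp
    also have "\<dots> = (LINT y|lborel. \<eta> n (x - y))"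
      by (simp add: density_1 integral_distr)
    finally show ?thesis ..
  qed
  show "integrable lborel (\<lambda>x. \<eta> n (x - y))" "integrable lborel (\<lambda>y. \<eta> n (x - y))"
    using 1 2 not_integrable_integral_eq by fastforce+
qed

text \<open>By \<open>conv_swap\<close> the mollification moves from \<open>u\<close> to
  \<open>k\<close>. The averages of the uniformly continuous \<open>k\<close> converge to it
  uniformly and all live in one ball, so local integrability of \<open>u\<close> suffices.\<close>

lemma tendsto_integral_conv:
  assumes u: "loc_int u" and k: "continuous_on UNIV k" "bounded_support k"
  shows "(\<lambda>n. LINT x|lborel. k x * conv u (\<eta> n) x) \<longlonglongrightarrow> (LINT x|lborel. u x * k x)"
proof (rule LIMSEQ_I)
  fix e :: real assume "e > 0"
  obtain r where r: "\<forall>x. norm x > r \<longrightarrow> k x = 0"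
    using k unfolding bounded_support_def by auto
  define \<rho> where "\<rho> = \<bar>r\<bar> + 1"
  define C where "C = (LINT s|lborel. indicator (cball 0 \<rho>) s * \<bar>u s\<bar>) + 1"
  have iu: "integrable lborel (\<lambda>s. indicator (cball 0 \<rho>) s * \<bar>u s\<bar>)"
    using loc_int_abs[OF u] by (simp add: loc_int_def)
  have "(LINT s|lborel. indicator (cball 0 \<rho>) s * \<bar>u s\<bar>) \<ge> 0"
    by (intro integral_nonneg_AE) auto
  then have "C > 0" unfolding C_def by linarith
  then have "e / C > 0" using \<open>e > 0\<close> by simp
  obtain \<delta> where \<delta>: "\<delta> > 0" "\<And>x y. dist x y < \<delta> \<Longrightarrow> \<bar>k x - k y\<bar> < e / C"
    using bounded_support_uniformly_continuous[OF k \<open>e / C > 0\<close>] by metis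
  have "(\<lambda>n. DIM('a) / real (Suc n)) \<longlonglongrightarrow> 0"
    using LIMSEQ_Suc[OF lim_const_over_n] .
  then have "eventually (\<lambda>n. DIM('a) / real (Suc n) < min \<delta> 1) sequentially"
    using \<delta>(1) by (intro order_tendstoD) auto
  \<comment> \<open>Below \<open>\<delta>\<close> for the uniform continuity of \<open>k\<close>,
    and below 1 so that the averages of \<open>k\<close> stay supported in the ball of radius
    \<open>\<rho>\<close>.\<close>
  then obtain n0 where n0: "\<And>n. n \<ge> n0 \<Longrightarrow> DIM('a) / real (Suc n) < min \<delta> 1"
    unfolding eventually_sequentially by auto
  have "norm ((LINT x|lborel. k x * conv u (\<eta> n) x) - (LINT x|lborel. u x * k x)) < e"
    if n: "n \<ge> n0" for n
  proof -
    define K where "K = (\<lambda>y. LINT x|lborel. k x * \<eta> n (x - y))"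
    have swap: "(LINT x|lborel. k x * conv u (\<eta> n) x) = (LINT y|lborel. u y * K y)"
      "integrable lborel (\<lambda>y. u y * K y)"
      unfolding K_def using conv_swap[OF u smooth_eta bounded_support_eta eta_nonneg k] .
    have Kk: "\<bar>K y - k y\<bar> \<le> e / C" for y
    proof -
      have "integrable lborel (\<lambda>x. k x * \<eta> n (x - y))"
      proof (rule integrable_bounded_support)
        have "continuous_on UNIV (\<lambda>x. \<eta> n (x - y))"
          by (rule continuous_on_compose2[OF smooth_continuous[OF smooth_eta]]) (auto intro!: continuous_intros)
        then show "continuous_on UNIV (\<lambda>x. k x * \<eta> n (x - y))"
          using k by (intro continuous_on_mult)
      qed (intro bounded_support_mult1 k)
      then have eq: "K y - k y = (LINT x|lborel. (k x - k y) * \<eta> n (x - y))"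
        and i: "integrable lborel (\<lambda>x. (k x - k y) * \<eta> n (x - y))"
        using integrable_eta_translate[of n y] integral_eta_translate[of n y]
        by (simp_all add: K_def left_diff_distrib)
      have "\<bar>K y - k y\<bar> \<le> (LINT x|lborel. norm ((k x - k y) * \<eta> n (x - y)))"
        unfolding eq using integral_norm_bound[of lborel "\<lambda>x. (k x - k y) * \<eta> n (x - y)"] by simp
      also have "\<dots> \<le> (LINT x|lborel. e / C * \<eta> n (x - y))"
      proof (intro integral_mono)
        fix x
        show "norm ((k x - k y) * \<eta> n (x - y)) \<le> e / C * \<eta> n (x - y)"
        proof (cases "norm (x - y) > DIM('a) / real (Suc n)")
          case True
          then show ?thesis using eta_0 by simp
        next
          case False
          then have "dist x y < \<delta>" using n0[OF n] by (simp add: dist_norm)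
          then show ?thesis
            unfolding norm_mult using \<delta>(2)[of x y] eta_nonneg[of n "x - y"]
            by (intro mult_mono) auto
        qed
      qed (use i integrable_eta_translate in \<open>auto simp del: times_divide_eq_left intro!: integrable_mult_right\<close>)
      also have "\<dots> = e / C" by (simp add: integral_eta_translate del: times_divide_eq_left)
      finally show ?thesis .
    qed
    have K0: "K y = 0" "k y = 0" if y: "norm y > \<rho>" for y
    proof -
      have z: "k x * \<eta> n (x - y) = 0" for x
      proof (cases "norm x > r")
        case False
        have "norm y \<le> norm (x - y) + norm x"
          using norm_triangle_ineq4[of x "x - y"] by simp
        then have "norm (x - y) > 1" using False y by (simp add: \<rho>_def)
        then have "\<eta> n (x - y) = 0" using n0[OF n] by (intro eta_0) linarith
        then show ?thesis by simp
      qed (use r in auto)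
      show "K y = 0" unfolding K_def z by simp
      show "k y = 0" using y r by (auto simp: \<rho>_def)
    qed
    have i: "integrable lborel (\<lambda>y. u y * K y)" "integrable lborel (\<lambda>y. u y * k y)"
      using swap(2) integrable_loc_int_mult[OF u k] .
    have "(LINT x|lborel. k x * conv u (\<eta> n) x) - (LINT x|lborel. u x * k x) =
        (LINT y|lborel. u y * K y - u y * k y)"
      using swap(1) i by simp
    also have "norm \<dots> \<le> (LINT y|lborel. norm (u y * K y - u y * k y))"
      by (rule integral_norm_bound)
    also have "\<dots> \<le> (LINT y|lborel. e / C * (indicator (cball 0 \<rho>) y * \<bar>u y\<bar>))"
    proof (intro integral_mono)
      fix y
      show "norm (u y * K y - u y * k y) \<le> e / C * (indicator (cball 0 \<rho>) y * \<bar>u y\<bar>)"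
      proof (cases "norm y > \<rho>")
        case True
        then show ?thesis using K0 by simp
      next
        case False
        have "norm (u y * K y - u y * k y) = \<bar>u y\<bar> * \<bar>K y - k y\<bar>"
          by (simp add: abs_mult flip: right_diff_distrib)
        then show ?thesis
          using False mult_left_mono[OF Kk[of y], of "\<bar>u y\<bar>"] by (simp add: mult.commute)
      qed
    qed (use i iu in \<open>auto simp del: times_divide_eq_left intro!: integrable_mult_right\<close>)
    also have "\<dots> = e / C * (C - 1)" by (simp add: C_def)
    also have "\<dots> < e / C * C"
      using \<open>e / C > 0\<close> by (intro mult_strict_left_mono) auto
    finally show ?thesis using \<open>C > 0\<close> by simp
  qed
  then show "\<exists>n0. \<forall>n\<ge>n0. norm ((LINT x|lborel. k x * conv u (\<eta> n) x) - (LINT x|lborel. u x * k x)) < e"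
    by blast
qed

end

section \<open>Passing to the limit\<close>

lemma loc_int_square:
  assumes "u \<in> borel_measurable borel" "integrable lborel (\<lambda>x. (u x)\<^sup>2)"
  shows "loc_int (\<lambda>x. (u x)\<^sup>2)"
  using assms integrable_mult_indicator[of "cball 0 _" lborel "\<lambda>x. (u x)\<^sup>2"]
  by (simp add: loc_int_def)

lemma loc_int_of_square_integrable:
  assumes u [measurable]: "u \<in> borel_measurable borel" and u2: "integrable lborel (\<lambda>x. (u x)\<^sup>2)"
  shows "loc_int u"
  unfolding loc_int_def
proof (intro conjI allI u)
  fix r
  have one: "integrable lborel (\<lambda>x::'a. indicator (cball 0 r) x *\<^sub>R (1::real))"
    by (intro borel_integrable_compact) auto
  show "integrable lborel (\<lambda>x. indicator (cball 0 r) x * u x)"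
  proof (rule Bochner_Integration.integrable_bound)
    show "integrable lborel (\<lambda>x. (u x)\<^sup>2 + indicator (cball 0 r) x *\<^sub>R (1::real))"
      using u2 one by (rule Bochner_Integration.integrable_add)
    show "AE x in lborel. norm (indicator (cball 0 r) x * u x) \<le>
        norm ((u x)\<^sup>2 + indicator (cball 0 r) x *\<^sub>R (1::real))"
    proof (rule AE_I2)
      fix x
      have "2 * \<bar>u x\<bar> \<le> (u x)\<^sup>2 + 1"
        using sum_squares_bound[of "\<bar>u x\<bar>" 1] by simp
      then have "\<bar>u x\<bar> \<le> (u x)\<^sup>2 + 1" by linarith
      then show "norm (indicator (cball 0 r) x * u x) \<le>
          norm ((u x)\<^sup>2 + indicator (cball 0 r) x *\<^sub>R (1::real))"
        by (simp add: indicator_def)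
    qed
    show "(\<lambda>x. indicator (cball 0 r) x * u x) \<in> borel_measurable lborel"
      using u by (intro borel_measurable_times borel_measurable_indicator) auto
  qed
qed

definition clamp_real :: "real \<Rightarrow> real \<Rightarrow> real" where
  "clamp_real N t = max (- N) (min N t)"

text \<open>Truncate \<open>u\<close> at height \<open>N\<close>, then use that a measurable
  function is an almost everywhere limit of continuous functions. These are truncated at the same
  height, so \<open>\<psi> (2 N)^2\<close> dominates the error. Each of the two errors may cost
  \<open>\<epsilon> / 4\<close>, since \<open>(p + q)^2 \<le> 2 p^2 + 2 q^2\<close> doubles
  both.\<close>

lemma continuous_approximation_weighted_L2:
  fixes u \<psi> :: "'a::euclidean_space \<Rightarrow> real"
  assumes u [measurable]: "u \<in> borel_measurable borel" and u2: "integrable lborel (\<lambda>x. (u x)\<^sup>2)"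
    and \<psi>: "continuous_on UNIV \<psi>" "bounded_support \<psi>" "\<And>x. \<psi> x \<ge> 0" and "\<epsilon> > 0"
  obtains v where "continuous_on UNIV v" "(LINT x|lborel. \<psi> x * (u x - v x)\<^sup>2) < \<epsilon>"
proof -
  have [measurable]: "\<psi> \<in> borel_measurable borel"
    using \<psi>(1) by (rule borel_measurable_continuous_onI)
  have mcl [measurable]: "clamp_real N \<in> borel_measurable borel" for N
    unfolding clamp_real_def[abs_def] by measurable
  have i\<psi>: "integrable lborel \<psi>"
    using \<psi> by (intro integrable_bounded_support)
  have iu: "integrable lborel (\<lambda>x. \<psi> x * (u x)\<^sup>2)"
    using integrable_loc_int_mult[OF loc_int_square[OF u u2] \<psi>(1,2)] by (simp add: mult.commute)
  have cl: "\<bar>clamp_real N t\<bar> \<le> N" "\<bar>t - clamp_real N t\<bar> \<le> \<bar>t\<bar>" if "N \<ge> 0" for N t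
    using that by (auto simp: clamp_real_def max_def min_def)
  have "(\<lambda>N. LINT x|lborel. \<psi> x * (u x - clamp_real (real N) (u x))\<^sup>2) \<longlonglongrightarrow> (LINT x::'a|lborel. 0)"
  proof (rule integral_dominated_convergence[where w = "\<lambda>x. \<psi> x * (u x)\<^sup>2"])
    show "AE x in lborel. (\<lambda>N. \<psi> x * (u x - clamp_real (real N) (u x))\<^sup>2) \<longlonglongrightarrow> 0"
    proof (rule AE_I2)
      fix x
      obtain N0 :: nat where "\<bar>u x\<bar> \<le> real N0" using real_arch_simple by blast
      then have "\<psi> x * (u x - clamp_real (real N) (u x))\<^sup>2 = 0" if "N \<ge> N0" for N
        using that by (auto simp: clamp_real_def max_def min_def)
      then show "(\<lambda>N. \<psi> x * (u x - clamp_real (real N) (u x))\<^sup>2) \<longlonglongrightarrow> 0"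
        by (intro tendsto_eventually) (auto simp: eventually_sequentially)
    qed
    show "AE x in lborel. norm (\<psi> x * (u x - clamp_real (real N) (u x))\<^sup>2) \<le> \<psi> x * (u x)\<^sup>2" for N
      using cl(2)[of "real N"] \<psi>(3) by (intro AE_I2) (simp add: abs_mult mult_left_mono abs_le_square_iff)
  qed (use iu in measurable)
  then have "eventually (\<lambda>N. (LINT x|lborel. \<psi> x * (u x - clamp_real (real N) (u x))\<^sup>2) < \<epsilon> / 4) sequentially"
    using \<open>\<epsilon> > 0\<close> by (intro order_tendstoD) auto
  then obtain N :: nat where N: "(LINT x|lborel. \<psi> x * (u x - clamp_real (real N) (u x))\<^sup>2) < \<epsilon> / 4"
    unfolding eventually_sequentially by auto
  have "u \<in> borel_measurable lebesgue"
    using u measurable_completion by (metis measurable_lborel2)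
  then have "u measurable_on UNIV"
    by (rule lebesgue_measurable_imp_measurable_on) auto
  then obtain Z g where Z: "negligible Z" and g: "\<And>n. continuous_on UNIV (g n)"
    and lim: "\<And>x. x \<notin> Z \<Longrightarrow> (\<lambda>n. g n x) \<longlonglongrightarrow> u x"
    unfolding measurable_on_def by auto
  have [measurable]: "g n \<in> borel_measurable borel" for n
    using g by (rule borel_measurable_continuous_onI)
  have cont: "continuous_on UNIV (\<lambda>x. clamp_real (real N) (g n x))" for n
    unfolding clamp_real_def using g by (intro continuous_intros)
  have aelim: "AE x in lborel. (\<lambda>n. g n x) \<longlonglongrightarrow> u x"
  proof -
    have "AE x in lebesgue. (\<lambda>n. g n x) \<longlonglongrightarrow> u x"
      unfolding eventually_ae_filter_negligible using Z lim by (intro exI[of _ Z]) auto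
    then show ?thesis by (simp add: AE_completion_iff)
  qed
  define d where "d = (\<lambda>n x. \<psi> x * (clamp_real (real N) (u x) - clamp_real (real N) (g n x))\<^sup>2)"
  have db: "\<bar>d n x\<bar> \<le> \<psi> x * (2 * real N)\<^sup>2" for n x
  proof -
    have "\<bar>clamp_real (real N) (u x) - clamp_real (real N) (g n x)\<bar> \<le> 2 * real N"
      using cl(1)[of "real N" "u x"] cl(1)[of "real N" "g n x"] by linarith
    then have "(clamp_real (real N) (u x) - clamp_real (real N) (g n x))\<^sup>2 \<le> (2 * real N)\<^sup>2"
      using abs_le_square_iff by fastforce
    then show ?thesis
      using \<psi>(3)[of x] by (simp add: d_def abs_mult mult_left_mono)
  qed
  have "(\<lambda>n. LINT x|lborel. d n x) \<longlonglongrightarrow> (LINT x::'a|lborel. 0)"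
  proof (rule integral_dominated_convergence[where w = "\<lambda>x. \<psi> x * (2 * real N)\<^sup>2"])
    show "AE x in lborel. (\<lambda>n. d n x) \<longlonglongrightarrow> 0"
      using aelim
    proof eventually_elim
      case (elim x)
      have "(\<lambda>n. d n x) \<longlonglongrightarrow> \<psi> x * (clamp_real (real N) (u x) - clamp_real (real N) (u x))\<^sup>2"
        unfolding d_def clamp_real_def by (intro tendsto_intros tendsto_max tendsto_min elim)
      then show ?case by simp
    qed
    show "AE x in lborel. norm (d n x) \<le> \<psi> x * (2 * real N)\<^sup>2" for n
      using db by simp
    show "d n \<in> borel_measurable lborel" for n
      unfolding d_def by measurable
  qed (use i\<psi> in auto)
  then have "eventually (\<lambda>n. (LINT x|lborel. d n x) < \<epsilon> / 4) sequentially"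
    using \<open>\<epsilon> > 0\<close> by (intro order_tendstoD) auto
  then obtain n where n: "(LINT x|lborel. d n x) < \<epsilon> / 4"
    unfolding eventually_sequentially by auto
  have id: "integrable lborel (d n)"
  proof (rule Bochner_Integration.integrable_bound)
    show "integrable lborel (\<lambda>x. \<psi> x * (2 * real N)\<^sup>2)" using i\<psi> by simp
    show "d n \<in> borel_measurable lborel" unfolding d_def by measurable
    show "AE x in lborel. norm (d n x) \<le> norm (\<psi> x * (2 * real N)\<^sup>2)"
      using db[of n] by (intro AE_I2) (metis abs_ge_self order_trans real_norm_def)
  qed
  have ic: "integrable lborel (\<lambda>x. \<psi> x * (u x - clamp_real (real N) (u x))\<^sup>2)"
  proof (rule Bochner_Integration.integrable_bound[OF iu])
    show "AE x in lborel. norm (\<psi> x * (u x - clamp_real (real N) (u x))\<^sup>2) \<le> norm (\<psi> x * (u x)\<^sup>2)"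
      using cl(2)[of "real N"] \<psi>(3) by (intro AE_I2) (simp add: abs_mult mult_left_mono abs_le_square_iff)
  qed measurable
  have "(LINT x|lborel. \<psi> x * (u x - clamp_real (real N) (g n x))\<^sup>2) \<le>
      (LINT x|lborel. 2 * (\<psi> x * (u x - clamp_real (real N) (u x))\<^sup>2) + 2 * d n x)"
  proof (rule integral_mono')
    fix x
    have 2: "(p + q)\<^sup>2 \<le> 2 * p\<^sup>2 + 2 * q\<^sup>2" for p q :: real
      using sum_squares_bound[of p q] by (simp add: power2_sum)
    show "\<psi> x * (u x - clamp_real (real N) (g n x))\<^sup>2 \<le>
        2 * (\<psi> x * (u x - clamp_real (real N) (u x))\<^sup>2) + 2 * d n x"
      using mult_left_mono[OF 2[of "u x - clamp_real (real N) (u x)"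
          "clamp_real (real N) (u x) - clamp_real (real N) (g n x)"] \<psi>(3)[of x]]
      by (simp add: d_def algebra_simps)
  qed (use ic id \<psi>(3) in \<open>auto simp: d_def\<close>)
  also have "\<dots> < \<epsilon>"
    using ic id N n by simp
  finally show ?thesis using that cont by blast
qed

context mollifier
begin

text \<open>Jensen's inequality as non-negativity of a variance: \<open>\<eta> n (x - y)\<close> is
  a probability density in \<open>y\<close>, and \<open>c\<close> is the mean of \<open>u\<close>
  under it.\<close>

lemma conv_eta_square_le:
  assumes u: "u \<in> borel_measurable borel" and u2: "integrable lborel (\<lambda>x. (u x)\<^sup>2)"
  shows "(conv u (\<eta> n) x)\<^sup>2 \<le> conv (\<lambda>x. (u x)\<^sup>2) (\<eta> n) x"
proof -
  define c where "c = conv u (\<eta> n) x"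
  note eta = smooth_continuous[OF smooth_eta[of n]] bounded_support_eta[of n]
  have i: "integrable lborel (\<lambda>y. u y * \<eta> n (x - y))" "integrable lborel (\<lambda>y. (u y)\<^sup>2 * \<eta> n (x - y))"
    using loc_int_of_square_integrable[OF u u2] loc_int_square[OF u u2] eta
    by (auto intro!: integrable_conv)
  have "0 \<le> (LINT y|lborel. (u y - c)\<^sup>2 * \<eta> n (x - y))"
    using eta_nonneg by (intro integral_nonneg_AE) auto
  also have "\<dots> = (LINT y|lborel. (u y)\<^sup>2 * \<eta> n (x - y) - 2 * c * (u y * \<eta> n (x - y)) + c\<^sup>2 * \<eta> n (x - y))"
    by (intro Bochner_Integration.integral_cong) (auto simp: power2_diff algebra_simps)
  also have "\<dots> = conv (\<lambda>x. (u x)\<^sup>2) (\<eta> n) x - 2 * c * c + c\<^sup>2"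
    using i integrable_eta_reflect integral_eta_reflect[of n x] by (simp add: conv_def c_def)
  finally show ?thesis by (simp add: c_def power2_eq_square)
qed

text \<open>Upper bound: Jensen's inequality. Lower bound: \<open>c\<^sup>2 \<ge> 2 c v - v\<^sup>2\<close> with \<open>v\<close> a continuous
  approximation of \<open>u\<close>. Both reduce the claim to weak convergence.\<close>

lemma tendsto_integral_conv_square:
  assumes u: "u \<in> borel_measurable borel" and u2: "integrable lborel (\<lambda>x. (u x)\<^sup>2)"
    and \<psi>: "continuous_on UNIV \<psi>" "bounded_support \<psi>" "\<And>x. \<psi> x \<ge> 0"
  shows "(\<lambda>n. LINT x|lborel. \<psi> x * (conv u (\<eta> n) x)\<^sup>2) \<longlonglongrightarrow> (LINT x|lborel. \<psi> x * (u x)\<^sup>2)"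
proof (rule order_tendstoI)
  note lu = loc_int_of_square_integrable[OF u u2] and lu2 = loc_int_square[OF u u2]
  have cc: "continuous_on UNIV (conv w (\<eta> n))" if "loc_int w" for w n
    using smooth_conv[OF that smooth_eta bounded_support_eta] by (rule smooth_continuous)
  have ic: "integrable lborel (\<lambda>x. \<psi> x * (conv u (\<eta> n) x)\<^sup>2)" for n
    using cc[OF lu] \<psi> by (intro integrable_bounded_support bounded_support_mult1 continuous_intros)
  have iu: "integrable lborel (\<lambda>x. \<psi> x * (u x)\<^sup>2)"
    using integrable_loc_int_mult[OF lu2 \<psi>(1,2)] by (simp add: mult.commute)
  fix c
  {
    assume c: "(LINT x|lborel. \<psi> x * (u x)\<^sup>2) < c"
    have "(\<lambda>n. LINT x|lborel. \<psi> x * conv (\<lambda>x. (u x)\<^sup>2) (\<eta> n) x) \<longlonglongrightarrow> (LINT x|lborel. \<psi> x * (u x)\<^sup>2)"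
      using tendsto_integral_conv[OF lu2 \<psi>(1,2)] by (simp add: mult.commute)
    then have "eventually (\<lambda>n. (LINT x|lborel. \<psi> x * conv (\<lambda>x. (u x)\<^sup>2) (\<eta> n) x) < c) sequentially"
      using c by (rule order_tendstoD)
    then show "eventually (\<lambda>n. (LINT x|lborel. \<psi> x * (conv u (\<eta> n) x)\<^sup>2) < c) sequentially"
    proof eventually_elim
      case (elim n)
      have "(LINT x|lborel. \<psi> x * (conv u (\<eta> n) x)\<^sup>2) \<le> (LINT x|lborel. \<psi> x * conv (\<lambda>x. (u x)\<^sup>2) (\<eta> n) x)"
      proof (intro integral_mono ic mult_left_mono conv_eta_square_le u u2 \<psi>)
        show "integrable lborel (\<lambda>x. \<psi> x * conv (\<lambda>x. (u x)\<^sup>2) (\<eta> n) x)"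
          using cc[OF lu2] \<psi> by (intro integrable_bounded_support bounded_support_mult1 continuous_intros)
      qed
      then show ?case using elim by simp
    qed
  next
    assume c: "c < (LINT x|lborel. \<psi> x * (u x)\<^sup>2)"
    \<comment> \<open>Since \<open>2 u v - v^2 = u^2 - (u - v)^2\<close>, an error below the gap
      keeps the weighted integral of \<open>2 u v - v^2\<close> above \<open>c\<close>.\<close>
    then obtain v where v: "continuous_on UNIV v"
      "(LINT x|lborel. \<psi> x * (u x - v x)\<^sup>2) < (LINT x|lborel. \<psi> x * (u x)\<^sup>2) - c"
      using continuous_approximation_weighted_L2[OF u u2 \<psi>, of "(LINT x|lborel. \<psi> x * (u x)\<^sup>2) - c"]
      by auto
    have \<psi>v: "continuous_on UNIV (\<lambda>x. 2 * \<psi> x * v x)" "bounded_support (\<lambda>x. 2 * \<psi> x * v x)"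
      "integrable lborel (\<lambda>x. \<psi> x * (v x)\<^sup>2)"
    proof -
      show "continuous_on UNIV (\<lambda>x. 2 * \<psi> x * v x)"
        using \<psi> v by (intro continuous_intros)
      show "bounded_support (\<lambda>x. 2 * \<psi> x * v x)"
        by (intro bounded_support_mult1 bounded_support_mult2 \<psi>)
      show "integrable lborel (\<lambda>x. \<psi> x * (v x)\<^sup>2)"
        using \<psi> v by (intro integrable_bounded_support bounded_support_mult1 continuous_intros)
    qed
    have iuv: "integrable lborel (\<lambda>x. u x * (2 * \<psi> x * v x))"
      by (rule integrable_loc_int_mult[OF lu \<psi>v(1,2)])
    have "(\<lambda>n. (LINT x|lborel. 2 * \<psi> x * v x * conv u (\<eta> n) x) - (LINT x|lborel. \<psi> x * (v x)\<^sup>2)) \<longlonglongrightarrow>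
        (LINT x|lborel. u x * (2 * \<psi> x * v x)) - (LINT x|lborel. \<psi> x * (v x)\<^sup>2)"
      by (intro tendsto_diff tendsto_const tendsto_integral_conv[OF lu \<psi>v(1,2)])
    moreover have "c < (LINT x|lborel. u x * (2 * \<psi> x * v x)) - (LINT x|lborel. \<psi> x * (v x)\<^sup>2)"
    proof -
      have "(LINT x|lborel. \<psi> x * (u x - v x)\<^sup>2) =
          (LINT x|lborel. \<psi> x * (u x)\<^sup>2 - u x * (2 * \<psi> x * v x) + \<psi> x * (v x)\<^sup>2)"
        by (intro Bochner_Integration.integral_cong) (auto simp: power2_diff algebra_simps)
      also have "\<dots> = (LINT x|lborel. \<psi> x * (u x)\<^sup>2) - (LINT x|lborel. u x * (2 * \<psi> x * v x))
          + (LINT x|lborel. \<psi> x * (v x)\<^sup>2)"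
        using iu iuv \<psi>v(3) by simp
      finally show ?thesis using v(2) by linarith
    qed
    ultimately have "eventually (\<lambda>n. c < (LINT x|lborel. 2 * \<psi> x * v x * conv u (\<eta> n) x) -
        (LINT x|lborel. \<psi> x * (v x)\<^sup>2)) sequentially"
      by (rule order_tendstoD)
    then show "eventually (\<lambda>n. c < (LINT x|lborel. \<psi> x * (conv u (\<eta> n) x)\<^sup>2)) sequentially"
    proof eventually_elim
      case (elim n)
      have i: "integrable lborel (\<lambda>x. 2 * \<psi> x * v x * conv u (\<eta> n) x)"
        by (rule integrable_bounded_support[OF continuous_on_mult[OF \<psi>v(1) cc[OF lu]]
              bounded_support_mult1[OF \<psi>v(2)]])
      have "(LINT x|lborel. 2 * \<psi> x * v x * conv u (\<eta> n) x) - (LINT x|lborel. \<psi> x * (v x)\<^sup>2) =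
          (LINT x|lborel. 2 * \<psi> x * v x * conv u (\<eta> n) x - \<psi> x * (v x)\<^sup>2)"
        using i \<psi>v(3) by simp
      also have "\<dots> \<le> (LINT x|lborel. \<psi> x * (conv u (\<eta> n) x)\<^sup>2)"
      proof (intro integral_mono ic Bochner_Integration.integrable_diff i \<psi>v(3))
        fix x
        show "2 * \<psi> x * v x * conv u (\<eta> n) x - \<psi> x * (v x)\<^sup>2 \<le> \<psi> x * (conv u (\<eta> n) x)\<^sup>2"
          using mult_left_mono[OF sum_squares_bound[of "v x" "conv u (\<eta> n) x"] \<psi>(3)[of x]]
          by (simp add: algebra_simps)
      qed
      finally show ?case using elim by simp
    qed
  }
qed

end

lemma test_function_iff: "test_function \<phi> \<longleftrightarrow> smooth \<phi> \<and> bounded_support \<phi>"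
proof -
  have "compact (closure {x. \<phi> x \<noteq> 0}) \<longleftrightarrow> bounded_support \<phi>"
    unfolding compact_closure bounded_iff bounded_support_def by (metis (mono_tags) mem_Collect_eq not_le)
  then show ?thesis by (auto simp: test_function_def smooth_def)
qed

text \<open>The mollifications of \<open>p\<close> and \<open>q\<close> satisfy the equation
  classically, so \<open>carleman_cutoff\<close> holds for every \<open>n\<close>. Each integral
  pairs a square with a fixed non-negative continuous weight of bounded support and converges by
  \<open>tendsto_integral_conv_square\<close>; continuity is all that the weight containing
  \<open>\<bar>laplacian \<zeta> x\<bar>\<close> is sure to have.\<close>

lemma carleman_cutoff_distributional:
  fixes p q \<kappa> \<zeta> :: "'a::euclidean_space \<Rightarrow> real" and e :: 'a and l a K W :: real
  defines "w \<equiv> carleman_weight l e a"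
  assumes p: "p \<in> borel_measurable borel" "integrable lborel (\<lambda>x. (p x)\<^sup>2)"
    and q: "q \<in> borel_measurable borel" "integrable lborel (\<lambda>x. (q x)\<^sup>2)"
    and eq: "\<And>\<phi>. test_function \<phi> \<Longrightarrow> (LINT x|lborel. p x * laplacian \<phi> x) = (LINT x|lborel. q x * \<phi> x)"
    and c: "smooth \<kappa>" "bounded_support \<kappa>"
    and z: "smooth \<zeta>" "bounded_support \<zeta>" "\<And>x. \<zeta> x \<ge> 0"
    and e: "e \<in> Basis" and l: "l \<ge> 0" and K: "K \<ge> 0"
    and grad: "\<And>x. (\<Sum>b\<in>Basis. (partial_deriv b \<kappa> x)\<^sup>2) \<le> K * \<zeta> x"
    and W: "W \<ge> 0" "\<And>x. \<zeta> x \<noteq> 0 \<or> laplacian \<kappa> x \<noteq> 0 \<Longrightarrow> (w x)\<^sup>2 \<le> W"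
  shows "8 * l ^ 3 * (LINT x|lborel. ((x \<bullet> e + a) * w x * \<kappa> x)\<^sup>2 * (p x)\<^sup>2) \<le>
    2 * (LINT x|lborel. (w x * \<kappa> x)\<^sup>2 * (q x)\<^sup>2)
    + (LINT x|lborel. W * (4 * (laplacian \<kappa> x)\<^sup>2 + 8 * K * \<bar>laplacian \<zeta> x\<bar> + 8 * K * \<zeta> x) * (p x)\<^sup>2)
    + (LINT x|lborel. 8 * K * W * \<zeta> x * (q x)\<^sup>2)"
proof -
  obtain \<eta> :: "nat \<Rightarrow> 'a \<Rightarrow> real" where "mollifier \<eta>"
    using mollifier_sequence unfolding mollifier_def by metis
  then interpret mollifier \<eta> .
  have lp: "loc_int p" and lq: "loc_int q"
    using loc_int_of_square_integrable p q by blast+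
  have lap: "laplacian (conv p (\<eta> n)) = conv q (\<eta> n)" for n
    using laplacian_conv_distributional[OF lp lq smooth_eta bounded_support_eta] eq
    by (simp add: test_function_iff)
  have w: "smooth w" unfolding w_def by (rule smooth_carleman_weight)
  have bL: "bounded_support (laplacian \<kappa>)" "bounded_support (laplacian \<zeta>)"
    using bounded_support_laplacian c z by blast+
  have cL: "continuous_on UNIV (laplacian \<kappa>)" "continuous_on UNIV (laplacian \<zeta>)"
    using smooth_continuous smooth_laplacian c z by blast+
  show ?thesis
  proof (rule LIMSEQ_le)
    show "(\<lambda>n. 8 * l ^ 3 * (LINT x|lborel. ((x \<bullet> e + a) * w x * \<kappa> x)\<^sup>2 * (conv p (\<eta> n) x)\<^sup>2)) \<longlonglongrightarrow>
        8 * l ^ 3 * (LINT x|lborel. ((x \<bullet> e + a) * w x * \<kappa> x)\<^sup>2 * (p x)\<^sup>2)"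
      using c w by (intro tendsto_mult_left tendsto_integral_conv_square p smooth_continuous smooth_intros
          bounded_support_power bounded_support_mult2) auto
    show "(\<lambda>n. 2 * (LINT x|lborel. (w x * \<kappa> x)\<^sup>2 * (conv q (\<eta> n) x)\<^sup>2)
      + (LINT x|lborel. W * (4 * (laplacian \<kappa> x)\<^sup>2 + 8 * K * \<bar>laplacian \<zeta> x\<bar> + 8 * K * \<zeta> x) * (conv p (\<eta> n) x)\<^sup>2)
      + (LINT x|lborel. 8 * K * W * \<zeta> x * (conv q (\<eta> n) x)\<^sup>2)) \<longlonglongrightarrow>
      2 * (LINT x|lborel. (w x * \<kappa> x)\<^sup>2 * (q x)\<^sup>2)
      + (LINT x|lborel. W * (4 * (laplacian \<kappa> x)\<^sup>2 + 8 * K * \<bar>laplacian \<zeta> x\<bar> + 8 * K * \<zeta> x) * (p x)\<^sup>2)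
      + (LINT x|lborel. 8 * K * W * \<zeta> x * (q x)\<^sup>2)"
    proof (intro tendsto_add tendsto_mult_left tendsto_integral_conv_square p q)
      show "continuous_on UNIV (\<lambda>x. (w x * \<kappa> x)\<^sup>2)" "bounded_support (\<lambda>x. (w x * \<kappa> x)\<^sup>2)"
        using c w by (intro smooth_continuous smooth_intros bounded_support_power bounded_support_mult2; simp)+
      show "continuous_on UNIV (\<lambda>x. W * (4 * (laplacian \<kappa> x)\<^sup>2 + 8 * K * \<bar>laplacian \<zeta> x\<bar> + 8 * K * \<zeta> x))"
        using cL smooth_continuous[OF z(1)] by (intro continuous_intros)
      show "bounded_support (\<lambda>x. W * (4 * (laplacian \<kappa> x)\<^sup>2 + 8 * K * \<bar>laplacian \<zeta> x\<bar> + 8 * K * \<zeta> x))"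
        using bL z by (intro bounded_support_mult2 bounded_support_add bounded_support_power)
          (auto simp: bounded_support_def)
      show "continuous_on UNIV (\<lambda>x. 8 * K * W * \<zeta> x)"
        using z by (intro smooth_continuous smooth_intros)
      show "bounded_support (\<lambda>x. 8 * K * W * \<zeta> x)"
        using z(2) by (rule bounded_support_mult2)
    qed (use K W z in auto)
    show "\<exists>N. \<forall>n\<ge>N. 8 * l ^ 3 * (LINT x|lborel. ((x \<bullet> e + a) * w x * \<kappa> x)\<^sup>2 * (conv p (\<eta> n) x)\<^sup>2) \<le>
      2 * (LINT x|lborel. (w x * \<kappa> x)\<^sup>2 * (conv q (\<eta> n) x)\<^sup>2)
      + (LINT x|lborel. W * (4 * (laplacian \<kappa> x)\<^sup>2 + 8 * K * \<bar>laplacian \<zeta> x\<bar> + 8 * K * \<zeta> x) * (conv p (\<eta> n) x)\<^sup>2)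
      + (LINT x|lborel. 8 * K * W * \<zeta> x * (conv q (\<eta> n) x)\<^sup>2)"
      using carleman_cutoff[OF smooth_conv[OF lp smooth_eta bounded_support_eta] c z e l K grad W[unfolded w_def]]
      unfolding lap w_def by blast
  qed
qed

section \<open>Cutoff functions for the annulus\<close>

text \<open>Composing with \<open>x \<bullet> x - c\<close> instead of the norm keeps the inner
  function a polynomial: it is smooth at the origin too, and its derivatives are explicit.\<close>

lemma partial_deriv_radial:
  fixes h :: "real \<Rightarrow> real"
  assumes "smooth h"
  shows "smooth (\<lambda>x::'a::euclidean_space. h (x \<bullet> x - c))"
    and "b \<in> Basis \<Longrightarrow> partial_deriv b (\<lambda>x::'a. h (x \<bullet> x - c)) =
      (\<lambda>x. partial_deriv 1 h (x \<bullet> x - c) * (2 * (x \<bullet> b)))"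
    and "laplacian (\<lambda>x::'a. h (x \<bullet> x - c)) x =
      partial_deriv 1 (partial_deriv 1 h) (x \<bullet> x - c) * (4 * (x \<bullet> x)) +
      partial_deriv 1 h (x \<bullet> x - c) * (2 * real DIM('a))"
proof -
  \<comment> \<open>Written in coordinates, so that the closure rules yield its smoothness.\<close>
  define N where "N = (\<lambda>x::'a. (\<Sum>b\<in>Basis. (x \<bullet> b) * (x \<bullet> b)) - c)"
  have N: "N = (\<lambda>x. x \<bullet> x - c)"
    by (auto simp: N_def euclidean_inner[of x x for x])
  have sN: "smooth N" unfolding N_def by (intro smooth_intros)
  have dN: "partial_deriv b (\<lambda>x::'a. x \<bullet> x - c) x = 2 * (x \<bullet> b)" for b x
    by (rule partial_deriv_eqI[where D = "\<lambda>h. 2 * (x \<bullet> h)"])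
       (auto intro!: derivative_eq_intros simp: inner_commute)
  have sh: "smooth (partial_deriv 1 h)"
    using assms by (rule smooth_partial) simp
  show sm: "smooth (\<lambda>x::'a. h (x \<bullet> x - c))"
    using smooth_compose[OF assms sN] by (simp add: N)
  have d1: "partial_deriv b (\<lambda>x::'a. g (x \<bullet> x - c)) = (\<lambda>x. partial_deriv 1 g (x \<bullet> x - c) * (2 * (x \<bullet> b)))"
    if "smooth g" for g :: "real \<Rightarrow> real" and b
    using smooth_partial_compose[OF that sN, of b] by (simp add: N dN)
  then show "b \<in> Basis \<Longrightarrow> partial_deriv b (\<lambda>x::'a. h (x \<bullet> x - c)) =
      (\<lambda>x. partial_deriv 1 h (x \<bullet> x - c) * (2 * (x \<bullet> b)))"
    using assms by blast
  have d2: "partial_deriv b (partial_deriv b (\<lambda>x::'a. h (x \<bullet> x - c))) x =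
      partial_deriv 1 (partial_deriv 1 h) (x \<bullet> x - c) * (4 * ((x \<bullet> b) * (x \<bullet> b))) +
      partial_deriv 1 h (x \<bullet> x - c) * 2" if b: "b \<in> Basis" for b
  proof -
    have s1: "smooth (\<lambda>x::'a. partial_deriv 1 h (x \<bullet> x - c))"
      using smooth_compose[OF sh sN] by (simp add: N)
    have s2: "smooth (\<lambda>x::'a. 2 * (x \<bullet> b))" by (intro smooth_intros)
    show ?thesis
      unfolding d1[OF assms] smooth_partial_mult[OF s1 s2] d1[OF sh]
      using b by (simp add: smooth_partial_simps smooth_intros inner_same_Basis)
  qed
  have "laplacian (\<lambda>x::'a. h (x \<bullet> x - c)) x =
      (\<Sum>b\<in>Basis. partial_deriv 1 (partial_deriv 1 h) (x \<bullet> x - c) * (4 * ((x \<bullet> b) * (x \<bullet> b))) +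
      partial_deriv 1 h (x \<bullet> x - c) * 2)"
    unfolding laplacian_def using d2 by (intro sum.cong) auto
  also have "\<dots> = partial_deriv 1 (partial_deriv 1 h) (x \<bullet> x - c) * (4 * (x \<bullet> x)) +
      partial_deriv 1 h (x \<bullet> x - c) * (2 * real DIM('a))"
    by (simp add: sum.distrib euclidean_inner[of x x] flip: sum_distrib_left)
  finally show "laplacian (\<lambda>x::'a. h (x \<bullet> x - c)) x = \<dots>" .
qed

text \<open>A normalised antiderivative of a bump centred at 2. The derivative is exposed because
  the same bump later serves as the weight dominating the gradient of the cutoff.\<close>

lemma smooth_step_exists:
  obtains H :: "real \<Rightarrow> real" and c :: real
  where "smooth H" "c > 0" "\<And>s. s \<le> 1 \<Longrightarrow> H s = 1" "\<And>s. s \<ge> 3 \<Longrightarrow> H s = 0"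
    "partial_deriv 1 H = (\<lambda>s. - c * bump (s - 2))"
proof -
  define g where "g = (\<lambda>s. bump (s - 2))"
  have sg: "smooth g"
    using smooth_compose[OF smooth_bump, of "\<lambda>s::real. s \<bullet> 1 - 2"]
    by (simp add: g_def smooth_diff smooth_inner[of "1::real", simplified])
  have g: "g s = 0" if "s \<le> 1 \<or> s \<ge> 3" for s
    using that bump_eq_0[of "s - 2"] by (auto simp: g_def)
  define F where "F = (\<lambda>s. integral {0..s} g)"
  have F1: "F s = 0" if "s \<le> 1" for s
  proof -
    have "integral {0..s} g = integral {0..s} (\<lambda>_. 0)"
      using that g by (intro integral_cong) simp
    then show ?thesis by (simp add: F_def)
  qed
  \<comment> \<open>The interval \<open>{0..s}\<close> is empty for negative \<open>s\<close>, so
    below 1 the function is treated as constantly 0; from 1 on, \<open>s\<close> is interior to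
    \<open>{0..s + 1}\<close> and the fundamental theorem of calculus applies.\<close>
  have dF: "(F has_real_derivative g s) (at s)" for s
  proof (cases "s < 1")
    case True
    have "((\<lambda>s. 0) has_real_derivative g s) (at s)"
      using True g by simp
    then show ?thesis
      by (rule has_field_derivative_transform_within_open[where S = "{..<1}"]) (use True F1 in auto)
  next
    case False
    have "(F has_real_derivative g s) (at s within {0..s + 1})"
      unfolding F_def using False smooth_continuous[OF sg] by (intro integral_has_real_derivative) auto
    moreover have "s \<in> interior {0..s + 1}" using False by auto
    ultimately show ?thesis
      by (metis at_within_interior)
  qed
  obtain z where z: "1 < z" "z < 3" "F 3 - F 1 = 2 * g z"
    using MVT2[of 1 3 F g] dF by auto
  then have F3: "F 3 > 0"
    using F1[of 1] bump_pos[of "z - 2"] by (simp add: g_def abs_if)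
  have F3': "F s = F 3" if "s \<ge> 3" for s
  proof (cases "s = 3")
    case False
    then have "3 < s" using that by simp
    then obtain z where "3 < z" "F s - F 3 = (s - 3) * g z"
      using MVT2[of 3 s F g] dF by blast
    then show ?thesis using g[of z] by simp
  qed simp
  have dH: "((\<lambda>s. 1 - F s / F 3) has_real_derivative - (1 / F 3) * g s) (at s)" for s
    using F3 by (auto intro!: derivative_eq_intros dF)
  show ?thesis
  proof
    show "smooth (\<lambda>s. 1 - F s / F 3)"
      by (rule smooth_antiderivative[OF dH]) (intro smooth_intros sg)
    show "1 / F 3 > 0" using F3 by simp
    show "\<And>s. s \<le> 1 \<Longrightarrow> 1 - F s / F 3 = 1" by (simp add: F1)
    show "1 - F s / F 3 = 0" if "s \<ge> 3" for s
      using F3 unfolding F3'[OF that] by simp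
    show "partial_deriv 1 (\<lambda>s. 1 - F s / F 3) = (\<lambda>s. - (1 / F 3) * bump (s - 2))"
      using partial_deriv_real_eqI[OF dH] by (auto simp: g_def)
  qed
qed

lemma annulus_eq: "R > 0 \<Longrightarrow> annulus R s = {x. R < norm x \<and> norm x < s}"
  by (auto simp: annulus_def)

text \<open>Take \<open>\<kappa> = H (|x|^2 - R^2)\<close> and
  \<open>\<zeta> = g (|x|^2 - R^2)\<close> with \<open>H' = - c g\<close>. As
  \<open>0 \<le> g \<le> 1\<close> gives \<open>g^2 \<le> g\<close>, the squared gradient of
  \<open>\<kappa>\<close> is bounded by a multiple of \<open>\<zeta>\<close>. The transition takes
  place for \<open>|x|^2 - R^2\<close> between 1 and 3, a shell of thickness of order
  \<open>1 / R\<close>; this is where the factors \<open>R^2\<close> come from.\<close>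

lemma annulus_cutoffs:
  obtains B where "B > 0" "\<And>R. R \<ge> 2 \<Longrightarrow> \<exists>\<kappa> \<zeta> :: 'a::euclidean_space \<Rightarrow> real.
    smooth \<kappa> \<and> smooth \<zeta> \<and> (\<forall>x. norm x \<le> R \<longrightarrow> \<kappa> x = 1) \<and> (\<forall>x. norm x \<ge> R + 1 \<longrightarrow> \<kappa> x = 0) \<and>
    (\<forall>x. 0 \<le> \<zeta> x \<and> \<zeta> x \<le> 1) \<and>
    (\<forall>x. x \<notin> annulus R (R + 1) \<longrightarrow> \<zeta> x = 0 \<and> laplacian \<kappa> x = 0 \<and> laplacian \<zeta> x = 0) \<and>
    (\<forall>x. (\<Sum>b\<in>Basis. (partial_deriv b \<kappa> x)\<^sup>2) \<le> B * R\<^sup>2 * \<zeta> x) \<and>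
    (\<forall>x. \<bar>laplacian \<kappa> x\<bar> \<le> B * R\<^sup>2) \<and> (\<forall>x. \<bar>laplacian \<zeta> x\<bar> \<le> B * R\<^sup>2)"
proof -
  obtain H c where H: "smooth H" "\<And>s. s \<le> 1 \<Longrightarrow> H s = 1" "\<And>s. s \<ge> 3 \<Longrightarrow> H s = 0" and c: "c > 0"
    and dH: "partial_deriv 1 H = (\<lambda>s. - c * bump (s - 2))"
    using smooth_step_exists by metis
  define g where "g = (\<lambda>s. bump (s - 2))"
  have sg: "smooth g"
    using smooth_compose[OF smooth_bump, of "\<lambda>s::real. s \<bullet> 1 - 2"]
    by (simp add: g_def smooth_diff smooth_inner[of "1::real", simplified])
  let ?d = "partial_deriv (1::real)"
  have g0: "g s = 0" if "s \<le> 1 \<or> s \<ge> 3" for s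
    using that bump_eq_0[of "s - 2"] by (auto simp: g_def)
  have dH: "?d H = (\<lambda>s. - c * g s)" using dH by (simp add: g_def)
  have ddH: "?d (?d H) = (\<lambda>s. - c * ?d g s)"
    unfolding dH using sg by (simp add: smooth_partial_mult smooth_const partial_deriv_const_fun
        smooth_partial_uminus smooth_mult)
  have sdg: "smooth (?d g)" "smooth (?d (?d g))"
    using sg by (auto intro!: smooth_partial)
  have bg: "bounded_support g"
    unfolding bounded_support_def using g0 by (intro exI[of _ 3]) (auto simp: abs_if split: if_splits)
  obtain B1 where B1: "B1 > 0" "\<And>s. \<bar>?d g s\<bar> \<le> B1"
    using bounded_support_bounded smooth_continuous sdg bounded_support_partial bg by metis
  obtain B2 where B2: "B2 > 0" "\<And>s. \<bar>?d (?d g) s\<bar> \<le> B2"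
    using bounded_support_bounded smooth_continuous sdg bounded_support_partial bg by metis
  have dg0: "?d g s = 0" "?d (?d g) s = 0" if "s < 1 \<or> s > 3" for s
  proof -
    have op: "open ({..<1::real} \<union> {3<..})" by (intro open_Un) auto
    have 1: "?d g s = 0" if "s \<in> {..<1} \<union> {3<..}" for s
      using that g0 by (intro partial_deriv_eq_0_outside[OF op]) auto
    show "?d g s = 0" using that 1 by auto
    show "?d (?d g) s = 0" using that 1 by (intro partial_deriv_eq_0_outside[OF op]) auto
  qed
  have g1: "0 \<le> g s" "g s \<le> 1" for s
    unfolding g_def using bump_nonneg bump_le_1 by auto
  \<comment> \<open>The three summands serve the gradient of \<open>\<kappa>\<close>, the Laplacian
    of \<open>\<kappa>\<close> and the Laplacian of \<open>\<zeta>\<close>; each 16 is 4 times the 4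
    of \<open>|x|^2 \<le> 4 R^2\<close>.\<close>
  define B where "B = 16 * c\<^sup>2 + (16 * c * B1 + 2 * c * DIM('a)) + (16 * B2 + 2 * B1 * DIM('a))"
  have pos: "0 \<le> 16 * c\<^sup>2" "0 \<le> 16 * c * B1 + 2 * c * DIM('a)" "0 \<le> 16 * B2 + 2 * B1 * DIM('a)"
    using c B1 B2 by auto
  have "B > 0" unfolding B_def using c B1 B2 by (intro add_pos_nonneg) auto
  moreover have "\<exists>\<kappa> \<zeta> :: 'a \<Rightarrow> real.
    smooth \<kappa> \<and> smooth \<zeta> \<and> (\<forall>x. norm x \<le> R \<longrightarrow> \<kappa> x = 1) \<and> (\<forall>x. norm x \<ge> R + 1 \<longrightarrow> \<kappa> x = 0) \<and>
    (\<forall>x. 0 \<le> \<zeta> x \<and> \<zeta> x \<le> 1) \<and>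
    (\<forall>x. x \<notin> annulus R (R + 1) \<longrightarrow> \<zeta> x = 0 \<and> laplacian \<kappa> x = 0 \<and> laplacian \<zeta> x = 0) \<and>
    (\<forall>x. (\<Sum>b\<in>Basis. (partial_deriv b \<kappa> x)\<^sup>2) \<le> B * R\<^sup>2 * \<zeta> x) \<and>
    (\<forall>x. \<bar>laplacian \<kappa> x\<bar> \<le> B * R\<^sup>2) \<and> (\<forall>x. \<bar>laplacian \<zeta> x\<bar> \<le> B * R\<^sup>2)" if R: "R \<ge> 2" for R
  proof -
    define \<kappa> :: "'a \<Rightarrow> real" where "\<kappa> = (\<lambda>x. H (x \<bullet> x - R\<^sup>2))"
    define \<zeta> :: "'a \<Rightarrow> real" where "\<zeta> = (\<lambda>x. g (x \<bullet> x - R\<^sup>2))"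
    have xx: "x \<bullet> x = (norm x)\<^sup>2" for x :: 'a by (simp add: power2_norm_eq_inner)
    have R2: "R\<^sup>2 \<ge> 1" using R by (simp add: one_le_power)
    have inner: "x \<bullet> x - R\<^sup>2 \<le> 0" if "norm x \<le> R" for x :: 'a
      using power_mono[OF that, of 2] by (simp add: xx)
    \<comment> \<open>Here \<open>R \<ge> 2\<close> enters:
      \<open>(R + 1)^2 - R^2 = 2 R + 1 \<ge> 5\<close>, so the transition ends inside the
      annulus.\<close>
    have outer: "x \<bullet> x - R\<^sup>2 > 3" if "norm x \<ge> R + 1" for x :: 'a
    proof -
      have "(R + 1)\<^sup>2 \<le> (norm x)\<^sup>2" using that R by (intro power_mono) auto
      then show ?thesis using R by (simp add: xx power2_eq_square algebra_simps)
    qed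
    have mid: "x \<bullet> x \<le> 4 * R\<^sup>2" if "x \<bullet> x - R\<^sup>2 \<le> 3" for x :: 'a
      using that R2 by simp
    have lk: "laplacian \<kappa> x = - c * ?d g (x \<bullet> x - R\<^sup>2) * (4 * (x \<bullet> x)) - c * g (x \<bullet> x - R\<^sup>2) * (2 * DIM('a))" for x
      unfolding \<kappa>_def partial_deriv_radial(3)[OF H(1)] ddH unfolding dH by simp
    have lz: "laplacian \<zeta> x = ?d (?d g) (x \<bullet> x - R\<^sup>2) * (4 * (x \<bullet> x)) + ?d g (x \<bullet> x - R\<^sup>2) * (2 * DIM('a))" for x
      unfolding \<zeta>_def partial_deriv_radial(3)[OF sg] by simp
    have grad: "(\<Sum>b\<in>Basis. (partial_deriv b \<kappa> x)\<^sup>2) = 4 * c\<^sup>2 * (g (x \<bullet> x - R\<^sup>2))\<^sup>2 * (x \<bullet> x)" for x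
    proof -
      have "(\<Sum>b\<in>Basis. (partial_deriv b \<kappa> x)\<^sup>2) =
          (\<Sum>b\<in>Basis. 4 * c\<^sup>2 * (g (x \<bullet> x - R\<^sup>2))\<^sup>2 * ((x \<bullet> b) * (x \<bullet> b)))"
        unfolding \<kappa>_def by (intro sum.cong refl)
          (simp add: partial_deriv_radial(2)[OF H(1)] dH power2_eq_square)
      then show ?thesis by (simp add: euclidean_inner[of x x] flip: sum_distrib_left)
    qed
    show ?thesis
    proof (rule exI[of _ \<kappa>], rule exI[of _ \<zeta>], intro conjI allI impI)
      show "smooth \<kappa>" "smooth \<zeta>"
        unfolding \<kappa>_def \<zeta>_def by (intro partial_deriv_radial H sg)+
      fix x :: 'a
      show "norm x \<le> R \<Longrightarrow> \<kappa> x = 1"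
        using inner[of x] H(2) by (simp add: \<kappa>_def)
      show "norm x \<ge> R + 1 \<Longrightarrow> \<kappa> x = 0"
        using outer[of x] H(3) by (simp add: \<kappa>_def)
      show "0 \<le> \<zeta> x" "\<zeta> x \<le> 1" using g1 by (auto simp: \<zeta>_def)
      {
        assume "x \<notin> annulus R (R + 1)"
        then have "norm x \<le> R \<or> norm x \<ge> R + 1"
          using R by (auto simp: annulus_eq)
        then have "x \<bullet> x - R\<^sup>2 < 1 \<or> x \<bullet> x - R\<^sup>2 > 3"
          using inner[of x] outer[of x] by linarith
        then have g00: "g (x \<bullet> x - R\<^sup>2) = 0" "?d g (x \<bullet> x - R\<^sup>2) = 0" "?d (?d g) (x \<bullet> x - R\<^sup>2) = 0"
          using g0[of "x \<bullet> x - R\<^sup>2"] dg0[of "x \<bullet> x - R\<^sup>2"] by auto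
        then show "\<zeta> x = 0" by (simp add: \<zeta>_def)
        show "laplacian \<kappa> x = 0" "laplacian \<zeta> x = 0"
          unfolding lk lz g00 by simp_all
      }
      have BR: "C * R\<^sup>2 \<le> B * R\<^sup>2" if "C \<le> B" for C
        using that by (intro mult_right_mono) auto
      show "(\<Sum>b\<in>Basis. (partial_deriv b \<kappa> x)\<^sup>2) \<le> B * R\<^sup>2 * \<zeta> x"
      proof (cases "x \<bullet> x - R\<^sup>2 \<le> 3")
        case True
        have "(g (x \<bullet> x - R\<^sup>2))\<^sup>2 \<le> g (x \<bullet> x - R\<^sup>2)"
          using g1 by (simp add: power2_eq_square mult_left_le)
        then have "4 * c\<^sup>2 * (g (x \<bullet> x - R\<^sup>2))\<^sup>2 * (x \<bullet> x) \<le> 4 * c\<^sup>2 * g (x \<bullet> x - R\<^sup>2) * (4 * R\<^sup>2)"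
          using mid[OF True] g1 by (intro mult_mono) auto
        also have "\<dots> = 16 * c\<^sup>2 * R\<^sup>2 * \<zeta> x" by (simp add: \<zeta>_def)
        also have "\<dots> \<le> B * R\<^sup>2 * \<zeta> x"
          using g1 pos by (intro mult_right_mono BR) (auto simp: B_def \<zeta>_def)
        finally show ?thesis by (simp add: grad)
      next
        case False
        then show ?thesis using g0[of "x \<bullet> x - R\<^sup>2"] by (simp add: grad \<zeta>_def)
      qed
      have bound: "\<bar>a * (4 * (x \<bullet> x)) + b * (2 * DIM('a))\<bar> \<le> B * R\<^sup>2"
        if "x \<bullet> x - R\<^sup>2 \<le> 3" "\<bar>a\<bar> \<le> \<alpha>" "\<bar>b\<bar> \<le> \<beta>" "16 * \<alpha> + 2 * \<beta> * DIM('a) \<le> B" for a b \<alpha> \<beta> :: real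
      proof -
        have "\<bar>a * (4 * (x \<bullet> x)) + b * (2 * DIM('a))\<bar> \<le> \<bar>a\<bar> * (4 * (x \<bullet> x)) + \<bar>b\<bar> * (2 * DIM('a))"
          by (rule order_trans[OF abs_triangle_ineq]) (simp add: abs_mult)
        also have "\<dots> \<le> \<alpha> * (4 * (4 * R\<^sup>2)) + \<beta> * (2 * DIM('a)) * R\<^sup>2"
        proof (rule add_mono)
          show "\<bar>a\<bar> * (4 * (x \<bullet> x)) \<le> \<alpha> * (4 * (4 * R\<^sup>2))"
            using that mid by (intro mult_mono) auto
          have "\<bar>b\<bar> * (2 * DIM('a)) * 1 \<le> \<beta> * (2 * DIM('a)) * R\<^sup>2"
            using that R2 by (intro mult_mono) auto
          then show "\<bar>b\<bar> * real (2 * DIM('a)) \<le> \<beta> * (2 * DIM('a)) * R\<^sup>2" by simp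
        qed
        also have "\<dots> = (16 * \<alpha> + 2 * \<beta> * DIM('a)) * R\<^sup>2" by (simp add: algebra_simps)
        also have "\<dots> \<le> B * R\<^sup>2" by (rule BR[OF that(4)])
        finally show ?thesis .
      qed
      show "\<bar>laplacian \<kappa> x\<bar> \<le> B * R\<^sup>2"
      proof (cases "x \<bullet> x - R\<^sup>2 \<le> 3")
        case True
        have 1: "\<bar>- c * ?d g (x \<bullet> x - R\<^sup>2)\<bar> \<le> c * B1"
          using B1 c by (simp add: abs_mult)
        have 2: "\<bar>- c * g (x \<bullet> x - R\<^sup>2)\<bar> \<le> c"
          using c g1[of "x \<bullet> x - R\<^sup>2"] by (simp add: abs_mult mult_left_le)
        have 3: "16 * (c * B1) + 2 * c * DIM('a) \<le> B"
          using pos unfolding B_def by linarith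
        have "laplacian \<kappa> x = - c * ?d g (x \<bullet> x - R\<^sup>2) * (4 * (x \<bullet> x)) + - c * g (x \<bullet> x - R\<^sup>2) * (2 * DIM('a))"
          unfolding lk by simp
        then show ?thesis
          using bound[OF True 1 2 3] by (simp only:)
      next
        case False
        then show ?thesis using g0[of "x \<bullet> x - R\<^sup>2"] dg0[of "x \<bullet> x - R\<^sup>2"] \<open>B > 0\<close> by (simp add: lk)
      qed
      show "\<bar>laplacian \<zeta> x\<bar> \<le> B * R\<^sup>2"
      proof (cases "x \<bullet> x - R\<^sup>2 \<le> 3")
        case True
        have "16 * B2 + 2 * B1 * DIM('a) \<le> B"
          using pos unfolding B_def by linarith
        from bound[OF True B2(2) B1(2) this] show ?thesis
          unfolding lz .
      next
        case False
        then show ?thesis using dg0[of "x \<bullet> x - R\<^sup>2"] \<open>B > 0\<close> by (simp add: lz)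
      qed
    qed
  qed
  ultimately show ?thesis using that by blast
qed

section \<open>The lower bound\<close>

text \<open>The weight is \<open>g = (w \<kappa>)^2\<close>, at least 1 on the inner ball because
  \<open>\<kappa> = 1\<close> and \<open>w \<ge> 1\<close> there. It is chosen before
  \<open>p\<close> and \<open>q\<close>, so that the inequalities for the real and imaginary parts
  of a solution can be added. The parameter \<open>l\<close> stays free.\<close>

lemma carleman_annulus:
  obtains C where "C > 0" "\<And>R l. R \<ge> 2 \<Longrightarrow> l \<ge> 0 \<Longrightarrow> \<exists>g :: 'a::euclidean_space \<Rightarrow> real.
    continuous_on UNIV g \<and> bounded_support g \<and> (\<forall>x. 0 \<le> g x) \<and> (\<forall>x. norm x \<le> R \<longrightarrow> 1 \<le> g x) \<and>
    (\<forall>p q. p \<in> borel_measurable borel \<and> integrable lborel (\<lambda>x. (p x)\<^sup>2) \<and>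
      q \<in> borel_measurable borel \<and> integrable lborel (\<lambda>x. (q x)\<^sup>2) \<and>
      (\<forall>\<phi>. test_function \<phi> \<longrightarrow> (LINT x|lborel. p x * laplacian \<phi> x) = (LINT x|lborel. q x * \<phi> x)) \<longrightarrow>
      8 * l ^ 3 * (R + 1)\<^sup>2 * (LINT x|lborel. g x * (p x)\<^sup>2) \<le> 2 * (LINT x|lborel. g x * (q x)\<^sup>2)
        + C * R ^ 4 * exp (9 * l * (R + 1)\<^sup>2) *
          (LINT x|lborel. indicator (annulus R (R + 1)) x * ((p x)\<^sup>2 + (q x)\<^sup>2)))"
proof -
  obtain B where B: "B > 0" and cut: "\<And>R. R \<ge> 2 \<Longrightarrow> \<exists>\<kappa> \<zeta> :: 'a::euclidean_space \<Rightarrow> real.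
    smooth \<kappa> \<and> smooth \<zeta> \<and> (\<forall>x. norm x \<le> R \<longrightarrow> \<kappa> x = 1) \<and> (\<forall>x. norm x \<ge> R + 1 \<longrightarrow> \<kappa> x = 0) \<and>
    (\<forall>x. 0 \<le> \<zeta> x \<and> \<zeta> x \<le> 1) \<and>
    (\<forall>x. x \<notin> annulus R (R + 1) \<longrightarrow> \<zeta> x = 0 \<and> laplacian \<kappa> x = 0 \<and> laplacian \<zeta> x = 0) \<and>
    (\<forall>x. (\<Sum>b\<in>Basis. (partial_deriv b \<kappa> x)\<^sup>2) \<le> B * R\<^sup>2 * \<zeta> x) \<and>
    (\<forall>x. \<bar>laplacian \<kappa> x\<bar> \<le> B * R\<^sup>2) \<and> (\<forall>x. \<bar>laplacian \<zeta> x\<bar> \<le> B * R\<^sup>2)"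
    using annulus_cutoffs[where 'a = 'a] by blast
  \<comment> \<open>\<open>4 B^2 + 8 B^2\<close> from the squared Laplacian of
    \<open>\<kappa>\<close> and from \<open>K\<close> times the Laplacian of \<open>\<zeta>\<close>,
    where \<open>K = B R^2\<close>; \<open>8 B\<close> from \<open>K \<zeta>\<close>, using
    \<open>R^2 \<le> R^4\<close>.\<close>
  define C where "C = 12 * B\<^sup>2 + 8 * B"
  have "C > 0" using B by (simp add: C_def add_nonneg_pos)
  obtain e :: 'a where e: "e \<in> Basis" using nonempty_Basis by blast
  have "\<exists>g :: 'a \<Rightarrow> real.
    continuous_on UNIV g \<and> bounded_support g \<and> (\<forall>x. 0 \<le> g x) \<and> (\<forall>x. norm x \<le> R \<longrightarrow> 1 \<le> g x) \<and>
    (\<forall>p q. p \<in> borel_measurable borel \<and> integrable lborel (\<lambda>x. (p x)\<^sup>2) \<and>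
      q \<in> borel_measurable borel \<and> integrable lborel (\<lambda>x. (q x)\<^sup>2) \<and>
      (\<forall>\<phi>. test_function \<phi> \<longrightarrow> (LINT x|lborel. p x * laplacian \<phi> x) = (LINT x|lborel. q x * \<phi> x)) \<longrightarrow>
      8 * l ^ 3 * (R + 1)\<^sup>2 * (LINT x|lborel. g x * (p x)\<^sup>2) \<le> 2 * (LINT x|lborel. g x * (q x)\<^sup>2)
        + C * R ^ 4 * exp (9 * l * (R + 1)\<^sup>2) *
          (LINT x|lborel. indicator (annulus R (R + 1)) x * ((p x)\<^sup>2 + (q x)\<^sup>2)))"
    if R: "R \<ge> 2" and l: "l \<ge> 0" for R l
  proof -
    obtain \<kappa> \<zeta> :: "'a \<Rightarrow> real" where k: "smooth \<kappa>" "\<And>x. norm x \<le> R \<Longrightarrow> \<kappa> x = 1" "\<And>x. norm x \<ge> R + 1 \<Longrightarrow> \<kappa> x = 0"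
      and z: "smooth \<zeta>" "\<And>x. 0 \<le> \<zeta> x" "\<And>x. \<zeta> x \<le> 1"
      and out: "\<And>x. x \<notin> annulus R (R + 1) \<Longrightarrow> \<zeta> x = 0" "\<And>x. x \<notin> annulus R (R + 1) \<Longrightarrow> laplacian \<kappa> x = 0"
        "\<And>x. x \<notin> annulus R (R + 1) \<Longrightarrow> laplacian \<zeta> x = 0"
      and grad: "\<And>x. (\<Sum>b\<in>Basis. (partial_deriv b \<kappa> x)\<^sup>2) \<le> B * R\<^sup>2 * \<zeta> x"
      and lk: "\<And>x. \<bar>laplacian \<kappa> x\<bar> \<le> B * R\<^sup>2" and lz: "\<And>x. \<bar>laplacian \<zeta> x\<bar> \<le> B * R\<^sup>2"
      using cut[OF R] by blast
    define A :: "'a set" where "A = annulus R (R + 1)"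
    have A: "A = {x::'a. R < norm x \<and> norm x < R + 1}"
      unfolding A_def using R by (intro annulus_eq) simp
    have mA [measurable]: "A \<in> sets borel"
      unfolding A_def annulus_def by (intro sets.Diff borel_open borel_closed) auto
    define a where "a = 2 * (R + 1)"
    define w where "w = carleman_weight l e a"
    have w: "smooth w" unfolding w_def by (rule smooth_carleman_weight)
    have w2: "(w x)\<^sup>2 = exp (l * (x \<bullet> e + a)\<^sup>2)" for x
    proof -
      have "(w x)\<^sup>2 = exp (2 * (l / 2 * (x \<bullet> e + a)\<^sup>2))"
        unfolding exp_double by (simp add: w_def carleman_weight_def)
      then show ?thesis by simp
    qed
    have t: "R + 1 \<le> x \<bullet> e + a" "x \<bullet> e + a \<le> 3 * (R + 1)" if "norm x \<le> R + 1" for x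
      using that Basis_le_norm[OF e, of x] by (auto simp: a_def)
    define W where "W = exp (9 * l * (R + 1)\<^sup>2)"
    have wW: "(w x)\<^sup>2 \<le> W" if "x \<in> A" for x
    proof -
      have "(x \<bullet> e + a)\<^sup>2 \<le> (3 * (R + 1))\<^sup>2"
        using t[of x] that R by (intro power_mono) (auto simp: A)
      then have "l * (x \<bullet> e + a)\<^sup>2 \<le> l * (9 * (R + 1)\<^sup>2)"
        unfolding power_mult_distrib using l by (intro mult_left_mono) auto
      then show ?thesis by (simp add: w2 W_def)
    qed
    have bk: "bounded_support \<kappa>" unfolding bounded_support_def using k(3) by (intro exI[of _ "R + 1"]) auto
    have bz: "bounded_support \<zeta>" unfolding bounded_support_def
      using out(1) by (intro exI[of _ "R + 1"]) (auto simp: A[unfolded A_def])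
    define g where "g = (\<lambda>x. (w x * \<kappa> x)\<^sup>2)"
    have g: "continuous_on UNIV g" "bounded_support g" "\<And>x. 0 \<le> g x"
      unfolding g_def using w k bk
      by (auto intro!: smooth_continuous smooth_intros bounded_support_power bounded_support_mult2)
    have g1: "1 \<le> g x" if "norm x \<le> R" for x
      using k(2)[OF that] l by (simp add: g_def power_mult_distrib w2)
    have R24: "R\<^sup>2 \<le> R ^ 4" "R\<^sup>2 \<ge> 0" "R ^ 4 \<ge> 0" "R ^ 4 = R\<^sup>2 * R\<^sup>2"
      using R power_increasing[of 2 4 R] by (simp_all flip: power_add)
    have c1: "W * (4 * (laplacian \<kappa> x)\<^sup>2 + 8 * (B * R\<^sup>2) * \<bar>laplacian \<zeta> x\<bar> + 8 * (B * R\<^sup>2) * \<zeta> x) \<le>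
        C * R ^ 4 * W * indicator A x" for x
    proof (cases "x \<in> A")
      case True
      have "(laplacian \<kappa> x)\<^sup>2 \<le> (B * R\<^sup>2)\<^sup>2"
        using power_mono[OF lk[of x], of 2] by simp
      moreover have "8 * (B * R\<^sup>2) * \<bar>laplacian \<zeta> x\<bar> \<le> 8 * (B * R\<^sup>2) * (B * R\<^sup>2)"
        using lz[of x] B by (intro mult_left_mono) auto
      moreover have "8 * (B * R\<^sup>2) * \<zeta> x \<le> 8 * (B * R ^ 4) * 1"
        using z(2,3)[of x] B R24(1-3) by (intro mult_mono) auto
      ultimately have "4 * (laplacian \<kappa> x)\<^sup>2 + 8 * (B * R\<^sup>2) * \<bar>laplacian \<zeta> x\<bar> + 8 * (B * R\<^sup>2) * \<zeta> x \<le>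
          4 * (B * R\<^sup>2)\<^sup>2 + 8 * (B * R\<^sup>2) * (B * R\<^sup>2) + 8 * (B * R ^ 4)"
        by linarith
      also have "\<dots> = C * R ^ 4"
        by (simp add: C_def R24(4) power2_eq_square algebra_simps)
      finally show ?thesis
        using True by (simp add: W_def mult.commute)
    next
      case False
      then show ?thesis using out[of x] by (simp add: A_def)
    qed
    have c2: "8 * (B * R\<^sup>2) * W * \<zeta> x \<le> C * R ^ 4 * W * indicator A x" for x
    proof (cases "x \<in> A")
      case True
      have "8 * (B * R\<^sup>2) * \<zeta> x \<le> 8 * (B * R ^ 4) * 1"
        using z(2,3)[of x] B R24(1-3) by (intro mult_mono) auto
      also have "\<dots> \<le> C * R ^ 4" using R24(3) by (simp add: C_def algebra_simps)
      finally show ?thesis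
        using True by (simp add: W_def mult.commute mult.left_commute)
    next
      case False
      then show ?thesis using out[of x] by (simp add: A_def)
    qed
    show ?thesis
    proof (rule exI[of _ g], intro conjI allI impI g g1)
      fix p q :: "'a \<Rightarrow> real"
      assume pq: "p \<in> borel_measurable borel \<and> integrable lborel (\<lambda>x. (p x)\<^sup>2) \<and>
        q \<in> borel_measurable borel \<and> integrable lborel (\<lambda>x. (q x)\<^sup>2) \<and>
        (\<forall>\<phi>. test_function \<phi> \<longrightarrow> (LINT x|lborel. p x * laplacian \<phi> x) = (LINT x|lborel. q x * \<phi> x))"
      then have p: "p \<in> borel_measurable borel" "integrable lborel (\<lambda>x. (p x)\<^sup>2)"
        and q: "q \<in> borel_measurable borel" "integrable lborel (\<lambda>x. (q x)\<^sup>2)" by auto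
      have main: "8 * l ^ 3 * (LINT x|lborel. ((x \<bullet> e + a) * w x * \<kappa> x)\<^sup>2 * (p x)\<^sup>2) \<le>
          2 * (LINT x|lborel. (w x * \<kappa> x)\<^sup>2 * (q x)\<^sup>2)
          + (LINT x|lborel. W * (4 * (laplacian \<kappa> x)\<^sup>2 + 8 * (B * R\<^sup>2) * \<bar>laplacian \<zeta> x\<bar> + 8 * (B * R\<^sup>2) * \<zeta> x) * (p x)\<^sup>2)
          + (LINT x|lborel. 8 * (B * R\<^sup>2) * W * \<zeta> x * (q x)\<^sup>2)"
        unfolding w_def
      proof (rule carleman_cutoff_distributional[OF p q _ k(1) bk z(1) bz z(2) e l _ grad])
        show "\<And>x. \<zeta> x \<noteq> 0 \<or> laplacian \<kappa> x \<noteq> 0 \<Longrightarrow> (carleman_weight l e a x)\<^sup>2 \<le> W"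
          using wW out unfolding A_def w_def by blast
      qed (use pq B in \<open>auto simp: W_def\<close>)
      have ip: "integrable lborel (\<lambda>x. h x * (p x)\<^sup>2)" and iq: "integrable lborel (\<lambda>x. h x * (q x)\<^sup>2)"
        if "continuous_on UNIV h" "bounded_support h" for h
        using integrable_loc_int_mult[OF loc_int_square[OF p] that]
          integrable_loc_int_mult[OF loc_int_square[OF q] that] by (simp_all add: mult.commute)
      have iA: "integrable lborel (\<lambda>x. indicator A x * (p x)\<^sup>2)" "integrable lborel (\<lambda>x. indicator A x * (q x)\<^sup>2)"
        using integrable_mult_indicator[of A lborel "\<lambda>x. (p x)\<^sup>2"]
          integrable_mult_indicator[of A lborel "\<lambda>x. (q x)\<^sup>2"] p q mA by simp_all
      have "(R + 1)\<^sup>2 * (LINT x|lborel. g x * (p x)\<^sup>2) = (LINT x|lborel. (R + 1)\<^sup>2 * (g x * (p x)\<^sup>2))"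
        by simp
      also have "\<dots> \<le> (LINT x|lborel. ((x \<bullet> e + a) * w x * \<kappa> x)\<^sup>2 * (p x)\<^sup>2)"
      proof (intro integral_mono integrable_mult_right ip g)
        show "continuous_on UNIV (\<lambda>x. ((x \<bullet> e + a) * w x * \<kappa> x)\<^sup>2)"
          using k w by (intro smooth_continuous smooth_intros)
        show "bounded_support (\<lambda>x. ((x \<bullet> e + a) * w x * \<kappa> x)\<^sup>2)"
          by (intro bounded_support_power bounded_support_mult2 bk) simp
        fix x
        have "(R + 1)\<^sup>2 * g x \<le> ((x \<bullet> e + a) * w x * \<kappa> x)\<^sup>2"
        proof (cases "norm x \<le> R + 1")
          case True
          have "(R + 1)\<^sup>2 \<le> (x \<bullet> e + a)\<^sup>2"
            using t[OF True] R by (intro power_mono) auto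
          from mult_right_mono[OF this g(3)[of x]] show ?thesis
            by (simp add: g_def power_mult_distrib mult.assoc)
        next
          case False
          then show ?thesis using k(3)[of x] by (simp add: g_def)
        qed
        from mult_right_mono[OF this, of "(p x)\<^sup>2"]
        show "(R + 1)\<^sup>2 * (g x * (p x)\<^sup>2) \<le> ((x \<bullet> e + a) * w x * \<kappa> x)\<^sup>2 * (p x)\<^sup>2"
          by (simp add: mult.assoc)
      qed
      finally have lhs: "8 * l ^ 3 * ((R + 1)\<^sup>2 * (LINT x|lborel. g x * (p x)\<^sup>2)) \<le>
          8 * l ^ 3 * (LINT x|lborel. ((x \<bullet> e + a) * w x * \<kappa> x)\<^sup>2 * (p x)\<^sup>2)"
        using l by (intro mult_left_mono) auto
      have r1: "(LINT x|lborel. W * (4 * (laplacian \<kappa> x)\<^sup>2 + 8 * (B * R\<^sup>2) * \<bar>laplacian \<zeta> x\<bar> + 8 * (B * R\<^sup>2) * \<zeta> x) * (p x)\<^sup>2)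
          \<le> (LINT x|lborel. C * R ^ 4 * W * (indicator A x * (p x)\<^sup>2))"
      proof (rule integral_mono')
        fix x
        show "W * (4 * (laplacian \<kappa> x)\<^sup>2 + 8 * (B * R\<^sup>2) * \<bar>laplacian \<zeta> x\<bar> + 8 * (B * R\<^sup>2) * \<zeta> x) * (p x)\<^sup>2 \<le>
            C * R ^ 4 * W * (indicator A x * (p x)\<^sup>2)"
          using mult_right_mono[OF c1[of x], of "(p x)\<^sup>2"] by (simp add: mult.assoc)
        show "0 \<le> C * R ^ 4 * W * (indicator A x * (p x)\<^sup>2)"
          using \<open>C > 0\<close> R24(3) by (simp add: W_def)
      qed (intro integrable_mult_right iA)
      have r2: "(LINT x|lborel. 8 * (B * R\<^sup>2) * W * \<zeta> x * (q x)\<^sup>2)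
          \<le> (LINT x|lborel. C * R ^ 4 * W * (indicator A x * (q x)\<^sup>2))"
      proof (rule integral_mono')
        fix x
        show "8 * (B * R\<^sup>2) * W * \<zeta> x * (q x)\<^sup>2 \<le> C * R ^ 4 * W * (indicator A x * (q x)\<^sup>2)"
          using mult_right_mono[OF c2[of x], of "(q x)\<^sup>2"] by (simp add: mult.assoc)
        show "0 \<le> C * R ^ 4 * W * (indicator A x * (q x)\<^sup>2)"
          using \<open>C > 0\<close> R24(3) by (simp add: W_def)
      qed (intro integrable_mult_right iA)
      have "(LINT x|lborel. C * R ^ 4 * W * (indicator A x * (p x)\<^sup>2)) +
          (LINT x|lborel. C * R ^ 4 * W * (indicator A x * (q x)\<^sup>2)) =
          C * R ^ 4 * W * (LINT x|lborel. indicator A x * ((p x)\<^sup>2 + (q x)\<^sup>2))"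
        using iA by (simp add: distrib_left)
      then show "8 * l ^ 3 * (R + 1)\<^sup>2 * (LINT x|lborel. g x * (p x)\<^sup>2) \<le> 2 * (LINT x|lborel. g x * (q x)\<^sup>2)
        + C * R ^ 4 * exp (9 * l * (R + 1)\<^sup>2) *
          (LINT x|lborel. indicator (annulus R (R + 1)) x * ((p x)\<^sup>2 + (q x)\<^sup>2))"
        using main lhs r1 r2 unfolding g_def W_def[symmetric] A_def[symmetric] mult.assoc[of "8 * l ^ 3"]
        by linarith
    qed
  qed
  then show ?thesis using that \<open>C > 0\<close> by blast
qed

text \<open>With \<open>y = k R^(4/3)\<close> the expression is \<open>y^2 exp (- y) / k^2\<close>.
  The exponent \<open>8/3 = 4 - 4/3\<close> is the gap between the loss \<open>R^4\<close> from the
  cutoffs and the factor \<open>R^(-4/3)\<close> of the claim.\<close>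

lemma eventually_powr_exp_small:
  fixes k \<epsilon> :: real
  assumes "k > 0" "\<epsilon> > 0"
  shows "eventually (\<lambda>R. R powr (8 / 3) * exp (- k * R powr (4 / 3)) \<le> \<epsilon>) at_top"
proof -
  have "filterlim (\<lambda>R::real. R powr (4 / 3)) at_top at_top"
  proof (rule filterlim_at_top_mono[OF filterlim_ident])
    show "eventually (\<lambda>R::real. R \<le> R powr (4 / 3)) at_top"
      using eventually_ge_at_top[of 1]
      by eventually_elim (use powr_mono[of 1 "4 / 3"] in fastforce)
  qed
  then have "filterlim (\<lambda>R::real. k * R powr (4 / 3)) at_top at_top"
    using assms by (intro filterlim_tendsto_pos_mult_at_top[OF tendsto_const]) auto
  from filterlim_compose[OF tendsto_power_div_exp_0[of 2] this]
  have "eventually (\<lambda>R. (k * R powr (4 / 3))\<^sup>2 / exp (k * R powr (4 / 3)) < k\<^sup>2 * \<epsilon>) at_top"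
    using assms by (intro order_tendstoD) auto
  then show ?thesis
  proof eventually_elim
    case (elim R)
    have sq: "(R powr (4 / 3))\<^sup>2 = R powr (8 / 3)"
      by (simp add: power2_eq_square flip: powr_add)
    have "(k * R powr (4 / 3))\<^sup>2 / exp (k * R powr (4 / 3)) =
        k\<^sup>2 * (R powr (8 / 3) * exp (- k * R powr (4 / 3)))"
      unfolding power_mult_distrib sq mult_minus_left exp_minus
      by (simp only: divide_inverse mult.assoc)
    then have "k\<^sup>2 * (R powr (8 / 3) * exp (- k * R powr (4 / 3))) < k\<^sup>2 * \<epsilon>"
      using elim by linarith
    then have "R powr (8 / 3) * exp (- k * R powr (4 / 3)) < \<epsilon>"
      using assms by (subst (asm) mult_less_cancel_left_pos) auto
    then show ?case by (rule less_imp_le)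
  qed
qed

section \<open>From the complex equation to pairs of real Borel functions\<close>

lemma Linf_norm_AE:
  assumes "in_Linf (V :: 'a::euclidean_space \<Rightarrow> complex)"
  shows "AE x in lebesgue. norm (V x) \<le> Linf_norm V" and "Linf_norm V \<ge> 0"
proof -
  define E where "E = esssup lebesgue (\<lambda>x. ereal (norm (V x)))"
  have E: "E < \<infinity>" using assms by (simp add: in_Linf_def E_def)
  have ae: "AE x in lebesgue. ereal (norm (V x)) \<le> E"
    unfolding E_def by (rule esssup_AE)
  \<comment> \<open>This excludes the value minus infinity, which \<open>real_of_ereal\<close> would
    send to 0. A negative almost everywhere bound on a norm would make the whole space a null
    set.\<close>
  have "E \<ge> 0"
  proof (rule ccontr)
    assume "\<not> E \<ge> 0"
    have "AE x in (lebesgue :: 'a measure). False"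
      using ae
    proof (rule eventually_mono)
      fix x assume "ereal (norm (V x)) \<le> E"
      moreover have "0 \<le> ereal (norm (V x))" by simp
      ultimately show False using \<open>\<not> E \<ge> 0\<close> order_trans by blast
    qed
    then show False
      using open_not_negligible[of "UNIV :: 'a set"]
      unfolding eventually_ae_filter_negligible by (auto simp: top.extremum_unique)
  qed
  then have "E = ereal (Linf_norm V)"
    using E by (cases E) (auto simp: Linf_norm_def E_def[symmetric])
  then show "AE x in lebesgue. norm (V x) \<le> Linf_norm V" "Linf_norm V \<ge> 0"
    using ae \<open>E \<ge> 0\<close> by auto
qed

text \<open>\<open>p\<close> and \<open>q\<close> provide Borel versions, indexed by the functions \<open>Re\<close> and \<open>Im\<close>, of the real and
  imaginary parts of the merely Lebesgue measurable \<open>u\<close> and \<open>f\<close>.\<close>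

lemma distributional_real_part:
  fixes u f :: "'a::euclidean_space \<Rightarrow> complex" and T :: "complex \<Rightarrow> real"
  assumes T: "T = Re \<or> T = Im"
    and eq: "(LINT x|lebesgue. - (u x * of_real (L x)) + f x * of_real (\<phi> x)) = 0"
    and u: "u \<in> borel_measurable lebesgue" and f: "f \<in> borel_measurable lebesgue"
    and L: "continuous_on UNIV L" "bounded_support L" and \<phi>: "continuous_on UNIV \<phi>" "bounded_support \<phi>"
    and p: "\<And>T. T = Re \<or> T = Im \<Longrightarrow> loc_int (p T)" "\<And>T. T = Re \<or> T = Im \<Longrightarrow> AE x in lborel. T (u x) = p T x"
    and q: "\<And>T. T = Re \<or> T = Im \<Longrightarrow> loc_int (q T)" "\<And>T. T = Re \<or> T = Im \<Longrightarrow> AE x in lborel. T (f x) = q T x"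
  shows "(LINT x|lborel. p T x * L x) = (LINT x|lborel. q T x * \<phi> x)"
proof -
  \<comment> \<open>An integral can be 0 merely because the integrand is not integrable. Local
    integrability of \<open>p\<close>, \<open>q\<close> and bounded support of \<open>L\<close>,
    \<open>\<phi>\<close> make \<open>G Re\<close> and \<open>G Im\<close> integrable, so that the
    complex equation really splits into two real ones.\<close>
  define G where "G = (\<lambda>T x. - (p T x * L x) + q T x * \<phi> x)"
  have i: "integrable lborel (\<lambda>x. p T x * L x)" "integrable lborel (\<lambda>x. q T x * \<phi> x)" if "T = Re \<or> T = Im" for T
    using integrable_loc_int_mult p(1)[OF that] q(1)[OF that] L \<phi> by blast+
  then have iG: "integrable lborel (G T)" if "T = Re \<or> T = Im" for T
    using that unfolding G_def by simp
  have mG [measurable]: "G Re \<in> borel_measurable borel" "G Im \<in> borel_measurable borel"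
    using iG[of Re] iG[of Im] by auto
  have [measurable]: "(\<lambda>x. complex_of_real (L x)) \<in> borel_measurable lebesgue"
    "(\<lambda>x. complex_of_real (\<phi> x)) \<in> borel_measurable lebesgue"
    using borel_measurable_continuous_onI[OF L(1)] borel_measurable_continuous_onI[OF \<phi>(1)]
    by (auto intro!: borel_measurable_of_real measurable_completion)
  have ae: "AE x in lebesgue. - (u x * of_real (L x)) + f x * of_real (\<phi> x) =
      complex_of_real (G Re x) + \<i> * complex_of_real (G Im x)"
  proof (rule AE_completion)
    show "AE x in lborel. - (u x * of_real (L x)) + f x * of_real (\<phi> x) =
      complex_of_real (G Re x) + \<i> * complex_of_real (G Im x)"
      using p(2)[of Re, simplified] p(2)[of Im, simplified] q(2)[of Re, simplified] q(2)[of Im, simplified]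
    proof eventually_elim
      case (elim x)
      then show ?case by (intro complex_eqI) (auto simp: G_def)
    qed
  qed
  have "0 = (LINT x|lebesgue. complex_of_real (G Re x) + \<i> * complex_of_real (G Im x))"
    unfolding eq[symmetric] using u f ae
    by (intro integral_cong_AE) (measurable, auto intro!: measurable_completion)
  also have "\<dots> = (LINT x|lborel. complex_of_real (G Re x) + \<i> * complex_of_real (G Im x))"
    by (intro integral_completion) measurable
  also have "\<dots> = complex_of_real (integral\<^sup>L lborel (G Re)) + \<i> * complex_of_real (integral\<^sup>L lborel (G Im))"
    using iG by simp
  finally have "integral\<^sup>L lborel (G Re) = 0 \<and> integral\<^sup>L lborel (G Im) = 0"
    by (simp add: complex_eq_iff)
  then have "integral\<^sup>L lborel (G T) = 0" using T by auto
  then show ?thesis using i[OF T] by (simp add: G_def)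
qed

text \<open>\<open>carleman_annulus\<close> is applied to both parts of \<open>u\<close> and of
  \<open>V u\<close>. Only the sums of squares \<open>U\<close> and \<open>Q\<close> satisfy
  \<open>Q \<le> v^2 U\<close>, so the potential is absorbed after adding. Stating the relation
  between \<open>l\<close> and \<open>V\<close> as a hypothesis postpones the cube root.\<close>

lemma annulus_integral_lower_bound:
  obtains C where "C > 0" "\<And>(V :: 'a::euclidean_space \<Rightarrow> complex) u R l.
    in_Linf V \<Longrightarrow> schroedinger_solution V u \<Longrightarrow> in_L2 u \<Longrightarrow> R \<ge> 2 \<Longrightarrow> l \<ge> 0 \<Longrightarrow>
    8 * l ^ 3 * (R + 1)\<^sup>2 = 4 * (Linf_norm V)\<^sup>2 \<Longrightarrow>
    2 * (Linf_norm V)\<^sup>2 * (LINT x|lebesgue. indicator (cball 0 R) x * (norm (u x))\<^sup>2) \<le>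
      C * R ^ 4 * exp (9 * l * (R + 1)\<^sup>2) * (1 + (Linf_norm V)\<^sup>2) *
      (LINT x:annulus R (R + 1)|lebesgue. (norm (u x))\<^sup>2)"
proof -
  obtain C where C: "C > 0" and carl: "\<And>R l. R \<ge> 2 \<Longrightarrow> l \<ge> 0 \<Longrightarrow> \<exists>g :: 'a::euclidean_space \<Rightarrow> real.
    continuous_on UNIV g \<and> bounded_support g \<and> (\<forall>x. 0 \<le> g x) \<and> (\<forall>x. norm x \<le> R \<longrightarrow> 1 \<le> g x) \<and>
    (\<forall>p q. p \<in> borel_measurable borel \<and> integrable lborel (\<lambda>x. (p x)\<^sup>2) \<and>
      q \<in> borel_measurable borel \<and> integrable lborel (\<lambda>x. (q x)\<^sup>2) \<and>
      (\<forall>\<phi>. test_function \<phi> \<longrightarrow> (LINT x|lborel. p x * laplacian \<phi> x) = (LINT x|lborel. q x * \<phi> x)) \<longrightarrow>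
      8 * l ^ 3 * (R + 1)\<^sup>2 * (LINT x|lborel. g x * (p x)\<^sup>2) \<le> 2 * (LINT x|lborel. g x * (q x)\<^sup>2)
        + C * R ^ 4 * exp (9 * l * (R + 1)\<^sup>2) *
          (LINT x|lborel. indicator (annulus R (R + 1)) x * ((p x)\<^sup>2 + (q x)\<^sup>2)))"
    by (rule carleman_annulus[where 'a = 'a]) blast
  have "2 * (Linf_norm V)\<^sup>2 * (LINT x|lebesgue. indicator (cball 0 R) x * (norm (u x))\<^sup>2) \<le>
      C * R ^ 4 * exp (9 * l * (R + 1)\<^sup>2) * (1 + (Linf_norm V)\<^sup>2) *
      (LINT x:annulus R (R + 1)|lebesgue. (norm (u x))\<^sup>2)"
    if V: "in_Linf V" and sol: "schroedinger_solution V u" and u: "in_L2 u" and R: "R \<ge> 2" and l: "l \<ge> 0"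
      and lV: "8 * l ^ 3 * (R + 1)\<^sup>2 = 4 * (Linf_norm V)\<^sup>2" for V u :: "'a \<Rightarrow> complex" and R l
  proof -
    define v where "v = Linf_norm V"
    define f where "f = (\<lambda>x. V x * u x)"
    have Vv: "AE x in lebesgue. norm (V x) \<le> v" and v: "v \<ge> 0"
      unfolding v_def by (rule Linf_norm_AE[OF V])+
    have mu: "u \<in> borel_measurable lebesgue" and iu: "integrable lebesgue (\<lambda>x. (norm (u x))\<^sup>2)"
      using u by (auto simp: in_L2_def)
    have mV: "V \<in> borel_measurable lebesgue" using V by (simp add: in_Linf_def)
    have mf: "f \<in> borel_measurable lebesgue" unfolding f_def using mu mV by measurable
    have borel_version: "\<exists>p. \<forall>T. T = Re \<or> T = Im \<longrightarrow> p T \<in> borel_measurable borel \<and> (AE x in lborel. T (h x) = p T x)"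
      if h: "h \<in> borel_measurable lebesgue" for h :: "'a \<Rightarrow> complex"
    proof -
      have "\<exists>g\<in>borel_measurable lborel. AE x in lborel. T (h x) = g x" if "T = Re \<or> T = Im" for T
        using that h by (intro completion_ex_borel_measurable_real) auto
      then show ?thesis
        unfolding measurable_lborel2 by metis
    qed
    obtain p where "\<forall>T. T = Re \<or> T = Im \<longrightarrow> p T \<in> borel_measurable borel \<and> (AE x in lborel. T (u x) = p T x)"
      using borel_version[OF mu] by (elim exE)
    then have p: "\<And>T. T = Re \<or> T = Im \<Longrightarrow> p T \<in> borel_measurable borel"
      and pu: "\<And>T. T = Re \<or> T = Im \<Longrightarrow> AE x in lborel. T (u x) = p T x"
      by blast+
    obtain q where "\<forall>T. T = Re \<or> T = Im \<longrightarrow> q T \<in> borel_measurable borel \<and> (AE x in lborel. T (f x) = q T x)"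
      using borel_version[OF mf] by (elim exE)
    then have q: "\<And>T. T = Re \<or> T = Im \<Longrightarrow> q T \<in> borel_measurable borel"
      and qf: "\<And>T. T = Re \<or> T = Im \<Longrightarrow> AE x in lborel. T (f x) = q T x"
      by blast+
    have [measurable]: "p Re \<in> borel_measurable borel" "p Im \<in> borel_measurable borel"
      "q Re \<in> borel_measurable borel" "q Im \<in> borel_measurable borel"
      using p q by auto
    define U Q where "U = (\<lambda>x. (p Re x)\<^sup>2 + (p Im x)\<^sup>2)" and "Q = (\<lambda>x. (q Re x)\<^sup>2 + (q Im x)\<^sup>2)"
    have mU [measurable]: "U \<in> borel_measurable borel" "Q \<in> borel_measurable borel"
      unfolding U_def Q_def by measurable
    have U0: "U x \<ge> 0" "Q x \<ge> 0" for x by (auto simp: U_def Q_def)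
    have uU: "AE x in lborel. (norm (u x))\<^sup>2 = U x"
      using pu[of Re, simplified] pu[of Im, simplified]
      by eventually_elim (auto simp: U_def cmod_power2)
    have fQ: "AE x in lborel. (norm (f x))\<^sup>2 = Q x"
      using qf[of Re, simplified] qf[of Im, simplified]
      by eventually_elim (auto simp: Q_def cmod_power2)
    have iU: "integrable lborel U"
    proof -
      have "integrable lebesgue U"
      proof (rule integrable_cong_AE_imp[OF iu])
        show "U \<in> borel_measurable lebesgue"
          using mU(1) by (intro measurable_completion) simp
        show "AE x in lebesgue. (norm (u x))\<^sup>2 = U x"
          using uU by (rule AE_completion)
      qed
      then show ?thesis by (simp add: integrable_completion)
    qed
    have QU: "AE x in lborel. Q x \<le> v\<^sup>2 * U x"
      using uU fQ Vv[unfolded AE_completion_iff]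
    proof eventually_elim
      case (elim x)
      have "(norm (f x))\<^sup>2 = (norm (V x))\<^sup>2 * (norm (u x))\<^sup>2"
        by (simp add: f_def norm_mult power_mult_distrib)
      also have "\<dots> \<le> v\<^sup>2 * (norm (u x))\<^sup>2"
        using elim(3) by (intro mult_right_mono power_mono) auto
      finally show ?case using elim by simp
    qed
    have iQ: "integrable lborel Q"
    proof (rule Bochner_Integration.integrable_bound)
      show "integrable lborel (\<lambda>x. v\<^sup>2 * U x)" using iU by simp
      show "AE x in lborel. norm (Q x) \<le> norm (v\<^sup>2 * U x)"
        using QU by eventually_elim (use U0 in \<open>auto simp: abs_mult\<close>)
    qed simp
    have p2: "integrable lborel (\<lambda>x. (p T x)\<^sup>2)" if "T = Re \<or> T = Im" for T
      using iU by (rule Bochner_Integration.integrable_bound) (use that p[OF that] in \<open>auto simp: U_def\<close>)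
    have q2: "integrable lborel (\<lambda>x. (q T x)\<^sup>2)" if "T = Re \<or> T = Im" for T
      using iQ by (rule Bochner_Integration.integrable_bound) (use that q[OF that] in \<open>auto simp: Q_def\<close>)
    have lp: "loc_int (p T)" and lq: "loc_int (q T)" if "T = Re \<or> T = Im" for T
      using loc_int_of_square_integrable p q p2 q2 that by blast+
    have weak: "(LINT x|lborel. p T x * laplacian \<phi> x) = (LINT x|lborel. q T x * \<phi> x)"
      if T: "T = Re \<or> T = Im" and "test_function \<phi>" for T \<phi>
    proof -
      have \<phi>: "smooth \<phi>" "bounded_support \<phi>"
        using \<open>test_function \<phi>\<close> by (auto simp: test_function_iff)
      have eq: "(LINT x|lebesgue. - (u x * of_real (laplacian \<phi> x)) + f x * of_real (\<phi> x)) = 0"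
        using sol \<open>test_function \<phi>\<close> by (simp add: schroedinger_solution_def f_def)
      show ?thesis
        using \<phi> by (intro distributional_real_part[OF T eq mu mf _ _ _ _ lp pu lq qf])
          (auto intro: smooth_continuous bounded_support_laplacian)
    qed
    define A :: "'a set" where "A = annulus R (R + 1)"
    have mA [measurable]: "A \<in> sets borel"
      unfolding A_def annulus_def by (intro sets.Diff borel_open borel_closed) auto
    define W where "W = C * R ^ 4 * exp (9 * l * (R + 1)\<^sup>2)"
    have W: "W \<ge> 0" using C R by (simp add: W_def)
    obtain g :: "'a \<Rightarrow> real" where g: "continuous_on UNIV g" "bounded_support g" "\<And>x. 0 \<le> g x"
      "\<And>x. norm x \<le> R \<Longrightarrow> 1 \<le> g x" and gi: "\<And>p q. p \<in> borel_measurable borel \<Longrightarrow> integrable lborel (\<lambda>x. (p x)\<^sup>2) \<Longrightarrow>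
      q \<in> borel_measurable borel \<Longrightarrow> integrable lborel (\<lambda>x. (q x)\<^sup>2) \<Longrightarrow>
      (\<And>\<phi>. test_function \<phi> \<Longrightarrow> (LINT x|lborel. p x * laplacian \<phi> x) = (LINT x|lborel. q x * \<phi> x)) \<Longrightarrow>
      4 * v\<^sup>2 * (LINT x|lborel. g x * (p x)\<^sup>2) \<le> 2 * (LINT x|lborel. g x * (q x)\<^sup>2)
        + W * (LINT x|lborel. indicator A x * ((p x)\<^sup>2 + (q x)\<^sup>2))"
      using carl[OF R l] unfolding lV v_def[symmetric] W_def[symmetric] A_def[symmetric] by blast
    have ig: "integrable lborel (\<lambda>x. g x * h x)" if "h \<in> borel_measurable borel" "integrable lborel h" for h
    proof -
      have "loc_int h"
        unfolding loc_int_def using that integrable_mult_indicator[of "cball 0 _" lborel h] by simp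
      from integrable_loc_int_mult[OF this g(1,2)] show ?thesis
        by (simp add: mult.commute)
    qed
    have iA: "integrable lborel (\<lambda>x. indicator A x * h x)" if "integrable lborel h" for h :: "'a \<Rightarrow> real"
      using integrable_mult_indicator[of A lborel h] that by simp
    have pq2: "(\<lambda>x. (p Re x)\<^sup>2) \<in> borel_measurable borel" "(\<lambda>x. (p Im x)\<^sup>2) \<in> borel_measurable borel"
      "(\<lambda>x. (q Re x)\<^sup>2) \<in> borel_measurable borel" "(\<lambda>x. (q Im x)\<^sup>2) \<in> borel_measurable borel"
      by measurable
    have sU: "(LINT x|lborel. g x * U x) = (LINT x|lborel. g x * (p Re x)\<^sup>2) + (LINT x|lborel. g x * (p Im x)\<^sup>2)"
      unfolding U_def distrib_left by (intro Bochner_Integration.integral_add ig pq2 p2) auto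
    have sQ: "(LINT x|lborel. g x * Q x) = (LINT x|lborel. g x * (q Re x)\<^sup>2) + (LINT x|lborel. g x * (q Im x)\<^sup>2)"
      unfolding Q_def distrib_left by (intro Bochner_Integration.integral_add ig pq2 q2) auto
    have sA: "(LINT x|lborel. indicator A x * (U x + Q x)) =
        (LINT x|lborel. indicator A x * ((p Re x)\<^sup>2 + (q Re x)\<^sup>2)) + (LINT x|lborel. indicator A x * ((p Im x)\<^sup>2 + (q Im x)\<^sup>2))"
    proof -
      have "(LINT x|lborel. indicator A x * (U x + Q x)) =
          (LINT x|lborel. indicator A x * ((p Re x)\<^sup>2 + (q Re x)\<^sup>2) + indicator A x * ((p Im x)\<^sup>2 + (q Im x)\<^sup>2))"
        by (intro Bochner_Integration.integral_cong) (auto simp: U_def Q_def algebra_simps)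
      also have "\<dots> = (LINT x|lborel. indicator A x * ((p Re x)\<^sup>2 + (q Re x)\<^sup>2)) + (LINT x|lborel. indicator A x * ((p Im x)\<^sup>2 + (q Im x)\<^sup>2))"
        by (intro Bochner_Integration.integral_add iA Bochner_Integration.integrable_add p2 q2) auto
      finally show ?thesis .
    qed
    have gT: "4 * v\<^sup>2 * (LINT x|lborel. g x * (p T x)\<^sup>2) \<le> 2 * (LINT x|lborel. g x * (q T x)\<^sup>2)
        + W * (LINT x|lborel. indicator A x * ((p T x)\<^sup>2 + (q T x)\<^sup>2))" if "T = Re \<or> T = Im" for T
      by (intro gi p q p2 q2 weak that)
    have "4 * v\<^sup>2 * (LINT x|lborel. g x * U x) \<le> 2 * (LINT x|lborel. g x * Q x)
        + W * (LINT x|lborel. indicator A x * (U x + Q x))"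
      using gT[of Re] gT[of Im]
      unfolding sU sQ sA distrib_left[of W] distrib_left[of "4 * v\<^sup>2"] distrib_left[of 2] by simp
    also have "(LINT x|lborel. g x * Q x) \<le> (LINT x|lborel. v\<^sup>2 * (g x * U x))"
    proof (intro integral_mono_AE integrable_mult_right ig mU iU iQ)
      show "AE x in lborel. g x * Q x \<le> v\<^sup>2 * (g x * U x)"
        using QU by eventually_elim (use g(3) mult_left_mono in \<open>fastforce simp: mult.left_commute\<close>)
    qed
    also have "(LINT x|lborel. indicator A x * (U x + Q x)) \<le> (LINT x|lborel. (1 + v\<^sup>2) * (indicator A x * U x))"
    proof (intro integral_mono_AE integrable_mult_right iA iU iQ Bochner_Integration.integrable_add)
      show "AE x in lborel. indicator A x * (U x + Q x) \<le> (1 + v\<^sup>2) * (indicator A x * U x)"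
        using QU by eventually_elim (auto simp: indicator_def algebra_simps)
    qed
    \<comment> \<open>The term with \<open>Q\<close> is at most \<open>2 v^2\<close> times the
      integral of \<open>g U\<close>, half of the left-hand side.\<close>
    finally have "2 * v\<^sup>2 * (LINT x|lborel. g x * U x) \<le> W * ((1 + v\<^sup>2) * (LINT x|lborel. indicator A x * U x))"
      using W by (simp add: mult_left_mono)
    moreover have "(LINT x|lborel. indicator (cball 0 R) x * U x) \<le> (LINT x|lborel. g x * U x)"
    proof (rule integral_mono')
      fix x
      show "indicator (cball 0 R) x * U x \<le> g x * U x"
        using g(3,4)[of x] U0 by (intro mult_right_mono) (auto simp: indicator_def)
      show "0 \<le> g x * U x" using g U0 by simp
    qed (intro ig mU iU)
    then have "2 * v\<^sup>2 * (LINT x|lborel. indicator (cball 0 R) x * U x) \<le> 2 * v\<^sup>2 * (LINT x|lborel. g x * U x)"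
      by (intro mult_left_mono) auto
    ultimately have fin: "2 * v\<^sup>2 * (LINT x|lborel. indicator (cball 0 R) x * U x) \<le>
        W * ((1 + v\<^sup>2) * (LINT x|lborel. indicator A x * U x))"
      by linarith
    have conv: "(LINT x|lebesgue. indicator S x * (norm (u x))\<^sup>2) = (LINT x|lborel. indicator S x * U x)"
      if [measurable]: "S \<in> sets borel" for S
    proof -
      have m: "(\<lambda>x. indicator S x * U x) \<in> borel_measurable borel" by measurable
      have "(LINT x|lebesgue. indicator S x * (norm (u x))\<^sup>2) = (LINT x|lebesgue. indicator S x * U x)"
      proof (rule integral_cong_AE)
        show "(\<lambda>x. indicator S x * (norm (u x))\<^sup>2) \<in> borel_measurable lebesgue"
          using mu that by (intro borel_measurable_times borel_measurable_power borel_measurable_norm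
              borel_measurable_indicator) auto
        show "(\<lambda>x. indicator S x * U x) \<in> borel_measurable lebesgue"
          using m by (intro measurable_completion) simp
        show "AE x in lebesgue. indicator S x * (norm (u x))\<^sup>2 = indicator S x * U x"
          using AE_completion[OF uU] by eventually_elim simp
      qed
      also have "\<dots> = (LINT x|lborel. indicator S x * U x)"
        using m by (intro integral_completion) simp
      finally show ?thesis .
    qed
    show ?thesis
      using fin conv[of "cball 0 R"] conv[OF mA]
      by (simp add: set_lebesgue_integral_def v_def W_def A_def mult.assoc)
  qed
  then show ?thesis using that C by blast
qed

theorem theorem5:
  fixes C_V :: real
  shows "\<exists>M>0. \<forall>V :: 'a::euclidean_space \<Rightarrow> complex.
    in_Linf V \<and> Linf_norm V \<le> C_V \<and> \<not> (AE x in lebesgue. V x = 0) \<longrightarrow>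
    (\<forall>u. schroedinger_solution V u \<and> in_L2 u \<and> L2_norm u = 1 \<longrightarrow>
      (\<exists>R0>0. \<forall>R\<ge>R0.
        (LINT x:annulus R (R + 1)|lebesgue. (norm (u x))\<^sup>2)
          \<ge> inverse M * R powr (- 4 / 3) *
             exp (- M * Linf_norm V powr (2 / 3) * R powr (4 / 3))))"
proof -
  obtain C where C: "C > 0" and bound: "\<And>(V :: 'a \<Rightarrow> complex) u R l.
    in_Linf V \<Longrightarrow> schroedinger_solution V u \<Longrightarrow> in_L2 u \<Longrightarrow> R \<ge> 2 \<Longrightarrow> l \<ge> 0 \<Longrightarrow>
    8 * l ^ 3 * (R + 1)\<^sup>2 = 4 * (Linf_norm V)\<^sup>2 \<Longrightarrow>
    2 * (Linf_norm V)\<^sup>2 * (LINT x|lebesgue. indicator (cball 0 R) x * (norm (u x))\<^sup>2) \<le>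
      C * R ^ 4 * exp (9 * l * (R + 1)\<^sup>2) * (1 + (Linf_norm V)\<^sup>2) *
      (LINT x:annulus R (R + 1)|lebesgue. (norm (u x))\<^sup>2)"
    using annulus_integral_lower_bound by blast
  \<comment> \<open>\<open>37 = 9 * 4 + 1\<close>: the 9 bounds the exponent of the squared weight,
    the 4 covers \<open>(R + 1)^(4/3) \<le> 4 R^(4/3)\<close>, and the 1 pays for powers of
    \<open>R\<close> and constants.\<close>
  have "\<exists>R0>0. \<forall>R\<ge>R0. (LINT x:annulus R (R + 1)|lebesgue. (norm (u x))\<^sup>2)
      \<ge> inverse 37 * R powr (- 4 / 3) * exp (- 37 * Linf_norm V powr (2 / 3) * R powr (4 / 3))"
    if V: "in_Linf V" "\<not> (AE x in lebesgue. V x = 0)"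
      and u: "schroedinger_solution V u" "in_L2 u" "L2_norm u = 1" for V u :: "'a \<Rightarrow> complex"
  proof -
    define v where "v = Linf_norm V"
    \<comment> \<open>Here \<open>V\<close> not vanishing almost everywhere enters; otherwise
      \<open>k = 0\<close> and no exponential decay would be left to absorb constants.\<close>
    have "v \<noteq> 0"
    proof
      assume "v = 0"
      then have "AE x in lebesgue. V x = 0"
        using Linf_norm_AE(1)[OF V(1)] by (simp add: v_def)
      then show False using V(2) by simp
    qed
    then have v: "v > 0" using Linf_norm_AE(2)[OF V(1)] by (simp add: v_def)
    define k where "k = v powr (2 / 3)"
    have k: "k > 0" using v by (simp add: k_def)
    have mu: "u \<in> borel_measurable lebesgue" and iu: "integrable lebesgue (\<lambda>x. (norm (u x))\<^sup>2)"
      using u(2) by (auto simp: in_L2_def)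
    \<comment> \<open>Half of the mass of \<open>u\<close> eventually lies in the ball; this is how
      the threshold \<open>R0\<close> depends on \<open>u\<close>.\<close>
    have "((\<lambda>R::real. LINT x|lebesgue. indicator (cball 0 R) x * (norm (u x))\<^sup>2) \<longlongrightarrow>
        (LINT x|lebesgue. (norm (u x))\<^sup>2)) at_top"
    proof (rule integral_dominated_convergence_at_top[where w = "\<lambda>x. (norm (u x))\<^sup>2"])
      show "(\<lambda>x. (norm (u x))\<^sup>2) \<in> borel_measurable lebesgue" using iu by simp
      show "(\<lambda>x. indicator (cball 0 R) x * (norm (u x))\<^sup>2) \<in> borel_measurable lebesgue" for R
        using iu by (intro borel_measurable_times borel_measurable_indicator) auto
      show "AE x in lebesgue. ((\<lambda>R. indicator (cball 0 R) x * (norm (u x))\<^sup>2) \<longlongrightarrow> (norm (u x))\<^sup>2) at_top"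
      proof (rule AE_I2)
        fix x
        have "eventually (\<lambda>R. indicator (cball 0 R) x * (norm (u x))\<^sup>2 = (norm (u x))\<^sup>2) at_top"
          using eventually_ge_at_top[of "norm x"] by eventually_elim simp
        then show "((\<lambda>R. indicator (cball 0 R) x * (norm (u x))\<^sup>2) \<longlongrightarrow> (norm (u x))\<^sup>2) at_top"
          by (rule tendsto_eventually)
      qed
      show "eventually (\<lambda>R. AE x in lebesgue. norm (indicator (cball 0 R) x * (norm (u x))\<^sup>2) \<le> (norm (u x))\<^sup>2) at_top"
        by (auto intro!: always_eventually AE_I2 simp: indicator_def)
    qed (rule iu)
    moreover have "(LINT x|lebesgue. (norm (u x))\<^sup>2) = 1"
      using u(3) by (simp add: L2_norm_def)
    ultimately have mass: "eventually (\<lambda>R. (LINT x|lebesgue. indicator (cball 0 R) x * (norm (u x))\<^sup>2) > 1 / 2) at_top"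
      by (intro order_tendstoD) auto
    \<comment> \<open>This quotient is what remains of
      \<open>v^2 \<le> C (1 + v^2) R^4 exp (36 s) I\<close> after dividing by the constants.\<close>
    have "v\<^sup>2 / (C * (1 + v\<^sup>2)) > 0" using v C by (intro divide_pos_pos mult_pos_pos) (auto simp: add_pos_nonneg)
    from eventually_conj[OF mass eventually_conj[OF eventually_powr_exp_small[OF k this] eventually_ge_at_top[of 2]]]
    obtain R0 where R0: "\<And>R. R \<ge> R0 \<Longrightarrow> (LINT x|lebesgue. indicator (cball 0 R) x * (norm (u x))\<^sup>2) > 1 / 2 \<and>
        R powr (8 / 3) * exp (- k * R powr (4 / 3)) \<le> v\<^sup>2 / (C * (1 + v\<^sup>2)) \<and> R \<ge> 2"
      unfolding eventually_at_top_linorder by blast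
    have "(LINT x:annulus R (R + 1)|lebesgue. (norm (u x))\<^sup>2)
      \<ge> inverse 37 * R powr (- 4 / 3) * exp (- 37 * v powr (2 / 3) * R powr (4 / 3))" if "R \<ge> R0" for R
    proof -
      from R0[OF that] have m: "(LINT x|lebesgue. indicator (cball 0 R) x * (norm (u x))\<^sup>2) > 1 / 2"
        and small: "R powr (8 / 3) * exp (- k * R powr (4 / 3)) \<le> v\<^sup>2 / (C * (1 + v\<^sup>2))" and R: "R \<ge> 2"
        by auto
      define I where "I = (LINT x:annulus R (R + 1)|lebesgue. (norm (u x))\<^sup>2)"
      define s where "s = k * R powr (4 / 3)"
      \<comment> \<open>The positive solution of \<open>8 l^3 (R + 1)^2 = 4 v^2\<close>.\<close>
      define l where "l = (v\<^sup>2 / (2 * (R + 1)\<^sup>2)) powr (1 / 3)"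
      have pos: "v\<^sup>2 / (2 * (R + 1)\<^sup>2) > 0" using v R by simp
      have "l ^ 3 = l powr 3" using pos unfolding l_def by (subst powr_numeral) auto
      also have "\<dots> = v\<^sup>2 / (2 * (R + 1)\<^sup>2)" using pos by (simp add: l_def powr_powr)
      finally have l3: "8 * l ^ 3 * (R + 1)\<^sup>2 = 4 * v\<^sup>2"
        using R by (simp add: field_simps)
      \<comment> \<open>Dropping the 2 in the denominator,
        \<open>l (R + 1)^2 \<le> k (R + 1)^(4/3) \<le> k (2 R)^(4/3)\<close>, and
        \<open>2^(4/3) \<le> 4\<close>.\<close>
      have ls: "l * (R + 1)\<^sup>2 \<le> 4 * s"
      proof -
        have "l \<le> (v\<^sup>2 / (R + 1)\<^sup>2) powr (1 / 3)"
          unfolding l_def using v R by (intro powr_mono2) (auto simp: divide_simps)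
        also have "\<dots> = k * (R + 1) powr (- 2 / 3)"
        proof -
          have sq: "(x\<^sup>2) powr (1 / 3) = x powr (2 / 3)" if "x > 0" for x :: real
          proof -
            have "(x\<^sup>2) powr (1 / 3) = (x powr 2) powr (1 / 3)"
              using that by (subst powr_numeral) auto
            then show ?thesis by (simp add: powr_powr)
          qed
          have "(v\<^sup>2 / (R + 1)\<^sup>2) powr (1 / 3) = (v\<^sup>2) powr (1 / 3) / ((R + 1)\<^sup>2) powr (1 / 3)"
            by (rule powr_divide)
          also have "\<dots> = k / (R + 1) powr (2 / 3)"
            using v R by (simp add: sq k_def)
          also have "\<dots> = k * (R + 1) powr (- 2 / 3)"
            unfolding divide_minus_left powr_minus by (rule divide_inverse)
          finally show ?thesis .
        qed
        finally have "l * (R + 1)\<^sup>2 \<le> k * (R + 1) powr (- 2 / 3) * (R + 1)\<^sup>2"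
          by (intro mult_right_mono) auto
        also have "\<dots> = k * (R + 1) powr (4 / 3)"
        proof -
          have "(R + 1)\<^sup>2 = (R + 1) powr 2" using R by (subst powr_numeral) auto
          moreover have "(R + 1) powr (- 2 / 3) * (R + 1) powr 2 = (R + 1) powr (4 / 3)"
            unfolding powr_add[symmetric] by simp
          ultimately show ?thesis by (simp only: mult.assoc)
        qed
        also have "\<dots> \<le> k * (2 * R) powr (4 / 3)"
          using R k by (intro mult_left_mono powr_mono2) auto
        also have "\<dots> = k * (2 powr (4 / 3) * R powr (4 / 3))"
          using R by (simp add: powr_mult)
        also have "\<dots> \<le> k * (4 * R powr (4 / 3))"
        proof -
          have "(2::real) powr (4 / 3) \<le> 2 powr 2" by (intro powr_mono) auto
          then show ?thesis using k by (intro mult_left_mono mult_right_mono) auto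
        qed
        finally show ?thesis by (simp add: s_def)
      qed
      have I0: "I \<ge> 0"
        unfolding I_def set_lebesgue_integral_def by (intro integral_nonneg_AE) auto
      have "v\<^sup>2 = 2 * v\<^sup>2 * (1 / 2)" by simp
      also have "\<dots> \<le> 2 * v\<^sup>2 * (LINT x|lebesgue. indicator (cball 0 R) x * (norm (u x))\<^sup>2)"
        using m by (intro mult_left_mono) auto
      also have "\<dots> \<le> C * R ^ 4 * exp (9 * l * (R + 1)\<^sup>2) * (1 + v\<^sup>2) * I"
        using bound[OF V(1) u(1,2) R _ l3[unfolded v_def]] unfolding v_def I_def l_def by simp
      also have "\<dots> \<le> C * R ^ 4 * exp (36 * s) * (1 + v\<^sup>2) * I"
        using ls C R I0 by (intro mult_right_mono mult_left_mono) auto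
      finally have 1: "v\<^sup>2 \<le> C * (1 + v\<^sup>2) * (R ^ 4 * exp (36 * s) * I)"
        by (simp add: mult_ac)
      have "v\<^sup>2 / (C * (1 + v\<^sup>2)) \<le> R ^ 4 * exp (36 * s) * I"
        using 1 C by (subst pos_divide_le_eq) (auto simp: mult.commute intro!: mult_pos_pos add_pos_nonneg)
      with small have 2: "R powr (8 / 3) * exp (- s) \<le> R ^ 4 * exp (36 * s) * I"
        by (simp add: s_def)
      \<comment> \<open>Split so that the last factor is the one bounded by \<open>2\<close>, while
        the others are the reciprocals of \<open>R^4\<close> and \<open>exp (36 s)\<close>.\<close>
      have "R powr (- 4 / 3) * exp (- 37 * s) = R powr (- 4) * exp (- 36 * s) * (R powr (8 / 3) * exp (- s))"
      proof -
        have "R powr (- 4 / 3) = R powr (- 4) * R powr (8 / 3)" "exp (- 37 * s) = exp (- 36 * s) * exp (- s)"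
          by (simp_all flip: powr_add exp_add)
        then show ?thesis by simp
      qed
      also have "\<dots> \<le> R powr (- 4) * exp (- 36 * s) * (R ^ 4 * exp (36 * s) * I)"
        using 2 by (intro mult_left_mono) auto
      also have "\<dots> = I"
      proof -
        have "R powr (- 4) * R ^ 4 = 1"
          using R by (simp add: powr_minus powr_numeral)
        moreover have "exp (- 36 * s) * exp (36 * s) = 1" by (simp flip: exp_add)
        moreover have "R powr (- 4) * exp (- 36 * s) * (R ^ 4 * exp (36 * s) * I) =
            (R powr (- 4) * R ^ 4) * (exp (- 36 * s) * exp (36 * s)) * I" by (simp only: mult_ac)
        ultimately show ?thesis by simp
      qed
      finally have "R powr (- 4 / 3) * exp (- 37 * s) \<le> I" .
      moreover have "inverse 37 * (R powr (- 4 / 3) * exp (- 37 * s)) \<le> 1 * (R powr (- 4 / 3) * exp (- 37 * s))"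
        by (intro mult_right_mono) auto
      ultimately have "inverse 37 * (R powr (- 4 / 3) * exp (- 37 * s)) \<le> I"
        by linarith
      then show ?thesis
        unfolding I_def s_def k_def by (simp only: mult.assoc)
    qed
    then show ?thesis
      unfolding v_def by (intro exI[of _ "max R0 1"]) auto
  qed
  then show ?thesis
    by (intro exI[of _ 37]) auto
qed

end
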